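(* Let $\lambda$ be a dominant weight, $\Gamma=(\beta_1,\dots,\beta_m)$ a $\lambda$-chain, and $J\subseteq[m]$ an admissible subset. Let $p\in\{0,1,\dots,r\}$. If $f_p(J)\neq\mathbf 0$, then $f_p(J)$ is an admissible subset. Similarly, if $e_p(J)\neq\mathbf 0$, then $e_p(J)$ is an admissible subset.
   Context: Let $\Phi$ be an irreducible finite root system in a real Euclidean space $V$ with inner product $\langle\cdot,\cdot\rangle$, positive roots $\Phi^+$, simple roots $\alpha_1,\dots,\alpha_r$, Weyl group $W$ with length function $\ell$, highest root $\tilde\alpha$, and $\rho=\frac12\sum_{\alpha\in\Phi^+}\alpha$. Write $\alpha^\vee=2\alpha/\langle\alpha,\alpha\rangle$, $s_\alpha$ for the reflection in $\alpha$, and $\alpha_0:=\theta:=-\tilde\alpha$. For a root $\alpha$ write $\alpha>0$ if $\alpha\in\Phi^+$, $\alpha<0$ otherwise, $\mathrm{sgn}(\alpha)=1$ or $-1$ accordingly, and $|\alpha|=\mathrm{sgn}(\alpha)\alpha$. The quantum Bruhat graph on $W$ has a directed edge $w\xrightarrow{\alpha}ws_\alpha$ ($\alpha\in\Phi^+$) whenever $\ell(ws_\alpha)=\ell(w)+1$ or $\ell(ws_\alpha)=\ell(w)-2\langle\rho,\alpha^\vee\rangle+1$. For $\alpha\in\Phi$, $k\in\mathbb Z$ let $H_{\alpha,k}=\{x\in V:\langle x,\alpha^\vee\rangle=k\}$ and $s_{\alpha,k}$ the affine reflection in it. Alcoves are the connected components of the complement of all $H_{\alpha,k}$; $A_\circ=\{x:0<\langle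 x,\alpha^\vee\rangle<1\ \forall\alpha\in\Phi^+\}$. Two alcoves are adjacent if distinct with a common wall. For a dominant weight $\lambda$, a $\lambda$-chain is a sequence of positive roots $(\beta_1,\dots,\beta_m)$ such that there is an alcove path $A_\circ=A_0,A_1,\dots,A_m=A_\circ-\lambda$ of minimal length among all such paths, with consecutive alcoves adjacent, the common wall of $A_{i-1},A_i$ lying in some $H_{\beta_i,k}$ and $-\beta_i$ pointing from $A_{i-1}$ to $A_i$. Fix $\lambda$ and $\Gamma$. Set $r_i=s_{\beta_i}$, $l_i=\#\{j<i:\beta_j=\beta_i\}$, $\hat r_i=s_{\beta_i,-l_i}$. For $J=\{j_1<\dots<j_s\}\subseteq[m]$ and $k\in[m]$ let $\gamma_k=r_{j_1}\cdots r_{j_p}(\beta_k)$ where $j_p$ is the largest element of $J$ less than $k$ (empty product if none), $\gamma_\infty=r_{j_1}\cdots r_{j_s}(\rho)$, and define the integer $l^\Delta_k$ by $H_{|\gamma_k|,-l^\Delta_k}=\hat r_{j_1}\cdots\hat r_{j_p}(H_{\beta_k,-l_k})$. Put $\mu(J)=-\hat r_{j_1}\cdots\hat r_{j_s}(-\lambda)$. $J$ is admissible if $1\xrightarrow{\beta_{j_1}}r_{j_1}\xrightarrow{\beta_{j_2}}r_{j_1}r_{j_2}\to\cdots\xrightarrow{\beta_{j_s}}r_{j_1}\cdots r_{j_s}$ is a path in the quantum Bruhat graph. Let $\varepsilon_i=1$ if $i\notin J$ and $\varepsilon_i=-1$ if $i\in J$. For a root $\alpha$ let $I_\alpha=\{i\in[m]:\gamma_i=\pm\alpha\}$,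 $\hat I_\alpha=I_\alpha\cup\{\infty\}$ ($\infty$ larger than everything), and for the index $\infty$ set $l^\Delta_\infty:=\langle\mu(J),\mathrm{sgn}(\alpha)\alpha^\vee\rangle$. Writing $I_\alpha=\{i_1<\dots<i_n\}$, for $\alpha>0$ let $g_\alpha:[0,n+\frac12]\to\mathbb R$ be the continuous piecewise-linear function with $g_\alpha(0)=-\frac12$ and slope $\mathrm{sgn}(\gamma_{i_k})$ on $(k-1,k-\frac12)$, $\varepsilon_{i_k}\mathrm{sgn}(\gamma_{i_k})$ on $(k-\frac12,k)$ ($1\le k\le n$), and $\mathrm{sgn}\langle\gamma_\infty,\alpha^\vee\rangle$ on $(n,n+\frac12)$; for $\alpha<0$ let $g_\alpha=-g_{-\alpha}$. (It is known that $\mathrm{sgn}(\alpha)l^\Delta_{i_k}=g_\alpha(k-\frac12)$ and $\langle\mu(J),\alpha^\vee\rangle=g_\alpha(n+\frac12)$.) Crystal operators: for $p\in\{0,\dots,r\}$ let $M=\max g_{\alpha_p}$. For $f_p$: let $m$ be the minimal $i\in\hat I_{\alpha_p}$ with $\mathrm{sgn}(\alpha_p)l^\Delta_i=M$; if $M>\delta_{p,0}$ then (for admissible $J$) $m$ has a predecessor $k$ in $\hat I_{\alpha_p}$ and $f_p(J)=(J\setminus\{m\})\cup\{k\}$; otherwise $f_p(J)=\mathbf 0$. For $e_p$: let $k$ be the maximal $i\in I_{\alpha_p}$ with $\mathrm{sgn}(\alpha_p)l^\Delta_i=M$ and $m$ its successor in $\hat I_{\alpha_p}$; $e_p(J)=(J\setminus\{k\})\cup\{m\}$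 if $M>\langle\mu(J),\alpha_p^\vee\rangle$ and $M\ge\delta_{p,0}$, else $e_p(J)=\mathbf 0$. Convention: $J\setminus\{\infty\}=J\cup\{\infty\}=J$. *)

theory Defs
  imports "HOL-Analysis.Analysis" "HOL-Library.Extended_Nat"
begin

section \<open>Root systems and Weyl groups\<close>

definition coroot :: "'a::euclidean_space \<Rightarrow> 'a" where
  "coroot a = (2 / (a \<bullet> a)) *\<^sub>R a"

definition reflection :: "'a::euclidean_space \<Rightarrow> 'a \<Rightarrow> 'a" where
  "reflection a x = x - (x \<bullet> coroot a) *\<^sub>R a"

text \<open>Root systems are reduced, crystallographic, and span the ambient space.\<close>

definition root_system :: "'a::euclidean_space set \<Rightarrow> bool" where
  "root_system \<Phi> \<longleftrightarrow>
     finite \<Phi> \<and> 0 \<notin> \<Phi> \<and> span \<Phi> = UNIV \<and>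
     (\<forall>a\<in>\<Phi>. reflection a ` \<Phi> = \<Phi>) \<and>
     (\<forall>a\<in>\<Phi>. \<forall>b\<in>\<Phi>. b \<bullet> coroot a \<in> \<int>) \<and>
     (\<forall>a\<in>\<Phi>. \<forall>c. c *\<^sub>R a \<in> \<Phi> \<longrightarrow> c = 1 \<or> c = -1)"

definition irreducible_root_system :: "'a::euclidean_space set \<Rightarrow> bool" where
  "irreducible_root_system \<Phi> \<longleftrightarrow>
     root_system \<Phi> \<and> \<Phi> \<noteq> {} \<and>
     \<not> (\<exists>S T. S \<noteq> {} \<and> T \<noteq> {} \<and> S \<union> T = \<Phi> \<and> S \<inter> T = {} \<and> (\<forall>a\<in>S. \<forall>b\<in>T. a \<bullet> b = 0))"

text \<open>
  The simple roots are \<open>\<alpha> 1, \<dots>, \<alpha> r\<close>. Since a root system spans the ambient space, the rank \<open>r\<close>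
  is \<open>DIM('a)\<close>. The value \<open>\<alpha> 0\<close> is irrelevant; see \<open>affine_simple_root\<close> below for the root
  indexed by 0.
\<close>

definition nonneg_comb :: "(nat \<Rightarrow> 'a::euclidean_space) \<Rightarrow> 'a \<Rightarrow> bool" where
  "nonneg_comb \<alpha> x \<longleftrightarrow> (\<exists>c :: nat \<Rightarrow> nat. x = (\<Sum>i=1..DIM('a). real (c i) *\<^sub>R \<alpha> i))"

definition simple_roots :: "'a::euclidean_space set \<Rightarrow> (nat \<Rightarrow> 'a) \<Rightarrow> bool" where
  "simple_roots \<Phi> \<alpha> \<longleftrightarrow>
     \<alpha> ` {1..DIM('a)} \<subseteq> \<Phi> \<and> inj_on \<alpha> {1..DIM('a)} \<and> independent (\<alpha> ` {1..DIM('a)}) \<and>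
     (\<forall>b\<in>\<Phi>. nonneg_comb \<alpha> b \<or> nonneg_comb \<alpha> (- b))"

definition pos_roots :: "'a::euclidean_space set \<Rightarrow> (nat \<Rightarrow> 'a) \<Rightarrow> 'a set" where
  "pos_roots \<Phi> \<alpha> = {b \<in> \<Phi>. nonneg_comb \<alpha> b}"

definition rho :: "'a::euclidean_space set \<Rightarrow> (nat \<Rightarrow> 'a) \<Rightarrow> 'a" where
  "rho \<Phi> \<alpha> = (1 / 2) *\<^sub>R (\<Sum>a\<in>pos_roots \<Phi> \<alpha>. a)"

definition highest_root :: "'a::euclidean_space set \<Rightarrow> (nat \<Rightarrow> 'a) \<Rightarrow> 'a" where
  "highest_root \<Phi> \<alpha> = (THE h. h \<in> \<Phi> \<and> (\<forall>b\<in>\<Phi>. nonneg_comb \<alpha> (h - b)))"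

definition affine_simple_root :: "'a::euclidean_space set \<Rightarrow> (nat \<Rightarrow> 'a) \<Rightarrow> nat \<Rightarrow> 'a" where
  "affine_simple_root \<Phi> \<alpha> p = (if p = 0 then - highest_root \<Phi> \<alpha> else \<alpha> p)"

definition root_sgn :: "'a::euclidean_space set \<Rightarrow> (nat \<Rightarrow> 'a) \<Rightarrow> 'a \<Rightarrow> real" where
  "root_sgn \<Phi> \<alpha> a = (if a \<in> pos_roots \<Phi> \<alpha> then 1 else -1)"

definition root_abs :: "'a::euclidean_space set \<Rightarrow> (nat \<Rightarrow> 'a) \<Rightarrow> 'a \<Rightarrow> 'a" where
  "root_abs \<Phi> \<alpha> a = root_sgn \<Phi> \<alpha> a *\<^sub>R a"

definition comp_list :: "('a \<Rightarrow> 'a) list \<Rightarrow> 'a \<Rightarrow> 'a" where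
  "comp_list fs = foldr (\<circ>) fs id"

definition weyl_group :: "'a::euclidean_space set \<Rightarrow> ('a \<Rightarrow> 'a) set" where
  "weyl_group \<Phi> = {comp_list (map reflection as) | as. set as \<subseteq> \<Phi>}"

definition weyl_length :: "(nat \<Rightarrow> 'a::euclidean_space) \<Rightarrow> ('a \<Rightarrow> 'a) \<Rightarrow> nat" where
  "weyl_length \<alpha> w =
     (LEAST n. \<exists>is. length is = n \<and> set is \<subseteq> {1..DIM('a)} \<and>
        w = comp_list (map (\<lambda>i. reflection (\<alpha> i)) is))"

definition qbg_edge ::
  "'a::euclidean_space set \<Rightarrow> (nat \<Rightarrow> 'a) \<Rightarrow> ('a \<Rightarrow> 'a) \<Rightarrow> 'a \<Rightarrow> ('a \<Rightarrow> 'a) \<Rightarrow> bool" where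
  "qbg_edge \<Phi> \<alpha> w a w' \<longleftrightarrow>
     w \<in> weyl_group \<Phi> \<and> a \<in> pos_roots \<Phi> \<alpha> \<and> w' = w \<circ> reflection a \<and>
     (weyl_length \<alpha> w' = weyl_length \<alpha> w + 1 \<or>
      real (weyl_length \<alpha> w') = real (weyl_length \<alpha> w) - 2 * (rho \<Phi> \<alpha> \<bullet> coroot a) + 1)"

definition dominant_weight :: "'a::euclidean_space set \<Rightarrow> (nat \<Rightarrow> 'a) \<Rightarrow> 'a \<Rightarrow> bool" where
  "dominant_weight \<Phi> \<alpha> lam \<longleftrightarrow>
     (\<forall>a\<in>\<Phi>. lam \<bullet> coroot a \<in> \<int>) \<and> (\<forall>a\<in>pos_roots \<Phi> \<alpha>. 0 \<le> lam \<bullet> coroot a)"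

section \<open>Alcoves and chains of roots\<close>

definition hyp :: "'a::euclidean_space \<Rightarrow> int \<Rightarrow> 'a set" where
  "hyp a k = {x. x \<bullet> coroot a = real_of_int k}"

definition aff_reflection :: "'a::euclidean_space \<Rightarrow> int \<Rightarrow> 'a \<Rightarrow> 'a" where
  "aff_reflection a k x = x - (x \<bullet> coroot a - real_of_int k) *\<^sub>R a"

definition alcoves :: "'a::euclidean_space set \<Rightarrow> 'a set set" where
  "alcoves \<Phi> = components (- (\<Union>a\<in>\<Phi>. \<Union>k. hyp a k))"

definition fund_alcove :: "'a::euclidean_space set \<Rightarrow> (nat \<Rightarrow> 'a) \<Rightarrow> 'a set" where
  "fund_alcove \<Phi> \<alpha> = {x. \<forall>a\<in>pos_roots \<Phi> \<alpha>. 0 < x \<bullet> coroot a \<and> x \<bullet> coroot a < 1}"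

text \<open>
  A wall is a facet of the closed alcove, not the hyperplane it spans: distinct alcoves may have
  facets in the same hyperplane without being adjacent.
\<close>

definition common_wall :: "'a::euclidean_space set \<Rightarrow> 'a set \<Rightarrow> 'a set \<Rightarrow> bool" where
  "common_wall F A B \<longleftrightarrow> F facet_of closure A \<and> F facet_of closure B"

definition adjacent :: "'a::euclidean_space set \<Rightarrow> 'a set \<Rightarrow> bool" where
  "adjacent A B \<longleftrightarrow> A \<noteq> B \<and> (\<exists>F. common_wall F A B)"

definition alcove_path ::
  "'a::euclidean_space set \<Rightarrow> 'a set \<Rightarrow> 'a set \<Rightarrow> nat \<Rightarrow> (nat \<Rightarrow> 'a set) \<Rightarrow> bool" where
  "alcove_path \<Phi> A B m P \<longleftrightarrow>
     P 0 = A \<and> P m = B \<and> (\<forall>i\<le>m. P i \<in> alcoves \<Phi>) \<and> (\<forall>i<m. adjacent (P i) (P (Suc i)))"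

text \<open>
  The chain is \<open>\<beta> 1, \<dots>, \<beta> m\<close>. The last conjunct below says that \<open>- \<beta> i\<close> points from \<open>P (i - 1)\<close>
  to \<open>P i\<close>, i.e. that these alcoves lie on the positive and the negative side of the hyperplane
  containing their common wall, respectively.
\<close>

definition lambda_chain ::
  "'a::euclidean_space set \<Rightarrow> (nat \<Rightarrow> 'a) \<Rightarrow> 'a \<Rightarrow> nat \<Rightarrow> (nat \<Rightarrow> 'a) \<Rightarrow> bool" where
  "lambda_chain \<Phi> \<alpha> lam m \<beta> \<longleftrightarrow>
     (\<forall>i\<in>{1..m}. \<beta> i \<in> pos_roots \<Phi> \<alpha>) \<and>
     (let A = fund_alcove \<Phi> \<alpha>; B = (\<lambda>x. x - lam) ` A in
        \<exists>P. alcove_path \<Phi> A B m P \<and>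
            (\<forall>m' P'. alcove_path \<Phi> A B m' P' \<longrightarrow> m \<le> m') \<and>
            (\<forall>i\<in>{1..m}. \<exists>F k. common_wall F (P (i - 1)) (P i) \<and> F \<subseteq> hyp (\<beta> i) k \<and>
               (\<forall>x\<in>P (i - 1). x \<bullet> coroot (\<beta> i) > real_of_int k) \<and>
               (\<forall>x\<in>P i. x \<bullet> coroot (\<beta> i) < real_of_int k)))"

section \<open>The quantum alcove model\<close>

definition chain_level :: "(nat \<Rightarrow> 'a::euclidean_space) \<Rightarrow> nat \<Rightarrow> int" where
  "chain_level \<beta> i = int (card {j \<in> {1..<i}. \<beta> j = \<beta> i})"

text \<open>Products are taken over a finite index set in increasing order, leftmost factor smallest.\<close>

definition refl_prod :: "(nat \<Rightarrow> 'a::euclidean_space) \<Rightarrow> nat set \<Rightarrow> 'a \<Rightarrow> 'a" where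
  "refl_prod \<beta> S = comp_list (map (\<lambda>j. reflection (\<beta> j)) (sorted_list_of_set S))"

definition aff_refl_prod :: "(nat \<Rightarrow> 'a::euclidean_space) \<Rightarrow> nat set \<Rightarrow> 'a \<Rightarrow> 'a" where
  "aff_refl_prod \<beta> S =
     comp_list (map (\<lambda>j. aff_reflection (\<beta> j) (- chain_level \<beta> j)) (sorted_list_of_set S))"

definition gam :: "(nat \<Rightarrow> 'a::euclidean_space) \<Rightarrow> nat set \<Rightarrow> nat \<Rightarrow> 'a" where
  "gam \<beta> J k = refl_prod \<beta> {j \<in> J. j < k} (\<beta> k)"

definition gam_inf ::
  "'a::euclidean_space set \<Rightarrow> (nat \<Rightarrow> 'a) \<Rightarrow> (nat \<Rightarrow> 'a) \<Rightarrow> nat set \<Rightarrow> 'a" where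
  "gam_inf \<Phi> \<alpha> \<beta> J = refl_prod \<beta> J (rho \<Phi> \<alpha>)"

definition fold_level ::
  "'a::euclidean_space set \<Rightarrow> (nat \<Rightarrow> 'a) \<Rightarrow> (nat \<Rightarrow> 'a) \<Rightarrow> nat set \<Rightarrow> nat \<Rightarrow> int" where
  "fold_level \<Phi> \<alpha> \<beta> J k =
     (THE l. hyp (root_abs \<Phi> \<alpha> (gam \<beta> J k)) (- l) =
        aff_refl_prod \<beta> {j \<in> J. j < k} ` hyp (\<beta> k) (- chain_level \<beta> k))"

definition fold_weight :: "'a::euclidean_space \<Rightarrow> (nat \<Rightarrow> 'a) \<Rightarrow> nat set \<Rightarrow> 'a" where
  "fold_weight lam \<beta> J = - aff_refl_prod \<beta> J (- lam)"

definition admissible ::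
  "'a::euclidean_space set \<Rightarrow> (nat \<Rightarrow> 'a) \<Rightarrow> nat \<Rightarrow> (nat \<Rightarrow> 'a) \<Rightarrow> nat set \<Rightarrow> bool" where
  "admissible \<Phi> \<alpha> m \<beta> J \<longleftrightarrow>
     J \<subseteq> {1..m} \<and>
     (let js = sorted_list_of_set J; w = (\<lambda>q. comp_list (map (\<lambda>j. reflection (\<beta> j)) (take q js)))
      in \<forall>q<length js. qbg_edge \<Phi> \<alpha> (w q) (\<beta> (js ! q)) (w (Suc q)))"

definition ind_set ::
  "nat \<Rightarrow> (nat \<Rightarrow> 'a::euclidean_space) \<Rightarrow> nat set \<Rightarrow> 'a \<Rightarrow> nat set" where
  "ind_set m \<beta> J a = {i \<in> {1..m}. gam \<beta> J i = a \<or> gam \<beta> J i = - a}"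

definition ind_set_hat ::
  "nat \<Rightarrow> (nat \<Rightarrow> 'a::euclidean_space) \<Rightarrow> nat set \<Rightarrow> 'a \<Rightarrow> enat set" where
  "ind_set_hat m \<beta> J a = insert \<infinity> (enat ` ind_set m \<beta> J a)"

text \<open>The value \<open>sgn(a) l\<^sup>\<Delta>\<^sub>i\<close> for an index \<open>i\<close> in \<open>ind_set_hat m \<beta> J a\<close>.\<close>

definition signed_level ::
  "'a::euclidean_space set \<Rightarrow> (nat \<Rightarrow> 'a) \<Rightarrow> 'a \<Rightarrow> (nat \<Rightarrow> 'a) \<Rightarrow> nat set \<Rightarrow> 'a \<Rightarrow> enat \<Rightarrow> real" where
  "signed_level \<Phi> \<alpha> lam \<beta> J a i = root_sgn \<Phi> \<alpha> a *
     (case i of enat k \<Rightarrow> real_of_int (fold_level \<Phi> \<alpha> \<beta> J k)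
              | \<infinity> \<Rightarrow> fold_weight lam \<beta> J \<bullet> (root_sgn \<Phi> \<alpha> a *\<^sub>R coroot a))"

definition fold_sign :: "nat set \<Rightarrow> nat \<Rightarrow> real" where
  "fold_sign J i = (if i \<in> J then -1 else 1)"

text \<open>
  \<open>g_slope \<dots> a q\<close> is the slope of \<open>g\<^sub>a\<close> on the interval \<open>(q/2, (q+1)/2)\<close>, for \<open>0 \<le> q \<le> 2n\<close>
  with \<open>n\<close> the cardinality of \<open>ind_set m \<beta> J a\<close>. The list of indices is numbered from 0, so that its
  entry \<open>q div 2\<close> is \<open>i\<^sub>k\<close> for \<open>k = q div 2 + 1\<close>.
\<close>

definition g_slope ::
  "'a::euclidean_space set \<Rightarrow> (nat \<Rightarrow> 'a) \<Rightarrow> nat \<Rightarrow> (nat \<Rightarrow> 'a) \<Rightarrow> nat set \<Rightarrow> 'a \<Rightarrow> nat \<Rightarrow> real" where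
  "g_slope \<Phi> \<alpha> m \<beta> J a q =
     (let I = ind_set m \<beta> J a; i = sorted_list_of_set I ! (q div 2) in
      if q < 2 * card I
      then (if even q then 1 else fold_sign J i) * root_sgn \<Phi> \<alpha> (gam \<beta> J i)
      else sgn (gam_inf \<Phi> \<alpha> \<beta> J \<bullet> coroot a))"

text \<open>
  The continuous piecewise-linear function with value \<open>-1/2\<close> at 0 and slopes \<open>g_slope\<close>, written
  as an explicit sum; it is only meaningful on \<open>[0, n + 1/2]\<close>.
\<close>

definition g_pos ::
  "'a::euclidean_space set \<Rightarrow> (nat \<Rightarrow> 'a) \<Rightarrow> nat \<Rightarrow> (nat \<Rightarrow> 'a) \<Rightarrow> nat set \<Rightarrow> 'a \<Rightarrow> real \<Rightarrow> real" where
  "g_pos \<Phi> \<alpha> m \<beta> J a x =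
     - 1/2 + (\<Sum>q\<le>2 * card (ind_set m \<beta> J a).
                g_slope \<Phi> \<alpha> m \<beta> J a q * max 0 (min (1/2) (x - real q / 2)))"

lemma g_pos_0: "g_pos \<Phi> \<alpha> m \<beta> J a 0 = - 1/2"
  by (auto simp: g_pos_def intro!: sum.neutral)

lemma continuous_g_pos: "continuous_on UNIV (g_pos \<Phi> \<alpha> m \<beta> J a)"
  unfolding g_pos_def by (intro continuous_intros)

lemma g_pos_slope:
  assumes "q \<le> 2 * card (ind_set m \<beta> J a)"
    and "real q / 2 \<le> x" "x \<le> y" "y \<le> (real q + 1) / 2"
  shows "g_pos \<Phi> \<alpha> m \<beta> J a y - g_pos \<Phi> \<alpha> m \<beta> J a x = g_slope \<Phi> \<alpha> m \<beta> J a q * (y - x)"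
proof -
  let ?c = "\<lambda>z (p::nat). max 0 (min (1/2) (z - real p / 2))"
  have "?c y p - ?c x p = (if p = q then y - x else 0)" for p
  proof -
    consider "p = q" | "real p + 1 \<le> real q" | "real q + 1 \<le> real p" by linarith
    then show ?thesis using assms(2-4) by cases (auto simp: max_def min_def field_simps)
  qed
  then have "g_slope \<Phi> \<alpha> m \<beta> J a p * ?c y p - g_slope \<Phi> \<alpha> m \<beta> J a p * ?c x p =
      (if p = q then g_slope \<Phi> \<alpha> m \<beta> J a q * (y - x) else 0)" for p
    by (auto simp: right_diff_distrib[symmetric])
  then show ?thesis
    using assms(1) by (simp add: g_pos_def sum_subtractf[symmetric])
qed

definition g_fun ::
  "'a::euclidean_space set \<Rightarrow> (nat \<Rightarrow> 'a) \<Rightarrow> nat \<Rightarrow> (nat \<Rightarrow> 'a) \<Rightarrow> nat set \<Rightarrow> 'a \<Rightarrow> real \<Rightarrow> real" where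
  "g_fun \<Phi> \<alpha> m \<beta> J a x =
     (if a \<in> pos_roots \<Phi> \<alpha> then g_pos \<Phi> \<alpha> m \<beta> J a x else - g_pos \<Phi> \<alpha> m \<beta> J (- a) x)"

text \<open>The maximum of \<open>g\<^sub>a\<close>; the supremum is attained by continuity.\<close>

definition g_max ::
  "'a::euclidean_space set \<Rightarrow> (nat \<Rightarrow> 'a) \<Rightarrow> nat \<Rightarrow> (nat \<Rightarrow> 'a) \<Rightarrow> nat set \<Rightarrow> 'a \<Rightarrow> real" where
  "g_max \<Phi> \<alpha> m \<beta> J a =
     Sup (g_fun \<Phi> \<alpha> m \<beta> J a ` {0 .. real (card (ind_set m \<beta> J a)) + 1/2})"

text \<open>
  \<open>exchange J i j\<close> is \<open>(J \ {i}) \<union> {j}\<close>, where by convention removing or adding \<open>\<infinity>\<close> has no effect.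
\<close>

definition exchange :: "nat set \<Rightarrow> enat \<Rightarrow> enat \<Rightarrow> nat set" where
  "exchange J i j = {n. enat n \<in> (enat ` J - {i}) \<union> {j}}"

text \<open>The value \<open>None\<close> represents the symbol \<open>\<zero>\<close>.\<close>

definition f_op ::
  "'a::euclidean_space set \<Rightarrow> (nat \<Rightarrow> 'a) \<Rightarrow> 'a \<Rightarrow> nat \<Rightarrow> (nat \<Rightarrow> 'a) \<Rightarrow> nat \<Rightarrow> nat set \<Rightarrow> nat set option"
where
  "f_op \<Phi> \<alpha> lam m \<beta> p J =
     (let a = affine_simple_root \<Phi> \<alpha> p;
          I = ind_set_hat m \<beta> J a;
          M = g_max \<Phi> \<alpha> m \<beta> J a;
          i = (LEAST i. i \<in> I \<and> signed_level \<Phi> \<alpha> lam \<beta> J a i = M);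
          k = Max {k \<in> I. k < i}
      in if M > of_bool (p = 0) then Some (exchange J i k) else None)"

definition e_op ::
  "'a::euclidean_space set \<Rightarrow> (nat \<Rightarrow> 'a) \<Rightarrow> 'a \<Rightarrow> nat \<Rightarrow> (nat \<Rightarrow> 'a) \<Rightarrow> nat \<Rightarrow> nat set \<Rightarrow> nat set option"
where
  "e_op \<Phi> \<alpha> lam m \<beta> p J =
     (let a = affine_simple_root \<Phi> \<alpha> p;
          I = ind_set_hat m \<beta> J a;
          M = g_max \<Phi> \<alpha> m \<beta> J a;
          k = Max {i \<in> I - {\<infinity>}. signed_level \<Phi> \<alpha> lam \<beta> J a i = M};
          i = Min {i \<in> I. k < i}
      in if M > fold_weight lam \<beta> J \<bullet> coroot a \<and> M \<ge> of_bool (p = 0)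
         then Some (exchange J k i) else None)"

end

(*
  An admissible subset J is a path in the quantum Bruhat graph, and applying f_p or e_p multiplies a
  segment of it on the left by s_a, where a = alpha_p. Put d = w^-1(a). The exact formula
  l(s_a w) = l(w) + sgn(d) (minus 2<rho, d^vee> if p = 0) shows that w -> s_a w is an edge if d > 0,
  that an edge w -> w s_b not labelled by +-d is carried to an edge by s_a if the sign of d does not
  change along it, and that d can only change from positive to negative along the edge w -> s_a w.
  For p = 0 this rests on <c, h^vee> being 0 or 1 for a positive root c other than the highest root h.

  The sign of d along the path is the slope of g_a. At the first maximum m of g_a and its predecessor k,
  the slopes force k to be outside J and m to be in J or infinite, with d > 0 all the way from k to m;
  for e_p the last maximum plays this role, with d < 0 after it. That the levels l^Delta are values of g_a
  is seen by following the strips, orthogonal to a, that contain the alcoves of the folded path.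
*)

theory Submission
  imports Defs
begin

subsection \<open>Reflections\<close>

lemma inner_coroot: "x \<bullet> coroot a = 2 * (x \<bullet> a) / (a \<bullet> a)"
  by (simp add: coroot_def)

lemma inner_coroot_self: "a \<noteq> 0 \<Longrightarrow> a \<bullet> coroot a = 2"
  by (simp add: inner_coroot)

lemma coroot_minus [simp]: "coroot (- a) = - coroot a"
  by (simp add: coroot_def)

lemma reflection_minus [simp]: "reflection (- a) = reflection a"
  by (rule ext) (simp add: reflection_def)

lemma reflection_self: "a \<noteq> 0 \<Longrightarrow> reflection a a = - a"
  by (simp add: reflection_def inner_coroot_self scaleR_2)

lemma linear_reflection: "linear (reflection a)"
  by (rule linearI) (simp_all add: reflection_def inner_left_distrib algebra_simps)

lemma inner_reflection: "reflection a x \<bullet> reflection a y = x \<bullet> y"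
  by (cases "a = 0")
    (simp_all add: reflection_def inner_coroot inner_diff_left inner_diff_right inner_commute field_simps)

lemma orthogonal_reflection: "orthogonal_transformation (reflection a)"
  by (simp add: orthogonal_transformation_def linear_reflection inner_reflection)

lemma reflection_reflection [simp]: "reflection a (reflection a x) = x"
  by (cases "a = 0") (simp_all add: reflection_def inner_coroot inner_diff_left)

lemma reflection_o_reflection [simp]: "reflection a \<circ> reflection a = id"
  by (rule ext) simp

lemma reflection_o_left [simp]: "reflection a \<circ> (reflection a \<circ> f) = f"
  by (rule ext) simp

lemma reflection_o_right [simp]: "f \<circ> reflection a \<circ> reflection a = f"
  by (rule ext) simp

lemma inv_reflection [simp]: "inv (reflection a) = reflection a"
  by (intro inv_unique_comp) simp_all

lemma bij_reflection: "bij (reflection a)"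
  by (intro o_bij[of "reflection a"]) simp_all

lemma reflection_uminus: "reflection a (- x) = - reflection a x"
  by (simp add: linear_neg[OF linear_reflection])

lemma coroot_orthogonal:
  "orthogonal_transformation w \<Longrightarrow> coroot (w a) = w (coroot a)"
  by (simp add: coroot_def orthogonal_transformation_def linear_cmul)

lemma orthogonal_reflection_conj:
  assumes "orthogonal_transformation w"
  shows "w (reflection a x) = reflection (w a) (w x)"
  using assms
  by (simp add: reflection_def coroot_orthogonal orthogonal_transformation_def linear_diff linear_cmul)

lemma coroot_reflection: "coroot (reflection b a) = coroot a - (b \<bullet> coroot a) *\<^sub>R coroot b"
  by (simp add: coroot_orthogonal[OF orthogonal_reflection])
    (simp add: reflection_def coroot_def inner_commute)

lemma inner_reflection_left: "reflection a x \<bullet> y = x \<bullet> reflection a y"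
  by (metis inner_reflection reflection_reflection)

lemma comp_list_Nil [simp]: "comp_list [] = id"
  by (simp add: comp_list_def)

lemma comp_list_Cons [simp]: "comp_list (f # fs) = f \<circ> comp_list fs"
  by (simp add: comp_list_def)

lemma comp_list_append: "comp_list (fs @ gs) = comp_list fs \<circ> comp_list gs"
  by (induction fs) (simp_all add: comp_assoc)

locale root_base =
  fixes \<Phi> :: "'a::euclidean_space set" and \<alpha> :: "nat \<Rightarrow> 'a" and Ix :: "nat set"
  assumes irr: "irreducible_root_system \<Phi>" and simple: "simple_roots \<Phi> \<alpha>"
    and Ix: "Ix = {1..DIM('a)}"
begin

abbreviation "pos \<equiv> pos_roots \<Phi> \<alpha>"
abbreviation "sg \<equiv> root_sgn \<Phi> \<alpha>"
abbreviation "nn \<equiv> nonneg_comb \<alpha>"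

lemma roots: "root_system \<Phi>"
  using irr by (simp add: irreducible_root_system_def)

lemma finite_roots: "finite \<Phi>" and zero_notin_roots: "0 \<notin> \<Phi>"
  and reflection_roots: "a \<in> \<Phi> \<Longrightarrow> b \<in> \<Phi> \<Longrightarrow> reflection a b \<in> \<Phi>"
  and inner_coroot_Ints: "a \<in> \<Phi> \<Longrightarrow> b \<in> \<Phi> \<Longrightarrow> b \<bullet> coroot a \<in> \<int>"
  and reduced: "a \<in> \<Phi> \<Longrightarrow> c *\<^sub>R a \<in> \<Phi> \<Longrightarrow> c = 1 \<or> c = -1"
  using roots by (auto simp: root_system_def)

lemma root_nonzero: "a \<in> \<Phi> \<Longrightarrow> a \<noteq> 0"
  using zero_notin_roots by auto

lemma root_inner_pos: "a \<in> \<Phi> \<Longrightarrow> 0 < a \<bullet> a"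
  using root_nonzero by auto

lemma minus_root: "a \<in> \<Phi> \<Longrightarrow> - a \<in> \<Phi>"
  using reflection_roots[of a a] by (simp add: reflection_self root_nonzero)

lemma minus_root_iff [simp]: "- a \<in> \<Phi> \<longleftrightarrow> a \<in> \<Phi>"
  using minus_root[of a] minus_root[of "- a"] by auto

lemma simple_root: "i \<in> Ix \<Longrightarrow> \<alpha> i \<in> \<Phi>"
  and inj_simple: "inj_on \<alpha> Ix" and indep_simple: "independent (\<alpha> ` Ix)"
  and nn_cases: "b \<in> \<Phi> \<Longrightarrow> nn b \<or> nn (- b)"
  using simple by (auto simp: simple_roots_def Ix)

lemma finite_Ix [simp]: "finite Ix"
  by (simp add: Ix)

lemma span_simple: "span (\<alpha> ` Ix) = UNIV"
  using card_ge_dim_independent[of "\<alpha> ` Ix" UNIV] indep_simple inj_simple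
  by (auto simp: card_image Ix)

definition coord :: "nat \<Rightarrow> 'a \<Rightarrow> real" where
  "coord i x = representation (\<alpha> ` Ix) x (\<alpha> i)"

lemma coord_add: "coord i (x + y) = coord i x + coord i y"
  and coord_diff: "coord i (x - y) = coord i x - coord i y"
  and coord_scaleR: "coord i (c *\<^sub>R x) = c * coord i x"
  and coord_minus: "coord i (- x) = - coord i x"
  and coord_zero [simp]: "coord i 0 = 0"
  by (simp_all add: coord_def representation_add representation_diff representation_scale
      representation_neg representation_zero indep_simple span_simple)

lemma coord_sum: "coord i (sum f A) = (\<Sum>x\<in>A. coord i (f x))"
  by (induction A rule: infinite_finite_induct) (simp_all add: coord_add)

lemma coord_simple: "i \<in> Ix \<Longrightarrow> j \<in> Ix \<Longrightarrow> coord i (\<alpha> j) = of_bool (i = j)"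
  using inj_simple by (auto simp: coord_def representation_basis indep_simple dest: inj_onD)

lemma coord_expand: "x = (\<Sum>i\<in>Ix. coord i x *\<^sub>R \<alpha> i)"
proof -
  have "x = (\<Sum>b\<in>\<alpha> ` Ix. representation (\<alpha> ` Ix) x b *\<^sub>R b)"
    using sum_representation_eq[OF indep_simple, of x "\<alpha> ` Ix"] by (simp add: span_simple)
  then show ?thesis
    by (simp add: sum.reindex[OF inj_simple] coord_def)
qed

lemma coord_eqI: "(\<And>i. i \<in> Ix \<Longrightarrow> coord i x = coord i y) \<Longrightarrow> x = y"
  by (subst coord_expand[of x], subst coord_expand[of y]) auto

lemma nn_iff: "nn x \<longleftrightarrow> (\<forall>i\<in>Ix. coord i x \<in> \<nat>)"
proof
  assume "nn x"
  then obtain c :: "nat \<Rightarrow> nat" where c: "x = (\<Sum>i\<in>Ix. real (c i) *\<^sub>R \<alpha> i)"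
    unfolding nonneg_comb_def Ix by auto
  have "coord i x = real (c i)" if "i \<in> Ix" for i
    using that by (simp add: c coord_sum coord_scaleR coord_simple)
  then show "\<forall>i\<in>Ix. coord i x \<in> \<nat>"
    by simp
next
  assume "\<forall>i\<in>Ix. coord i x \<in> \<nat>"
  then have "\<forall>i\<in>Ix. \<exists>n. coord i x = real n"
    by (auto elim: Nats_cases)
  then obtain c where "\<And>i. i \<in> Ix \<Longrightarrow> coord i x = real (c i)"
    by metis
  then have "x = (\<Sum>i=1..DIM('a). real (c i) *\<^sub>R \<alpha> i)"
    by (subst coord_expand[of x]) (auto simp: Ix)
  then show "nn x"
    unfolding nonneg_comb_def by blast
qed

lemma nn_coord: "nn x \<Longrightarrow> i \<in> Ix \<Longrightarrow> 0 \<le> coord i x"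
  by (auto simp: nn_iff elim!: Nats_cases)

lemma nn_antisym: "nn x \<Longrightarrow> nn (- x) \<Longrightarrow> x = 0"
  by (rule coord_eqI) (metis coord_minus coord_zero neg_0_le_iff_le nn_coord order_antisym)

lemma nn_0: "nn 0"
  by (simp add: nn_iff)

lemma nn_add: "nn x \<Longrightarrow> nn y \<Longrightarrow> nn (x + y)"
  by (simp add: nn_iff coord_add Nats_add)

lemma nn_scale: "nn x \<Longrightarrow> c \<in> \<nat> \<Longrightarrow> nn (c *\<^sub>R x)"
  by (simp add: nn_iff coord_scaleR Nats_mult)

lemma nn_simple: "i \<in> Ix \<Longrightarrow> nn (\<alpha> i)"
  by (simp add: nn_iff coord_simple)

lemma pos_root: "b \<in> pos \<Longrightarrow> b \<in> \<Phi>"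
  by (simp add: pos_roots_def)

lemma pos_nn: "b \<in> pos \<Longrightarrow> nn b"
  by (simp add: pos_roots_def)

lemma finite_pos: "finite pos"
  using finite_roots by (simp add: pos_roots_def)

lemma pos_minus: "b \<in> \<Phi> \<Longrightarrow> - b \<in> pos \<longleftrightarrow> b \<notin> pos"
  using nn_cases[of b] nn_antisym[of b] zero_notin_roots by (auto simp: pos_roots_def)

lemma simple_pos: "i \<in> Ix \<Longrightarrow> \<alpha> i \<in> pos"
  by (simp add: pos_roots_def simple_root nn_simple)

lemma pos_of_coord: "b \<in> \<Phi> \<Longrightarrow> i \<in> Ix \<Longrightarrow> 0 < coord i b \<Longrightarrow> b \<in> pos"
  using pos_minus[of b] nn_coord[of "- b" i] by (auto simp: coord_minus dest: pos_nn)

lemma sg_pos: "b \<in> pos \<Longrightarrow> sg b = 1"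
  and sg_minus: "b \<in> \<Phi> \<Longrightarrow> sg (- b) = - sg b"
  and sg_cases: "sg b = 1 \<or> sg b = -1"
  and sg_eq_1: "sg b = 1 \<longleftrightarrow> b \<in> pos"
  by (auto simp: root_sgn_def pos_minus)

lemma sg_eq_m1: "sg b = -1 \<longleftrightarrow> b \<notin> pos"
  by (simp add: root_sgn_def)

lemma simple_reflection_pos:
  assumes i: "i \<in> Ix" and b: "b \<in> pos" "b \<noteq> \<alpha> i"
  shows "reflection (\<alpha> i) b \<in> pos"
proof -
  have "\<exists>j\<in>Ix. j \<noteq> i \<and> 0 < coord j b"
  proof (rule ccontr)
    assume "\<not> ?thesis"
    then have "coord j b = 0" if "j \<in> Ix" "j \<noteq> i" for j
      using that nn_coord[OF pos_nn[OF b(1)], of j] by force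
    then have e: "b = coord i b *\<^sub>R \<alpha> i"
      using i by (intro coord_eqI) (auto simp: coord_scaleR coord_simple)
    then have "coord i b = 1 \<or> coord i b = -1"
      using reduced[OF simple_root[OF i], of "coord i b"] pos_root[OF b(1)] by simp
    then show False
      using e b(2) nn_coord[OF pos_nn[OF b(1)] i] by auto
  qed
  then obtain j where j: "j \<in> Ix" "j \<noteq> i" "0 < coord j b" by blast
  then have "0 < coord j (reflection (\<alpha> i) b)"
    using i by (simp add: reflection_def coord_diff coord_scaleR coord_simple)
  then show ?thesis
    using pos_of_coord[of _ j] j b i by (simp add: reflection_roots simple_root pos_root)
qed

lemma pos_ex_simple_inner:
  assumes "b \<in> pos"
  shows "\<exists>i\<in>Ix. 0 < b \<bullet> \<alpha> i"
proof (rule ccontr)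
  assume n: "\<not> ?thesis"
  have "b \<bullet> b = (\<Sum>i\<in>Ix. coord i b * (b \<bullet> \<alpha> i))"
    by (subst (2) coord_expand[of b]) (simp add: inner_sum_right)
  also have "\<dots> \<le> 0"
    using n nn_coord[OF pos_nn[OF assms]] by (intro sum_nonpos mult_nonneg_nonpos) (auto simp: not_less)
  finally show False
    using root_inner_pos[OF pos_root[OF assms]] by simp
qed

definition height :: "'a \<Rightarrow> real" where
  "height x = (\<Sum>i\<in>Ix. coord i x)"

lemma pos_induct [consumes 1, case_names simple step]:
  assumes "b \<in> pos"
    and base: "\<And>i. i \<in> Ix \<Longrightarrow> P (\<alpha> i)"
    and step: "\<And>i b. i \<in> Ix \<Longrightarrow> b \<in> pos \<Longrightarrow> reflection (\<alpha> i) b \<in> pos \<Longrightarrow> P b \<Longrightarrow> P (reflection (\<alpha> i) b)"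
  shows "P b"
  using assms(1)
proof (induction "nat \<lfloor>height b\<rfloor>" arbitrary: b rule: less_induct)
  case less
  show ?case
  proof (cases "b \<in> \<alpha> ` Ix")
    case True
    then show ?thesis using base by auto
  next
    case False
    obtain i where i: "i \<in> Ix" "0 < b \<bullet> \<alpha> i"
      using pos_ex_simple_inner[OF less.prems] by blast
    let ?c = "reflection (\<alpha> i) b"
    have c: "?c \<in> pos"
      using simple_reflection_pos[OF i(1) less.prems] False i(1) by blast
    have "b \<bullet> coroot (\<alpha> i) > 0"
      using i root_inner_pos[OF simple_root[OF i(1)]] by (simp add: inner_coroot)
    moreover have "b \<bullet> coroot (\<alpha> i) \<in> \<int>"
      using inner_coroot_Ints simple_root i less.prems pos_root by blast
    ultimately have "b \<bullet> coroot (\<alpha> i) \<ge> 1"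
      by (auto elim!: Ints_cases)
    moreover have "height ?c = height b - b \<bullet> coroot (\<alpha> i)"
    proof -
      have "coord j ?c = coord j b - (if j = i then b \<bullet> coroot (\<alpha> i) else 0)" if "j \<in> Ix" for j
        using that i by (simp add: reflection_def coord_diff coord_scaleR coord_simple)
      then show ?thesis
        using i by (simp add: height_def sum_subtractf)
    qed
    moreover have "0 \<le> height ?c"
      unfolding height_def by (rule sum_nonneg) (rule nn_coord[OF pos_nn[OF c]])
    ultimately have "nat \<lfloor>height ?c\<rfloor> < nat \<lfloor>height b\<rfloor>"
      by linarith
    from less.hyps[OF this c] have "P ?c" .
    from step[OF i(1) c _ this] less.prems show ?thesis by simp
  qed
qed


subsection \<open>The Weyl group and its length function\<close>

abbreviation "W \<equiv> weyl_group \<Phi>"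

definition word :: "nat list \<Rightarrow> 'a \<Rightarrow> 'a" where
  "word is = comp_list (map (\<lambda>i. reflection (\<alpha> i)) is)"

lemma word_Nil [simp]: "word [] = id"
  and word_Cons [simp]: "word (i # is) = reflection (\<alpha> i) \<circ> word is"
  and word_append: "word (is @ js) = word is \<circ> word js"
  by (simp_all add: word_def comp_list_append)

lemma W_id: "id \<in> W"
  unfolding weyl_group_def by (rule CollectI, rule exI[of _ "[]"]) simp

lemma W_reflection_left:
  assumes "w \<in> W" "a \<in> \<Phi>"
  shows "reflection a \<circ> w \<in> W"
proof -
  obtain as where "w = comp_list (map reflection as)" "set as \<subseteq> \<Phi>"
    using assms by (auto simp: weyl_group_def)
  then have "reflection a \<circ> w = comp_list (map reflection (a # as))" "set (a # as) \<subseteq> \<Phi>"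
    using assms by auto
  then show ?thesis
    unfolding weyl_group_def by blast
qed

lemma W_induct [consumes 1, case_names id step]:
  assumes "w \<in> W" and "P id"
    and "\<And>a w. w \<in> W \<Longrightarrow> a \<in> \<Phi> \<Longrightarrow> P w \<Longrightarrow> P (reflection a \<circ> w)"
  shows "P w"
proof -
  obtain as where as: "w = comp_list (map reflection as)" "set as \<subseteq> \<Phi>"
    using assms(1) by (auto simp: weyl_group_def)
  have "P (comp_list (map reflection as)) \<and> comp_list (map reflection as) \<in> W"
    using as(2) by (induction as) (use assms(2,3) W_id W_reflection_left in auto)
  then show ?thesis
    using as by simp
qed

lemma W_comp: "u \<in> W \<Longrightarrow> v \<in> W \<Longrightarrow> u \<circ> v \<in> W"
  by (induction u rule: W_induct) (simp_all add: comp_assoc W_reflection_left)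

lemma W_reflection: "a \<in> \<Phi> \<Longrightarrow> reflection a \<in> W"
  using W_reflection_left[OF W_id] by simp

lemma W_reflection_right: "w \<in> W \<Longrightarrow> a \<in> \<Phi> \<Longrightarrow> w \<circ> reflection a \<in> W"
  by (simp add: W_comp W_reflection)

lemma W_orthogonal: "w \<in> W \<Longrightarrow> orthogonal_transformation w"
proof (induction w rule: W_induct)
  case id
  then show ?case by (simp add: id_def)
next
  case (step a w)
  show ?case
    by (rule orthogonal_transformation_compose[OF orthogonal_reflection step(3)])
qed

lemma W_linear: "w \<in> W \<Longrightarrow> linear w"
  by (simp add: W_orthogonal orthogonal_transformation_linear)

lemma W_bij: "w \<in> W \<Longrightarrow> bij w"
  by (simp add: W_orthogonal orthogonal_transformation_bij)

lemma W_inner: "w \<in> W \<Longrightarrow> w x \<bullet> w y = x \<bullet> y"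
  using W_orthogonal by (simp add: orthogonal_transformation_def)

lemma W_uminus: "w \<in> W \<Longrightarrow> w (- x) = - w x"
  by (simp add: W_linear linear_neg)

lemma W_coroot: "w \<in> W \<Longrightarrow> coroot (w a) = w (coroot a)"
  by (simp add: W_orthogonal coroot_orthogonal)

lemma inv_reflection_left: "w \<in> W \<Longrightarrow> inv (reflection a \<circ> w) = inv w \<circ> reflection a"
  by (simp add: o_inv_distrib bij_reflection W_bij)

lemma inv_reflection_right: "w \<in> W \<Longrightarrow> inv (w \<circ> reflection a) = reflection a \<circ> inv w"
  by (simp add: o_inv_distrib bij_reflection W_bij)

lemma W_inv: "w \<in> W \<Longrightarrow> inv w \<in> W"
proof (induction w rule: W_induct)
  case id
  then show ?case using W_id by (simp add: id_def)
next
  case (step a w)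
  show ?case
    unfolding inv_reflection_left[OF step(1)] by (rule W_reflection_right[OF step(3,2)])
qed

lemma W_inv_apply [simp]: "w \<in> W \<Longrightarrow> inv w (w x) = x" "w \<in> W \<Longrightarrow> w (inv w x) = x"
  using W_bij[of w] by (simp_all add: bij_is_inj bij_is_surj surj_f_inv_f)

lemma W_adjoint: "w \<in> W \<Longrightarrow> w x \<bullet> y = x \<bullet> inv w y"
  by (metis W_inner W_inv_apply(2))

lemma W_root: "w \<in> W \<Longrightarrow> a \<in> \<Phi> \<Longrightarrow> w a \<in> \<Phi>"
  by (induction w rule: W_induct) (simp_all add: reflection_roots)

lemma W_reflection_conj: "w \<in> W \<Longrightarrow> w \<circ> reflection a = reflection (w a) \<circ> w"
  by (rule ext) (simp add: orthogonal_reflection_conj W_orthogonal)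

lemma W_reflection_conj_inv: "w \<in> W \<Longrightarrow> reflection a \<circ> w = w \<circ> reflection (inv w a)"
  by (simp add: W_reflection_conj)

lemma reflection_word: "b \<in> \<Phi> \<Longrightarrow> \<exists>is. set is \<subseteq> Ix \<and> reflection b = word is"
proof -
  have *: "\<exists>is. set is \<subseteq> Ix \<and> reflection b = word is" if "b \<in> pos" for b
    using that
  proof (induction rule: pos_induct)
    case (simple i)
    then show ?case by (intro exI[of _ "[i]"]) simp
  next
    case (step i b)
    then obtain js where js: "set js \<subseteq> Ix" "reflection b = word js" by auto
    have "reflection (reflection (\<alpha> i) b) = reflection (\<alpha> i) \<circ> reflection b \<circ> reflection (\<alpha> i)"
      using W_reflection_conj[OF W_reflection[OF simple_root[OF step(1)]], of b]
      by (simp add: comp_assoc)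
    then have "reflection (reflection (\<alpha> i) b) = word (i # js @ [i])"
      by (simp add: js word_append comp_assoc)
    then show ?case
      using js step by (intro exI[of _ "i # js @ [i]"]) auto
  qed
  assume "b \<in> \<Phi>"
  then show ?thesis
    using *[of b] *[of "- b"] pos_minus[of b] by auto
qed

lemma W_word: "w \<in> W \<Longrightarrow> \<exists>is. set is \<subseteq> Ix \<and> w = word is"
proof (induction rule: W_induct)
  case id
  then show ?case by (intro exI[of _ "[]"]) simp
next
  case (step a w)
  then obtain js ks where "set js \<subseteq> Ix" "w = word js" "set ks \<subseteq> Ix" "reflection a = word ks"
    using reflection_word by metis
  then show ?case
    by (intro exI[of _ "ks @ js"]) (simp add: word_append)
qed

lemma word_W: "set is \<subseteq> Ix \<Longrightarrow> word is \<in> W"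
  by (induction "is") (simp_all add: W_id W_reflection_left simple_root)

lemma weyl_length_word: "set is \<subseteq> Ix \<Longrightarrow> weyl_length \<alpha> (word is) \<le> length is"
  unfolding weyl_length_def word_def by (rule Least_le) (auto simp: Ix)

lemma reduced_word:
  assumes "w \<in> W"
  obtains "is" where "set is \<subseteq> Ix" "w = word is" "length is = weyl_length \<alpha> w"
proof -
  have "\<exists>n is. length is = n \<and> set is \<subseteq> {1..DIM('a)} \<and> w = comp_list (map (\<lambda>i. reflection (\<alpha> i)) is)"
    using W_word[OF assms] by (auto simp: word_def Ix)
  from LeastI_ex[OF this] show ?thesis
    using that unfolding weyl_length_def word_def Ix by blast
qed

lemma exchange:
  assumes "set is \<subseteq> Ix" "b \<in> pos" "word is b \<notin> pos"
  shows "\<exists>js. set js \<subseteq> Ix \<and> length js < length is \<and> word is \<circ> reflection b = word js"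
  using assms(1,3)
proof (induction "is")
  case Nil
  then show ?case using assms by simp
next
  case (Cons i "is")
  show ?case
  proof (cases "word is b \<in> pos")
    case True
    then have "word is b = \<alpha> i"
      using simple_reflection_pos[of i "word is b"] Cons.prems by auto
    then have "word (i # is) \<circ> reflection b = word is"
      using W_reflection_conj[OF word_W, of "is" b] Cons.prems by (simp add: comp_assoc)
    moreover have "set is \<subseteq> Ix" "length is < length (i # is)"
      using Cons.prems by auto
    ultimately show ?thesis by blast
  next
    case False
    moreover have "set is \<subseteq> Ix"
      using Cons.prems by simp
    ultimately obtain js where "set js \<subseteq> Ix" "length js < length is" "word is \<circ> reflection b = word js"
      using Cons.IH by blast
    then show ?thesis
      using Cons.prems by (intro exI[of _ "i # js"]) (simp add: fun_eq_iff)
  qed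
qed

lemma length_reflection_less:
  assumes "w \<in> W" "b \<in> pos" "w b \<notin> pos"
  shows "weyl_length \<alpha> (w \<circ> reflection b) < weyl_length \<alpha> w"
proof -
  obtain "is" where "is": "set is \<subseteq> Ix" "w = word is" "length is = weyl_length \<alpha> w"
    using reduced_word[OF assms(1)] .
  with exchange[of "is" b] assms obtain js
    where "set js \<subseteq> Ix" "length js < length is" "w \<circ> reflection b = word js"
    by auto
  then show ?thesis
    using weyl_length_word[of js] "is" by simp
qed

lemma length_reflection_greater:
  assumes "w \<in> W" "b \<in> pos" "w b \<in> pos"
  shows "weyl_length \<alpha> w < weyl_length \<alpha> (w \<circ> reflection b)"
proof -
  have "(w \<circ> reflection b) b \<notin> pos"
    using assms pos_root pos_minus[of "w b"]
    by (simp add: reflection_self root_nonzero W_uminus)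
  then have "weyl_length \<alpha> (w \<circ> reflection b \<circ> reflection b) < weyl_length \<alpha> (w \<circ> reflection b)"
    using assms pos_root by (intro length_reflection_less W_reflection_right)
  then show ?thesis
    by simp
qed

lemma length_reflection_iff:
  "w \<in> W \<Longrightarrow> b \<in> pos \<Longrightarrow> weyl_length \<alpha> w < weyl_length \<alpha> (w \<circ> reflection b) \<longleftrightarrow> w b \<in> pos"
  using length_reflection_greater length_reflection_less by (meson less_asym)

lemma length_comp_le:
  assumes "u \<in> W" "v \<in> W"
  shows "weyl_length \<alpha> (u \<circ> v) \<le> weyl_length \<alpha> u + weyl_length \<alpha> v"
proof -
  obtain "is" js where "set is \<subseteq> Ix" "u = word is" "length is = weyl_length \<alpha> u"
    "set js \<subseteq> Ix" "v = word js" "length js = weyl_length \<alpha> v"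
    using reduced_word[OF assms(1)] reduced_word[OF assms(2)] by metis
  then show ?thesis
    using weyl_length_word[of "is @ js"] by (simp add: word_append)
qed

lemma length_simple_left:
  assumes w: "w \<in> W" and i: "i \<in> Ix"
  shows "real (weyl_length \<alpha> (reflection (\<alpha> i) \<circ> w)) = real (weyl_length \<alpha> w) + sg (inv w (\<alpha> i))"
proof -
  let ?s = "reflection (\<alpha> i)"
  have s1: "weyl_length \<alpha> ?s \<le> 1"
    using weyl_length_word[of "[i]"] i by simp
  have sw: "?s \<circ> w \<in> W"
    using w i by (simp add: W_reflection_left simple_root)
  have le: "weyl_length \<alpha> (?s \<circ> w) \<le> weyl_length \<alpha> w + 1"
    using length_comp_le[OF W_reflection w, of "\<alpha> i"] s1 simple_root[OF i] by simp
  have ge: "weyl_length \<alpha> w \<le> weyl_length \<alpha> (?s \<circ> w) + 1"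
    using length_comp_le[OF W_reflection sw, of "\<alpha> i"] s1 simple_root[OF i] by simp
  let ?d = "inv w (\<alpha> i)"
  have d: "?d \<in> \<Phi>"
    using W_root[OF W_inv[OF w] simple_root[OF i]] .
  have e: "?s \<circ> w = w \<circ> reflection ?d"
    by (rule W_reflection_conj_inv[OF w])
  show ?thesis
  proof (cases "?d \<in> pos")
    case True
    have "weyl_length \<alpha> w < weyl_length \<alpha> (w \<circ> reflection ?d)"
      using length_reflection_greater[OF w True] simple_pos[OF i] w by simp
    then show ?thesis
      using le True e by (simp add: sg_pos)
  next
    case False
    then have m: "- ?d \<in> pos"
      using pos_minus[OF d] by simp
    have "weyl_length \<alpha> (w \<circ> reflection (- ?d)) < weyl_length \<alpha> w"
      using length_reflection_less[OF w m] simple_pos[OF i] w pos_minus[OF simple_root[OF i]]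
      by (simp add: W_uminus)
    then show ?thesis
      using ge False e sg_eq_m1[of ?d] by simp
  qed
qed

lemma roots_split: "\<Phi> = pos \<union> uminus ` pos"
proof
  show "\<Phi> \<subseteq> pos \<union> uminus ` pos"
  proof
    fix b assume b: "b \<in> \<Phi>"
    show "b \<in> pos \<union> uminus ` pos"
      using pos_minus[OF b] by (cases "b \<in> pos") (auto intro: image_eqI[of _ _ "- b"])
  qed
qed (auto dest: pos_root)

lemma sum_roots_even:
  fixes f :: "'a \<Rightarrow> real"
  assumes "\<And>b. b \<in> \<Phi> \<Longrightarrow> f (- b) = f b"
  shows "sum f \<Phi> = 2 * sum f pos"
proof -
  have "pos \<inter> uminus ` pos = {}"
    by (auto simp: pos_minus pos_root)
  then have "sum f \<Phi> = sum f pos + sum f (uminus ` pos)"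
    by (subst roots_split) (simp add: sum.union_disjoint finite_pos)
  also have "sum f (uminus ` pos) = sum f pos"
    by (subst sum.reindex) (auto simp: assms pos_root intro!: sum.cong inj_onI)
  finally show ?thesis by simp
qed

lemma sum_roots_W:
  fixes f :: "'a \<Rightarrow> real"
  assumes "w \<in> W"
  shows "(\<Sum>b\<in>\<Phi>. f (w b)) = sum f \<Phi>"
  by (rule sum.reindex_bij_witness[of _ "inv w" w]) (auto simp: assms W_root W_inv)

lemma sum_pos_W:
  fixes f :: "'a \<Rightarrow> real"
  assumes w: "w \<in> W" and odd: "\<And>b. b \<in> \<Phi> \<Longrightarrow> f (- b) = - f b"
  shows "(\<Sum>b\<in>pos. f (w b)) = (\<Sum>b\<in>pos. sg (inv w b) * f b)"
proof -
  have "2 * (\<Sum>b\<in>pos. f (w b)) = 2 * (\<Sum>b\<in>pos. sg b * f (w b))"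
    by (simp add: sg_pos)
  also have "\<dots> = (\<Sum>b\<in>\<Phi>. sg b * f (w b))"
    by (rule sum_roots_even[symmetric]) (simp add: sg_minus odd W_uminus W_root w)
  also have "\<dots> = (\<Sum>b\<in>\<Phi>. (\<lambda>b. sg (inv w b) * f b) (w b))"
    by (simp add: w)
  also have "\<dots> = (\<Sum>b\<in>\<Phi>. sg (inv w b) * f b)"
    by (rule sum_roots_W[OF w])
  also have "\<dots> = 2 * (\<Sum>b\<in>pos. sg (inv w b) * f b)"
    by (rule sum_roots_even) (simp add: sg_minus odd W_uminus W_root W_inv w)
  finally show ?thesis by simp
qed

lemma sum_sg_reflection:
  assumes "w \<in> W" "b \<in> \<Phi>"
  shows "(\<Sum>g\<in>pos. sg (inv (reflection b \<circ> w) g)) = (\<Sum>g\<in>pos. sg (inv w g))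
     - 2 * (\<Sum>g | g \<in> pos \<and> reflection b g \<notin> pos. sg (inv w g))"
proof -
  have "(\<Sum>g\<in>pos. sg (inv (reflection b \<circ> w) g)) = (\<Sum>g\<in>pos. sg (inv w (reflection b g)))"
    using assms by (simp add: inv_reflection_left)
  also have "\<dots> = (\<Sum>g\<in>pos. sg (reflection b g) * sg (inv w g))"
    using sum_pos_W[OF W_reflection[OF assms(2)], of "\<lambda>g. sg (inv w g)"] assms
    by (simp add: W_uminus W_inv sg_minus W_root)
  also have "\<dots> = (\<Sum>g\<in>pos. sg (inv w g) - 2 * (if reflection b g \<notin> pos then sg (inv w g) else 0))"
    by (intro sum.cong) (auto simp: root_sgn_def)
  also have "\<dots> = (\<Sum>g\<in>pos. sg (inv w g)) - 2 * (\<Sum>g\<in>pos. if reflection b g \<notin> pos then sg (inv w g) else 0)"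
    by (simp add: sum_subtractf sum_distrib_left)
  also have "(\<Sum>g\<in>pos. if reflection b g \<notin> pos then sg (inv w g) else 0)
     = (\<Sum>g | g \<in> pos \<and> reflection b g \<notin> pos. sg (inv w g))"
    by (simp add: sum.inter_filter finite_pos)
  finally show ?thesis .
qed

lemma simple_inversions: "i \<in> Ix \<Longrightarrow> {g \<in> pos. reflection (\<alpha> i) g \<notin> pos} = {\<alpha> i}"
  using simple_reflection_pos[of i] simple_pos[of i] pos_minus[OF simple_root, of i]
  by (auto simp: reflection_self root_nonzero simple_root)

text \<open>Inversions are counted with signs because such sums extend to sums of even functions over all of \<open>\<Phi>\<close>.\<close>

lemma length_formula:
  assumes "w \<in> W"
  shows "real (weyl_length \<alpha> w) = (\<Sum>g\<in>pos. (1 - sg (inv w g)) / 2)"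
proof -
  obtain "is" where "is": "set is \<subseteq> Ix" "w = word is"
    using W_word[OF assms] by blast
  have l0: "weyl_length \<alpha> id = 0"
    using weyl_length_word[of "[]"] by simp
  have "real (weyl_length \<alpha> (word is)) = (card pos - (\<Sum>g\<in>pos. sg (inv (word is) g))) / 2"
    using "is"(1)
  proof (induction "is")
    case Nil
    then show ?case by (simp add: l0 l0[unfolded id_def] sg_pos)
  next
    case (Cons i "is")
    have "word is \<in> W" using Cons.prems by (simp add: word_W)
    then show ?case
      using Cons length_simple_left[of "word is" i] sum_sg_reflection[of "word is" "\<alpha> i"]
        simple_inversions[of i] simple_root[of i]
      by (simp add: field_simps comp_def)
  qed
  then show ?thesis
    by (simp add: "is" sum_subtractf sum_divide_distrib[symmetric])
qed

lemma length_reflection_left: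
  assumes "w \<in> W" "b \<in> \<Phi>"
  shows "real (weyl_length \<alpha> (reflection b \<circ> w)) =
    real (weyl_length \<alpha> w) + (\<Sum>g | g \<in> pos \<and> reflection b g \<notin> pos. sg (inv w g))"
  using sum_sg_reflection[OF assms]
  by (simp add: length_formula assms W_reflection_left sum_divide_distrib[symmetric] sum_subtractf field_simps)


subsection \<open>The half-sum of positive roots and the highest root\<close>

lemma inner_coroot_pos_iff: "b \<in> \<Phi> \<Longrightarrow> 0 < x \<bullet> coroot b \<longleftrightarrow> 0 < x \<bullet> b"
  and inner_coroot_nonneg_iff: "b \<in> \<Phi> \<Longrightarrow> 0 \<le> x \<bullet> coroot b \<longleftrightarrow> 0 \<le> x \<bullet> b"
proof -
  assume "b \<in> \<Phi>"
  define c where "c = 2 / (b \<bullet> b)"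
  have c: "0 < c" "coroot b = c *\<^sub>R b"
    unfolding c_def coroot_def using \<open>b \<in> \<Phi>\<close>
    by (rule divide_pos_pos[OF zero_less_numeral root_inner_pos]) (rule refl)
  show "0 < x \<bullet> coroot b \<longleftrightarrow> 0 < x \<bullet> b" "0 \<le> x \<bullet> coroot b \<longleftrightarrow> 0 \<le> x \<bullet> b"
    using c by (simp_all add: zero_less_mult_iff zero_le_mult_iff)
qed

lemma rho_inner: "2 * (rho \<Phi> \<alpha> \<bullet> x) = (\<Sum>g\<in>pos. g \<bullet> x)"
  by (simp add: rho_def inner_sum_left)

text \<open>Reflection in \<open>b\<close> negates the pairing with the coroot, so only the inversions contribute to
  \<open>2\<langle>\<rho>, b\<^sup>\<or>\<rangle>\<close>; each contributes at least 1, and \<open>b\<close> itself contributes 2.\<close>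

lemma length_reflection_le:
  assumes b: "b \<in> pos"
  shows "real (weyl_length \<alpha> (reflection b)) + 1 \<le> 2 * (rho \<Phi> \<alpha> \<bullet> coroot b)"
    and "1 \<le> rho \<Phi> \<alpha> \<bullet> coroot b"
proof -
  note bR = pos_root[OF b]
  let ?N = "{g \<in> pos. reflection b g \<notin> pos}" and ?f = "\<lambda>g. g \<bullet> coroot b"
  have bN: "b \<in> ?N"
    using b pos_minus[OF bR] by (simp add: reflection_self root_nonzero bR)
  have finN: "finite ?N" using finite_pos by simp
  have flip: "?f (reflection b g) = - ?f g" for g
    by (simp add: inner_reflection_left coroot_orthogonal[OF orthogonal_reflection, symmetric]
        reflection_self root_nonzero bR)
  have "sum ?f (pos - ?N) = (\<Sum>g\<in>pos - ?N. ?f (reflection b g))"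
    by (rule sum.reindex_bij_witness[of _ "reflection b" "reflection b"]) auto
  then have "sum ?f (pos - ?N) = 0"
    by (simp add: flip sum_negf)
  then have "2 * (rho \<Phi> \<alpha> \<bullet> coroot b) = sum ?f ?N"
    using sum.subset_diff[of ?N pos ?f] finite_pos by (simp add: rho_inner)
  also have "\<dots> = ?f b + sum ?f (?N - {b})"
    using sum.remove[OF finN bN] .
  also have "?f b = 2"
    by (simp add: inner_coroot_self root_nonzero bR)
  finally have e: "2 * (rho \<Phi> \<alpha> \<bullet> coroot b) = 2 + sum ?f (?N - {b})" .
  have "1 \<le> ?f g" if g: "g \<in> ?N" for g
  proof (rule ccontr)
    assume n: "\<not> 1 \<le> ?f g"
    have "?f g \<in> \<int>" using g bR by (auto intro: inner_coroot_Ints pos_root)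
    with n have "- ?f g \<in> \<nat>"
      by (auto elim!: Ints_cases simp: Nats_altdef2)
    then have "nn (g + (- ?f g) *\<^sub>R b)"
      using g b by (intro nn_add nn_scale pos_nn) auto
    then have "nn (reflection b g)"
      by (simp add: reflection_def)
    then show False
      using g bR by (auto simp: pos_roots_def reflection_roots)
  qed
  then have "(\<Sum>g\<in>?N - {b}. 1) \<le> sum ?f (?N - {b})"
    by (intro sum_mono) auto
  then have ge: "real (card ?N) - 1 \<le> sum ?f (?N - {b})"
    using card_Suc_Diff1[OF finN bN] by simp
  have "real (weyl_length \<alpha> (reflection b)) = (\<Sum>g\<in>pos. if reflection b g \<notin> pos then 1 else 0)"
    unfolding length_formula[OF W_reflection[OF bR]]
    by (intro sum.cong) (auto simp: root_sgn_def)
  also have "\<dots> = real (card ?N)"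
    by (simp add: sum.inter_filter[symmetric] finite_pos)
  finally show *: "real (weyl_length \<alpha> (reflection b)) + 1 \<le> 2 * (rho \<Phi> \<alpha> \<bullet> coroot b)"
    using e ge by simp
  show "1 \<le> rho \<Phi> \<alpha> \<bullet> coroot b"
    using e ge bN finN card_gt_0_iff[of ?N] by (auto simp: of_nat_diff)
qed

lemma sgn_rho_coroot:
  assumes "b \<in> \<Phi>"
  shows "sgn (rho \<Phi> \<alpha> \<bullet> coroot b) = sg b"
  using length_reflection_le(2)[of b] length_reflection_le(2)[of "- b"] pos_minus[OF assms]
  by (cases "b \<in> pos") (auto simp: root_sgn_def)

lemma root_diff:
  assumes a: "a \<in> \<Phi>" and b: "b \<in> \<Phi>" and "0 < a \<bullet> b" "a \<noteq> b"
  shows "a - b \<in> \<Phi>"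
proof -
  have one: "x \<bullet> coroot y = 1 \<Longrightarrow> x \<in> \<Phi> \<Longrightarrow> y \<in> \<Phi> \<Longrightarrow> x - y \<in> \<Phi>" for x y
    using reflection_roots[of y x] by (simp add: reflection_def)
  have ge2: "x \<bullet> coroot y = 1 \<or> y \<bullet> y \<le> x \<bullet> y" if xy: "x \<in> \<Phi>" "y \<in> \<Phi>" "0 < x \<bullet> y" for x y
  proof -
    obtain k where k: "x \<bullet> coroot y = of_int k"
      using inner_coroot_Ints[OF xy(2,1)] by (auto elim: Ints_cases)
    moreover have "0 < x \<bullet> coroot y"
      using xy by (simp add: inner_coroot_pos_iff)
    ultimately consider "k = 1" | "2 \<le> real_of_int k" by fastforce
    then show ?thesis
    proof cases
      case 2
      then have "2 * (y \<bullet> y) \<le> real_of_int k * (y \<bullet> y)"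
        by (intro mult_right_mono) auto
      moreover have "2 * (x \<bullet> y) = real_of_int k * (y \<bullet> y)"
        using k root_nonzero[OF xy(2)] by (simp add: inner_coroot field_simps)
      ultimately show ?thesis by linarith
    qed (use k in simp)
  qed
  consider "a \<bullet> coroot b = 1" | "b \<bullet> coroot a = 1" | "b \<bullet> b \<le> a \<bullet> b" "a \<bullet> a \<le> a \<bullet> b"
    using ge2[OF a b] ge2[OF b a] assms(3) by (auto simp: inner_commute)
  then show ?thesis
  proof cases
    case 1
    then show ?thesis using one a b by blast
  next
    case 2
    then show ?thesis using one[OF _ b a] minus_root[of "b - a"] by simp
  next
    case 3
    then have "(a - b) \<bullet> (a - b) \<le> 0"
      by (simp add: inner_diff inner_commute)
    moreover have "0 < (a - b) \<bullet> (a - b)"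
      using assms(4) by simp
    ultimately show ?thesis by linarith
  qed
qed

definition maximal_root :: "'a \<Rightarrow> bool" where
  "maximal_root h \<longleftrightarrow> h \<in> \<Phi> \<and> (\<forall>c\<in>\<Phi>. nn (c - h) \<longrightarrow> c = h)"

lemma ex_maximal_root:
  assumes "b \<in> \<Phi>"
  shows "\<exists>h. maximal_root h \<and> nn (h - b)"
proof -
  let ?A = "{c \<in> \<Phi>. nn (c - b)}"
  have A: "finite (height ` ?A)" "height ` ?A \<noteq> {}"
    using assms finite_roots nn_0 by auto
  obtain h where h: "h \<in> ?A" "height h = Max (height ` ?A)"
  proof (rule imageE[OF Max_in[OF A]])
    fix x assume "Max (height ` ?A) = height x" "x \<in> ?A"
    then show ?thesis using that[of x] by simp
  qed
  have "c = h" if c: "c \<in> \<Phi>" "nn (c - h)" for c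
  proof -
    have "nn ((c - h) + (h - b))" using c h by (intro nn_add) auto
    then have "c \<in> ?A" using c by simp
    then have "height c \<le> height h"
      using A(1) h(2) by (auto intro: Max_ge)
    then have "(\<Sum>i\<in>Ix. coord i (c - h)) \<le> 0"
      by (simp add: height_def coord_diff sum_subtractf)
    moreover have nn: "\<forall>i\<in>Ix. 0 \<le> coord i (c - h)"
      using nn_coord[OF c(2)] by blast
    ultimately have "(\<Sum>i\<in>Ix. coord i (c - h)) = 0"
      by (meson order_antisym sum_nonneg)
    then have "\<forall>i\<in>Ix. coord i (c - h) = 0"
      using sum_nonneg_eq_0_iff[of Ix "\<lambda>i. coord i (c - h)"] nn by simp
    then show "c = h"
      by (intro coord_eqI) (simp add: coord_diff)
  qed
  then show ?thesis
    using h by (auto simp: maximal_root_def)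
qed

lemma maximal_root_pos:
  assumes "maximal_root h"
  shows "h \<in> pos"
proof (rule ccontr)
  assume n: "h \<notin> pos"
  have h: "h \<in> \<Phi>" using assms by (simp add: maximal_root_def)
  then have "nn (- h)" using n pos_minus[OF h] by (auto dest: pos_nn)
  then have "nn (- h - h)"
    using nn_add[of "- h" "- h"] by simp
  then have "- h = h"
    using assms h by (auto simp: maximal_root_def)
  then have "h \<in> pos \<longleftrightarrow> h \<notin> pos" using pos_minus[OF h] by simp
  then show False by simp
qed

lemma maximal_root_dominant:
  assumes "maximal_root h" and i: "i \<in> Ix"
  shows "0 \<le> h \<bullet> \<alpha> i"
proof (rule ccontr)
  assume n: "\<not> ?thesis"
  have h: "h \<in> \<Phi>" using assms by (simp add: maximal_root_def)
  let ?k = "h \<bullet> coroot (\<alpha> i)"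
  have k: "?k < 0"
    using n inner_coroot_nonneg_iff[OF simple_root[OF i], of h] by simp
  have "?k \<in> \<int>"
    using inner_coroot_Ints[OF simple_root[OF i] h] .
  with k have "- ?k \<in> \<nat>"
    by (auto elim!: Ints_cases simp: Nats_altdef2)
  then have "nn ((- ?k) *\<^sub>R \<alpha> i)"
    using i by (intro nn_scale nn_simple)
  then have "nn (reflection (\<alpha> i) h - h)"
    by (simp add: reflection_def)
  then have "reflection (\<alpha> i) h = h"
    using assms h i reflection_roots[OF simple_root h] by (simp add: maximal_root_def)
  then show False
    using k root_nonzero[OF simple_root[OF i]] by (simp add: reflection_def)
qed

lemma simple_inner_nonpos:
  assumes "i \<in> Ix" "j \<in> Ix" "i \<noteq> j"
  shows "\<alpha> i \<bullet> \<alpha> j \<le> 0"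
proof -
  have "\<alpha> i \<noteq> \<alpha> j" using assms inj_simple by (auto dest: inj_onD)
  then have "reflection (\<alpha> j) (\<alpha> i) \<in> pos"
    using simple_reflection_pos[OF assms(2) simple_pos[OF assms(1)]] by simp
  then have "0 \<le> coord j (reflection (\<alpha> j) (\<alpha> i))"
    using nn_coord pos_nn assms by blast
  then have "\<alpha> i \<bullet> coroot (\<alpha> j) \<le> 0"
    using assms by (simp add: reflection_def coord_diff coord_scaleR coord_simple)
  then show ?thesis
    using inner_coroot_pos_iff[OF simple_root[OF assms(2)], of "\<alpha> i"] by linarith
qed

lemma inner_coord: "x \<bullet> y = (\<Sum>i\<in>Ix. coord i x * (\<alpha> i \<bullet> y))"
  by (subst coord_expand[of x]) (simp add: inner_sum_left)

lemma maximal_root_full_support: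
  assumes h: "maximal_root h" and i: "i \<in> Ix"
  shows "0 < coord i h"
proof (rule ccontr)
  assume n: "\<not> ?thesis"
  have hR: "h \<in> \<Phi>" using h by (simp add: maximal_root_def)
  have h0: "0 \<le> coord k h" if "k \<in> Ix" for k
    using nn_coord[OF pos_nn[OF maximal_root_pos[OF h]] that] .
  define K where "K = {k \<in> Ix. coord k h \<noteq> 0}"
  have iK: "i \<in> Ix - K" using n i h0[OF i] by (simp add: K_def)
  have "K \<noteq> {}"
  proof
    assume "K = {}"
    then have "h = 0" by (intro coord_eqI) (auto simp: K_def)
    then show False using hR zero_notin_roots by simp
  qed
  then obtain k0 where k0: "k0 \<in> K" by blast
  have orth: "\<alpha> k \<bullet> \<alpha> j = 0" if k: "k \<in> K" and j: "j \<in> Ix - K" for k j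
  proof -
    have t: "coord l h * (\<alpha> l \<bullet> \<alpha> j) \<le> 0" if l: "l \<in> Ix" for l
    proof (cases "l \<in> K")
      case True
      then show ?thesis
        using j l by (intro mult_nonneg_nonpos h0 simple_inner_nonpos) auto
    next
      case False
      then show ?thesis using l by (simp add: K_def)
    qed
    have "0 \<le> (\<Sum>l\<in>Ix. coord l h * (\<alpha> l \<bullet> \<alpha> j))"
      using maximal_root_dominant[OF h, of j] j inner_coord[of h "\<alpha> j"] by simp
    moreover have "(\<Sum>l\<in>Ix. coord l h * (\<alpha> l \<bullet> \<alpha> j)) \<le> 0"
      by (intro sum_nonpos t)
    ultimately have "(\<Sum>l\<in>Ix. - (coord l h * (\<alpha> l \<bullet> \<alpha> j))) = 0"
      by (simp add: sum_negf)
    then have "\<forall>l\<in>Ix. - (coord l h * (\<alpha> l \<bullet> \<alpha> j)) = 0"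
      using t by (subst (asm) sum_nonneg_eq_0_iff) auto
    then show ?thesis
      using k by (auto simp: K_def)
  qed
  let ?S = "{b \<in> \<Phi>. \<forall>j\<in>Ix - K. coord j b = 0}" and ?T = "{b \<in> \<Phi>. \<forall>j\<in>K. coord j b = 0}"
  have inK: "K \<subseteq> Ix" by (auto simp: K_def)
  have ST: "b \<bullet> c = 0" if b: "b \<in> ?S" and c: "\<forall>j\<in>K. coord j c = 0" for b c
  proof -
    have "coord k b * (\<alpha> k \<bullet> c) = 0" if k: "k \<in> Ix" for k
    proof (cases "k \<in> K")
      case True
      have "c \<bullet> \<alpha> k = (\<Sum>j\<in>Ix. coord j c * (\<alpha> j \<bullet> \<alpha> k))"
        by (rule inner_coord)
      also have "\<dots> = 0"
        using c orth[OF True] inK by (intro sum.neutral) (auto simp: inner_commute)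
      finally show ?thesis by (simp add: inner_commute)
    next
      case False
      then show ?thesis using b k by auto
    qed
    then show ?thesis
      unfolding inner_coord[of b c] by (intro sum.neutral) blast
  qed
  have pos_ST: "b \<in> ?S \<union> ?T" if "b \<in> pos" for b
    using that
  proof (induction rule: pos_induct)
    case (simple i)
    then show ?case
      using inK by (cases "i \<in> K") (auto simp: simple_root coord_simple)
  next
    case (step i b)
    have sR: "reflection (\<alpha> i) b \<in> \<Phi>" using step by (simp add: pos_root)
    have c: "coord j (reflection (\<alpha> i) b) = coord j b" if "j \<in> Ix" "j \<noteq> i" for j
      using that step by (simp add: reflection_def coord_diff coord_scaleR coord_simple)
    show ?case
    proof (cases "i \<in> K")
      case True
      show ?thesis
      proof (cases "b \<in> ?S")
        case True
        have "coord j (reflection (\<alpha> i) b) = 0" if "j \<in> Ix - K" for j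
          using that c[of j] True \<open>i \<in> K\<close> by auto
        then show ?thesis using sR by simp
      next
        case False
        then have "\<alpha> i \<bullet> b = 0"
          using step(4) ST[of "\<alpha> i" b] \<open>i \<in> K\<close> step(1) by (auto simp: simple_root coord_simple)
        then have "reflection (\<alpha> i) b = b" by (simp add: reflection_def inner_coroot inner_commute)
        then show ?thesis using step(4) by simp
      qed
    next
      case False
      show ?thesis
      proof (cases "b \<in> ?T")
        case True
        have "coord j (reflection (\<alpha> i) b) = 0" if "j \<in> K" for j
          using that c[of j] True \<open>i \<notin> K\<close> inK by auto
        then show ?thesis using sR by simp
      next
        case False
        have "\<forall>j\<in>K. coord j (\<alpha> i) = 0"
          using \<open>i \<notin> K\<close> step(1) inK by (auto simp: coord_simple)
        then have "b \<bullet> \<alpha> i = 0"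
          using step(4) ST[of b "\<alpha> i"] False by blast
        then have "reflection (\<alpha> i) b = b" by (simp add: reflection_def inner_coroot)
        then show ?thesis using step(4) by simp
      qed
    qed
  qed
  have U: "?S \<union> ?T = \<Phi>"
  proof
    show "\<Phi> \<subseteq> ?S \<union> ?T"
    proof
      fix b assume b: "b \<in> \<Phi>"
      show "b \<in> ?S \<union> ?T"
        using pos_ST[of b] pos_ST[of "- b"] pos_minus[OF b] b by (auto simp: coord_minus)
    qed
  qed auto
  have D: "?S \<inter> ?T = {}"
  proof -
    have "b = 0" if "b \<in> ?S \<inter> ?T" for b
      using that by (intro coord_eqI) auto
    then show ?thesis using zero_notin_roots by blast
  qed
  have "\<alpha> k0 \<in> ?S" "\<alpha> i \<in> ?T"
    using k0 iK inK by (auto simp: simple_root coord_simple subset_eq)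
  then have ne: "?S \<noteq> {}" "?T \<noteq> {}"
    by blast+
  have o: "\<forall>a\<in>?S. \<forall>b\<in>?T. a \<bullet> b = 0"
    using ST by auto
  have "\<exists>S T. S \<noteq> {} \<and> T \<noteq> {} \<and> S \<union> T = \<Phi> \<and> S \<inter> T = {} \<and> (\<forall>a\<in>S. \<forall>b\<in>T. a \<bullet> b = 0)"
    by (intro exI[of _ ?S] exI[of _ ?T] conjI U D ne o)
  then show False
    using irr unfolding irreducible_root_system_def by blast
qed

lemma maximal_root_unique:
  assumes "maximal_root h" "maximal_root h'"
  shows "h = h'"
proof (rule ccontr)
  assume ne: "h \<noteq> h'"
  have R: "h \<in> \<Phi>" "h' \<in> \<Phi>" using assms by (auto simp: maximal_root_def)
  obtain k where k: "k \<in> Ix" "0 < h \<bullet> \<alpha> k"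
    using pos_ex_simple_inner[OF maximal_root_pos[OF assms(1)]] by blast
  have "0 < (\<Sum>i\<in>Ix. coord i h' * (\<alpha> i \<bullet> h))"
  proof (rule sum_pos2[OF _ k(1)])
    show "0 < coord k h' * (\<alpha> k \<bullet> h)"
      using maximal_root_full_support[OF assms(2) k(1)] k(2) by (simp add: inner_commute)
  qed (auto intro!: mult_nonneg_nonneg simp: inner_commute maximal_root_dominant[OF assms(1)]
        less_imp_le maximal_root_full_support[OF assms(2)])
  then have "0 < h \<bullet> h'"
    by (metis inner_coord inner_commute)
  then have "h - h' \<in> \<Phi>"
    using root_diff R ne by blast
  then have "nn (h - h') \<or> nn (h' - h)"
    using nn_cases[of "h - h'"] by simp
  then show False
    using assms R ne by (auto simp: maximal_root_def)
qed

abbreviation "hr \<equiv> highest_root \<Phi> \<alpha>"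

lemma highest_root_props: "maximal_root hr" "b \<in> \<Phi> \<Longrightarrow> nn (hr - b)"
proof -
  obtain b0 where "b0 \<in> \<Phi>"
    using irr by (auto simp: irreducible_root_system_def)
  then obtain h where h: "maximal_root h" using ex_maximal_root by blast
  have top: "\<forall>b\<in>\<Phi>. nn (h - b)"
    using ex_maximal_root maximal_root_unique[OF h] by metis
  have "highest_root \<Phi> \<alpha> = h"
    unfolding highest_root_def
  proof (rule the_equality)
    show "h \<in> \<Phi> \<and> (\<forall>b\<in>\<Phi>. nn (h - b))"
      using h top by (simp add: maximal_root_def)
  next
    fix h' assume "h' \<in> \<Phi> \<and> (\<forall>b\<in>\<Phi>. nn (h' - b))"
    then show "h' = h" using h by (auto simp: maximal_root_def)
  qed
  then show "maximal_root hr" "b \<in> \<Phi> \<Longrightarrow> nn (hr - b)"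
    using h top by auto
qed

lemma highest_root_pos: "hr \<in> pos" and highest_root_root: "hr \<in> \<Phi>"
  using maximal_root_pos[OF highest_root_props(1)] pos_root by auto

lemma inner_highest_coroot_nonneg:
  assumes "g \<in> pos"
  shows "0 \<le> g \<bullet> coroot hr"
proof -
  have "0 \<le> (\<Sum>i\<in>Ix. coord i g * (\<alpha> i \<bullet> hr))"
    using nn_coord[OF pos_nn[OF assms]] maximal_root_dominant[OF highest_root_props(1)]
    by (intro sum_nonneg mult_nonneg_nonneg) (auto simp: inner_commute)
  then show ?thesis
    by (simp add: inner_coroot_nonneg_iff highest_root_root flip: inner_coord)
qed

lemma inner_highest_coroot_cases:
  assumes g: "g \<in> pos" "g \<noteq> hr"
  shows "g \<bullet> coroot hr = 0 \<or> g \<bullet> coroot hr = 1"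
proof (rule ccontr)
  assume n: "\<not> ?thesis"
  let ?n = "g \<bullet> coroot hr"
  note gR = pos_root[OF g(1)]
  have nZ: "?n \<in> \<int>" using inner_coroot_Ints[OF highest_root_root gR] .
  with n inner_highest_coroot_nonneg[OF g(1)] have n2: "?n - 2 \<in> \<nat>"
    by (auto elim!: Ints_cases simp: Nats_altdef2 algebra_simps)
  have "nn (hr - reflection hr (- g))"
    by (rule highest_root_props) (simp add: reflection_roots highest_root_root gR)
  then have "nn (g - (?n - 1) *\<^sub>R hr)"
    by (simp add: reflection_def algebra_simps)
  moreover have "nn ((?n - 2) *\<^sub>R hr)"
    using n2 highest_root_pos by (intro nn_scale pos_nn)
  ultimately have "nn ((g - (?n - 1) *\<^sub>R hr) + (?n - 2) *\<^sub>R hr)"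
    by (rule nn_add)
  then have "nn (g - hr)"
    by (simp add: algebra_simps scaleR_2)
  then show False
    using highest_root_props(1) gR g(2) by (auto simp: maximal_root_def)
qed

lemma highest_root_minus_pos:
  assumes "g \<in> pos" "hr - g \<in> \<Phi>"
  shows "hr - g \<in> pos"
  using assms highest_root_props(2)[OF pos_root[OF assms(1)]] by (simp add: pos_roots_def)

lemma highest_root_inversions:
  "{g \<in> pos. reflection hr g \<notin> pos} = {g \<in> pos. g \<bullet> coroot hr \<noteq> 0}" (is "?A = ?B")
proof
  show "?A \<subseteq> ?B"
    by (auto simp: reflection_def)
  show "?B \<subseteq> ?A"
  proof
    fix g assume "g \<in> ?B"
    then have g: "g \<in> pos" "g \<bullet> coroot hr \<noteq> 0" by auto
    show "g \<in> ?A"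
    proof (cases "g = hr")
      case True
      then show ?thesis
        using g pos_minus[OF highest_root_root] by (simp add: reflection_self root_nonzero highest_root_root)
    next
      case False
      then have e: "reflection hr g = - (hr - g)"
        using inner_highest_coroot_cases[OF g(1)] g by (simp add: reflection_def)
      have R: "reflection hr g \<in> \<Phi>"
        using reflection_roots[OF highest_root_root pos_root[OF g(1)]] .
      then have hg: "hr - g \<in> \<Phi>" using e minus_root by (metis minus_minus)
      show ?thesis
        using highest_root_minus_pos[OF g(1) hg] pos_minus[OF hg] e g by simp
    qed
  qed
qed

lemma rho_coroot_W:
  assumes "w \<in> W" "a \<in> \<Phi>"
  shows "2 * (rho \<Phi> \<alpha> \<bullet> coroot (inv w a)) = (\<Sum>g\<in>pos. sg (inv w g) * (g \<bullet> coroot a))"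
proof -
  have "2 * (rho \<Phi> \<alpha> \<bullet> coroot (inv w a)) = (\<Sum>g\<in>pos. w g \<bullet> coroot a)"
    using assms by (simp add: rho_inner W_coroot W_inv W_adjoint)
  also have "\<dots> = (\<Sum>g\<in>pos. sg (inv w g) * (g \<bullet> coroot a))"
    by (rule sum_pos_W[OF assms(1)]) simp
  finally show ?thesis .
qed

lemma length_highest_left:
  assumes w: "w \<in> W"
  shows "real (weyl_length \<alpha> (reflection hr \<circ> w)) =
    real (weyl_length \<alpha> w) + 2 * (rho \<Phi> \<alpha> \<bullet> coroot (inv w hr)) - sg (inv w hr)"
proof -
  let ?B = "{g \<in> pos. g \<bullet> coroot hr \<noteq> 0}"
  have "(\<Sum>g\<in>pos. sg (inv w g) * (g \<bullet> coroot hr)) = (\<Sum>g\<in>?B. sg (inv w g) * (g \<bullet> coroot hr))"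
    by (rule sum.mono_neutral_right) (auto simp: finite_pos)
  also have "\<dots> = (\<Sum>g\<in>?B. sg (inv w g) + (if g = hr then sg (inv w hr) else 0))"
  proof (rule sum.cong[OF refl])
    fix g assume "g \<in> ?B"
    then show "sg (inv w g) * (g \<bullet> coroot hr) = sg (inv w g) + (if g = hr then sg (inv w hr) else 0)"
      using inner_highest_coroot_cases[of g] inner_coroot_self[OF root_nonzero[OF highest_root_root]]
      by auto
  qed
  also have "\<dots> = (\<Sum>g\<in>?B. sg (inv w g)) + sg (inv w hr)"
    using highest_root_pos inner_coroot_self[OF root_nonzero[OF highest_root_root]] finite_pos
    by (simp add: sum.distrib)
  finally show ?thesis
    using length_reflection_left[OF w highest_root_root] rho_coroot_W[OF w highest_root_root]
    by (simp add: highest_root_inversions)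
qed


subsection \<open>Left multiplication by affine simple reflections in the quantum Bruhat graph\<close>

lemma qbg_edgeD: "qbg_edge \<Phi> \<alpha> w b w' \<Longrightarrow> w \<in> W \<and> b \<in> pos \<and> w' = w \<circ> reflection b"
  by (simp add: qbg_edge_def)

lemma qbg_edge_cases:
  assumes "qbg_edge \<Phi> \<alpha> w b (w \<circ> reflection b)"
  obtains (bruhat) "w b \<in> pos" "real (weyl_length \<alpha> (w \<circ> reflection b)) = real (weyl_length \<alpha> w) + 1"
  | (quantum) "w b \<notin> pos"
    "real (weyl_length \<alpha> (w \<circ> reflection b)) = real (weyl_length \<alpha> w) - 2 * (rho \<Phi> \<alpha> \<bullet> coroot b) + 1"
proof -
  have w: "w \<in> W" and b: "b \<in> pos" using assms by (auto simp: qbg_edge_def)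
  note iff = length_reflection_iff[OF w b] and h = length_reflection_le(2)[OF b]
  from assms have "weyl_length \<alpha> (w \<circ> reflection b) = weyl_length \<alpha> w + 1 \<or>
      real (weyl_length \<alpha> (w \<circ> reflection b)) = real (weyl_length \<alpha> w) - 2 * (rho \<Phi> \<alpha> \<bullet> coroot b) + 1"
    by (simp add: qbg_edge_def)
  then show thesis
  proof
    assume e: "weyl_length \<alpha> (w \<circ> reflection b) = weyl_length \<alpha> w + 1"
    then have "w b \<in> pos" using iff by simp
    then show thesis using bruhat e by simp
  next
    assume e: "real (weyl_length \<alpha> (w \<circ> reflection b)) = real (weyl_length \<alpha> w) - 2 * (rho \<Phi> \<alpha> \<bullet> coroot b) + 1"
    then have "real (weyl_length \<alpha> (w \<circ> reflection b)) < real (weyl_length \<alpha> w)" using h by simp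
    then have "w b \<notin> pos" using iff by simp
    then show thesis using quantum e by simp
  qed
qed

lemma qbg_edgeI:
  assumes "w \<in> W" "b \<in> pos"
    and "real (weyl_length \<alpha> (w \<circ> reflection b)) = real (weyl_length \<alpha> w) + 1 \<or>
      real (weyl_length \<alpha> (w \<circ> reflection b)) = real (weyl_length \<alpha> w) - 2 * (rho \<Phi> \<alpha> \<bullet> coroot b) + 1"
  shows "qbg_edge \<Phi> \<alpha> w b (w \<circ> reflection b)"
  using assms by (auto simp: qbg_edge_def)

definition affine_simple :: "'a \<Rightarrow> bool" where
  "affine_simple a \<longleftrightarrow> a \<in> \<alpha> ` Ix \<or> a = - hr"

lemma affine_simple_cases:
  assumes "affine_simple a"
  obtains i where "i \<in> Ix" "a = \<alpha> i" | "a = - hr"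
  using assms by (auto simp: affine_simple_def)

lemma affine_simple_root_in: "affine_simple a \<Longrightarrow> a \<in> \<Phi>"
  by (auto simp: affine_simple_def simple_root highest_root_root)

lemma affine_simple_affine_simple_root: "p \<in> {0..DIM('a)} \<Longrightarrow> affine_simple (affine_simple_root \<Phi> \<alpha> p)"
proof -
  assume "p \<in> {0..DIM('a)}"
  then have "p = 0 \<or> p \<in> Ix" by (auto simp: Ix)
  then show ?thesis
    by (auto simp: affine_simple_root_def affine_simple_def)
qed

lemma sg_affine_simple_root: "p \<in> {0..DIM('a)} \<Longrightarrow> (1 - sg (affine_simple_root \<Phi> \<alpha> p)) / 2 = of_bool (p = 0)"
  using highest_root_root highest_root_pos
  by (auto simp: affine_simple_root_def sg_minus sg_pos simple_pos Ix)

lemma length_affine_left: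
  assumes "w \<in> W"
  shows "real (weyl_length \<alpha> (reflection (- hr) \<circ> w)) =
    real (weyl_length \<alpha> w) - 2 * (rho \<Phi> \<alpha> \<bullet> coroot (inv w (- hr))) + sg (inv w (- hr))"
  using length_highest_left[OF assms] assms
  by (simp add: W_uminus W_inv sg_minus W_root highest_root_root)

lemma qbg_edge_left:
  assumes a: "affine_simple a" and w: "w \<in> W" and d: "inv w a \<in> pos"
  shows "qbg_edge \<Phi> \<alpha> w (inv w a) (reflection a \<circ> w)"
proof -
  have e: "reflection a \<circ> w = w \<circ> reflection (inv w a)"
    by (rule W_reflection_conj_inv[OF w])
  from a have "real (weyl_length \<alpha> (reflection a \<circ> w)) = real (weyl_length \<alpha> w) + 1 \<or>
      real (weyl_length \<alpha> (reflection a \<circ> w))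
        = real (weyl_length \<alpha> w) - 2 * (rho \<Phi> \<alpha> \<bullet> coroot (inv w a)) + 1"
  proof (cases rule: affine_simple_cases)
    case (1 i)
    then show ?thesis using length_simple_left[OF w] d by (simp add: sg_pos)
  next
    case 2
    then show ?thesis using length_affine_left[OF w] d by (simp add: sg_pos)
  qed
  then show ?thesis
    unfolding e by (rule qbg_edgeI[OF w d])
qed

lemma inner_coroot_inv: "w \<in> W \<Longrightarrow> x \<bullet> coroot (inv w a) = w x \<bullet> coroot a"
  by (simp add: W_coroot W_inv W_adjoint)

lemma qbg_edge_sign_change:
  assumes a: "affine_simple a" and E: "qbg_edge \<Phi> \<alpha> w b (w \<circ> reflection b)"
    and d: "inv w a \<in> pos" and d': "inv (w \<circ> reflection b) a \<notin> pos"
  shows "b = inv w a"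
proof -
  have w: "w \<in> W" and b: "b \<in> pos" using E by (auto dest: qbg_edgeD)
  note bR = pos_root[OF b] and aR = affine_simple_root_in[OF a]
  have wb: "w \<circ> reflection b \<in> W" and sw: "reflection a \<circ> w \<in> W"
    using w bR aR by (auto intro: W_reflection_right W_reflection_left)
  have iff: "weyl_length \<alpha> (reflection a \<circ> w) < weyl_length \<alpha> (reflection a \<circ> (w \<circ> reflection b))
      \<longleftrightarrow> reflection a (w b) \<in> pos"
    using length_reflection_iff[OF sw b] by (simp add: comp_assoc)
  from a show ?thesis
  proof (cases rule: affine_simple_cases)
    case (1 i)
    have l: "real (weyl_length \<alpha> (reflection a \<circ> w)) = real (weyl_length \<alpha> w) + 1"
      "real (weyl_length \<alpha> (reflection a \<circ> (w \<circ> reflection b))) = real (weyl_length \<alpha> (w \<circ> reflection b)) - 1"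
      using length_simple_left[OF w 1(1)] length_simple_left[OF wb 1(1)] d d' 1 sg_eq_m1 by (auto simp: sg_pos)
    from E show ?thesis
    proof (cases rule: qbg_edge_cases)
      case bruhat
      then have "reflection a (w b) \<notin> pos" using l iff by simp
      then have "w b = a" using simple_reflection_pos[OF 1(1) bruhat(1)] 1 by auto
      then show ?thesis using w by auto
    next
      case quantum
      have sp: "reflection a \<circ> w = (reflection a \<circ> (w \<circ> reflection b)) \<circ> reflection b"
        by (simp add: comp_assoc)
      have "weyl_length \<alpha> (reflection a \<circ> w)
          \<le> weyl_length \<alpha> (reflection a \<circ> (w \<circ> reflection b)) + weyl_length \<alpha> (reflection b)"
        by (subst sp, rule length_comp_le) (use wb aR bR in \<open>auto intro: W_reflection_left W_reflection\<close>)
      then show ?thesis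
        using l quantum length_reflection_le(1)[OF b] by linarith
    qed
  next
    case 2
    let ?d = "inv w a" and ?K = "b \<bullet> coroot (inv w a)"
    have dR: "?d \<in> \<Phi>" using d by (rule pos_root)
    have d'_eq: "inv (w \<circ> reflection b) a = reflection b ?d"
      by (simp add: inv_reflection_right w)
    have K: "0 < ?K"
    proof (rule ccontr)
      assume "\<not> 0 < ?K"
      then have "?d \<bullet> coroot b \<le> 0"
        using inner_coroot_pos_iff[OF dR, of b] inner_coroot_pos_iff[OF bR, of ?d]
        by (simp add: inner_commute)
      moreover have "?d \<bullet> coroot b \<in> \<int>"
        using inner_coroot_Ints[OF bR dR] .
      ultimately have "- (?d \<bullet> coroot b) \<in> \<nat>"
        by (auto elim!: Ints_cases simp: Nats_altdef2)
      then have "nn (?d + (- (?d \<bullet> coroot b)) *\<^sub>R b)"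
        using d b by (intro nn_add nn_scale pos_nn)
      then have "reflection b ?d \<in> pos"
        using reflection_roots[OF bR dR] by (simp add: pos_roots_def reflection_def)
      then show False using d' d'_eq by simp
    qed
    have Kw: "w b \<bullet> coroot hr = - ?K"
      using 2 by (simp add: inner_coroot_inv w)
    have cd': "coroot (inv (w \<circ> reflection b) a) = coroot ?d - ?K *\<^sub>R coroot b"
      by (simp add: d'_eq coroot_reflection)
    from E show ?thesis
    proof (cases rule: qbg_edge_cases)
      case bruhat
      then show ?thesis using inner_highest_coroot_nonneg[of "w b"] Kw K by simp
    next
      case quantum
      have m: "- w b \<in> pos" using quantum(1) pos_minus[OF W_root[OF w bR]] by simp
      show ?thesis
      proof (cases "- w b = hr")
        case True
        then have "w b = a" using 2 by (metis minus_minus)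
        then show ?thesis using w by auto
      next
        case False
        then have K1: "?K = 1"
          using inner_highest_coroot_cases[OF m] Kw K by auto
        have "real (weyl_length \<alpha> (reflection a \<circ> w)) =
            real (weyl_length \<alpha> w) - 2 * (rho \<Phi> \<alpha> \<bullet> coroot ?d) + 1"
          using length_affine_left[OF w] 2 d by (simp add: sg_pos)
        moreover have "real (weyl_length \<alpha> (reflection a \<circ> (w \<circ> reflection b))) =
            real (weyl_length \<alpha> (w \<circ> reflection b)) - 2 * (rho \<Phi> \<alpha> \<bullet> coroot (inv (w \<circ> reflection b) a)) - 1"
          using length_affine_left[OF wb] 2 d' sg_eq_m1[of "inv (w \<circ> reflection b) a"] by simp
        ultimately have "weyl_length \<alpha> (reflection a \<circ> (w \<circ> reflection b)) < weyl_length \<alpha> (reflection a \<circ> w)"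
          using quantum(2) by (simp add: cd' K1 inner_diff_right)
        then have n: "reflection a (w b) \<notin> pos" using iff by simp
        have e: "reflection a (w b) = hr - (- w b)"
          using 2 Kw K1 by (simp add: reflection_def)
        have "reflection a (w b) \<in> \<Phi>"
          using reflection_roots[OF aR W_root[OF w bR]] .
        then show ?thesis
          using highest_root_minus_pos[OF m] n e by simp
      qed
    qed
  qed
qed

lemma qbg_edge_left_mult:
  assumes a: "affine_simple a" and E: "qbg_edge \<Phi> \<alpha> w b (w \<circ> reflection b)"
    and sg: "inv w a \<in> pos \<longleftrightarrow> inv (w \<circ> reflection b) a \<in> pos" and ne: "b \<noteq> inv w a" "b \<noteq> - inv w a"
  shows "qbg_edge \<Phi> \<alpha> (reflection a \<circ> w) b (reflection a \<circ> w \<circ> reflection b)"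
proof -
  have w: "w \<in> W" and b: "b \<in> pos" using E by (auto dest: qbg_edgeD)
  note bR = pos_root[OF b] and aR = affine_simple_root_in[OF a]
  have wb: "w \<circ> reflection b \<in> W" and sw: "reflection a \<circ> w \<in> W"
    using w bR aR by (auto intro: W_reflection_right W_reflection_left)
  have sgn: "sg (inv (w \<circ> reflection b) a) = sg (inv w a)"
    using sg by (simp add: root_sgn_def)
  from a show ?thesis
  proof (cases rule: affine_simple_cases)
    case (1 i)
    show ?thesis
      using E length_simple_left[OF w 1(1)] length_simple_left[OF wb 1(1)] 1 sgn
      by (intro qbg_edgeI[OF sw b]) (auto simp: comp_assoc elim: qbg_edge_cases)
  next
    case 2
    let ?K = "b \<bullet> coroot (inv w a)"
    have Kw: "w b \<bullet> coroot hr = - ?K"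
      using 2 by (simp add: inner_coroot_inv w)
    have cd': "coroot (inv (w \<circ> reflection b) a) = coroot (inv w a) - ?K *\<^sub>R coroot b"
      by (simp add: inv_reflection_right w coroot_reflection)
    have wne: "w b \<noteq> hr" "- w b \<noteq> hr"
    proof -
      have "w b \<noteq> - a" "w b \<noteq> a"
        using ne w by (auto simp: W_uminus W_inv) (metis W_inv W_inv_apply(1) W_uminus)+
      then show "w b \<noteq> hr" "- w b \<noteq> hr" using 2 by (metis minus_minus)+
    qed
    have l: "real (weyl_length \<alpha> (reflection a \<circ> w \<circ> reflection b)) - real (weyl_length \<alpha> (reflection a \<circ> w)) =
        real (weyl_length \<alpha> (w \<circ> reflection b)) - real (weyl_length \<alpha> w) + 2 * ?K * (rho \<Phi> \<alpha> \<bullet> coroot b)"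
    proof -
      have r: "rho \<Phi> \<alpha> \<bullet> coroot (inv (w \<circ> reflection b) a)
          = rho \<Phi> \<alpha> \<bullet> coroot (inv w a) - ?K * (rho \<Phi> \<alpha> \<bullet> coroot b)"
        by (simp add: cd' inner_diff_right)
      show ?thesis
        using length_affine_left[OF w] length_affine_left[OF wb] sgn
        unfolding 2[symmetric] r by (simp add: comp_assoc algebra_simps)
    qed
    from E show ?thesis
    proof (cases rule: qbg_edge_cases)
      case bruhat
      then have "?K = 0 \<or> ?K = -1"
        using inner_highest_coroot_cases[of "w b"] wne Kw by auto
      then show ?thesis
        using l bruhat by (intro qbg_edgeI[OF sw b]) auto
    next
      case quantum
      have m: "- w b \<in> pos" using quantum(1) pos_minus[OF W_root[OF w bR]] by simp
      then have "?K = 0 \<or> ?K = 1"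
        using inner_highest_coroot_cases[OF m] wne Kw by auto
      then show ?thesis
        using l quantum by (intro qbg_edgeI[OF sw b]) auto
    qed
  qed
qed


subsection \<open>Alcoves\<close>

lemma alcove_notin_Ints:
  assumes "A \<in> alcoves \<Phi>" "x \<in> A" "a \<in> \<Phi>"
  shows "x \<bullet> coroot a \<notin> \<int>"
proof
  assume "x \<bullet> coroot a \<in> \<int>"
  then obtain k where "x \<in> hyp a k" by (auto simp: hyp_def elim: Ints_cases)
  then show False
    using in_components_subset[of A] assms unfolding alcoves_def by blast
qed

lemma alcove_open: "A \<in> alcoves \<Phi> \<Longrightarrow> open A"
proof -
  have "(\<Union>k. hyp a k) = (\<lambda>x. x \<bullet> coroot a) -` \<int>" for a :: 'a
    by (auto simp: hyp_def elim: Ints_cases)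
  then have "closed (\<Union>a\<in>\<Phi>. \<Union>k. hyp a k)"
    using finite_roots by (auto intro!: closed_UN closed_vimage continuous_intros)
  then show "A \<in> alcoves \<Phi> \<Longrightarrow> open A"
    unfolding alcoves_def by (meson open_Compl open_components)
qed

lemma alcove_nonempty: "A \<in> alcoves \<Phi> \<Longrightarrow> A \<noteq> {}"
  and alcove_connected: "A \<in> alcoves \<Phi> \<Longrightarrow> connected A"
  unfolding alcoves_def by (auto dest: in_components_nonempty in_components_connected)

lemma alcove_floor_le:
  assumes "A \<in> alcoves \<Phi>" "x \<in> A" "y \<in> A" "a \<in> \<Phi>"
  shows "\<lfloor>x \<bullet> coroot a\<rfloor> \<le> \<lfloor>y \<bullet> coroot a\<rfloor>"
proof (rule ccontr)
  assume "\<not> ?thesis"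
  then have "coroot a \<bullet> y \<le> of_int \<lfloor>x \<bullet> coroot a\<rfloor>" "of_int \<lfloor>x \<bullet> coroot a\<rfloor> \<le> coroot a \<bullet> x"
    by (simp_all add: inner_commute) linarith
  from connected_ivt_hyperplane[OF alcove_connected[OF assms(1)] assms(3,2) this]
  obtain z where "z \<in> A" "z \<bullet> coroot a \<in> \<int>"
    by (auto simp: inner_commute)
  then show False
    using alcove_notin_Ints assms by blast
qed

lemma alcove_floor_eq:
  "A \<in> alcoves \<Phi> \<Longrightarrow> x \<in> A \<Longrightarrow> y \<in> A \<Longrightarrow> a \<in> \<Phi> \<Longrightarrow> \<lfloor>x \<bullet> coroot a\<rfloor> = \<lfloor>y \<bullet> coroot a\<rfloor>"
  by (intro antisym alcove_floor_le)

lemma alcove_closure_floor: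
  assumes A: "A \<in> alcoves \<Phi>" "x \<in> A" "a \<in> \<Phi>" and z: "z \<in> closure A"
  shows "of_int \<lfloor>x \<bullet> coroot a\<rfloor> \<le> z \<bullet> coroot a" "z \<bullet> coroot a \<le> of_int \<lfloor>x \<bullet> coroot a\<rfloor> + 1"
proof -
  let ?l = "\<lfloor>x \<bullet> coroot a\<rfloor>"
  have "closed {z. of_int ?l \<le> z \<bullet> coroot a \<and> z \<bullet> coroot a \<le> of_int ?l + 1}"
    by (intro closed_Collect_conj closed_Collect_le continuous_intros)
  moreover have "A \<subseteq> {z. of_int ?l \<le> z \<bullet> coroot a \<and> z \<bullet> coroot a \<le> of_int ?l + 1}"
    using alcove_floor_eq[OF A(1,2) _ A(3)] by (auto simp: real_of_int_floor_add_one_ge)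
  ultimately show "of_int ?l \<le> z \<bullet> coroot a" "z \<bullet> coroot a \<le> of_int ?l + 1"
    using closure_minimal z by blast+
qed

lemma facet_generic_point:
  assumes A: "A \<in> alcoves \<Phi>" and F: "F facet_of closure A" "F \<subseteq> hyp b k"
    and b: "b \<in> \<Phi>" and d: "d \<in> \<Phi>" "d \<noteq> b" "d \<noteq> - b"
  shows "\<exists>z\<in>F. z \<bullet> coroot d \<notin> \<int>"
proof (rule ccontr)
  assume "\<not> ?thesis"
  then have int: "z \<bullet> coroot d \<in> \<int>" if "z \<in> F" for z using that by blast
  have convF: "convex F" and neF: "F \<noteq> {}" and dimF: "aff_dim F = aff_dim (closure A) - 1"
    using F(1) by (auto simp: facet_of_def face_of_imp_convex)
  have dimA: "aff_dim (closure A) = int DIM('a)"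
    using aff_dim_open[OF alcove_open[OF A] alcove_nonempty[OF A]] by simp
  obtain z0 where z0: "z0 \<in> F" using neF by blast
  let ?l = "z0 \<bullet> coroot d"
  have le: "y \<bullet> coroot d \<le> x \<bullet> coroot d" if x: "x \<in> F" and y: "y \<in> F" for x y
  proof (rule ccontr)
    assume n: "\<not> ?thesis"
    obtain i j where ij: "x \<bullet> coroot d = of_int i" "y \<bullet> coroot d = of_int j"
      using int[OF x] int[OF y] by (auto elim!: Ints_cases)
    have "coroot d \<bullet> x \<le> of_int i + 1 / 2" "of_int i + 1 / 2 \<le> coroot d \<bullet> y"
      using n ij by (simp_all add: inner_commute)
    from connected_ivt_hyperplane[OF convex_connected[OF convF] x y this]
    obtain z where z: "z \<in> F" "z \<bullet> coroot d = of_int i + 1 / 2"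
      by (auto simp: inner_commute)
    then obtain q where "real_of_int q = of_int i + 1 / 2"
      using int[of z] by (auto elim!: Ints_cases)
    then have "real_of_int (2 * q) = of_int (2 * i + 1)" by simp
    then show False unfolding of_int_eq_iff by presburger
  qed
  let ?S = "{x. coroot b \<bullet> x = of_int k}" and ?T = "{x. coroot d \<bullet> x = ?l}"
  have FS: "F \<subseteq> ?S \<inter> ?T"
    using F(2) le[OF z0] le[OF _ z0] by (auto simp: hyp_def inner_commute intro: antisym)
  have "coroot b \<noteq> 0" using root_nonzero[OF b] by (simp add: coroot_def)
  then have dimS: "aff_dim ?S = int DIM('a) - 1"
    by (simp add: aff_dim_hyperplane)
  have "\<not> ?S \<subseteq> ?T"
  proof
    assume ST: "?S \<subseteq> ?T"
    define c where "c = (d \<bullet> b) / (b \<bullet> b)"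
    define v where "v = d - c *\<^sub>R b"
    have vb: "v \<bullet> b = 0"
      using root_nonzero[OF b] by (simp add: v_def c_def inner_diff_left)
    have "z0 \<in> ?S" using FS z0 by blast
    then have "z0 + v \<in> ?S"
      using vb by (simp add: inner_add_right coroot_def inner_commute)
    then have "z0 + v \<in> ?T" using ST by blast
    then have "v \<bullet> d = 0"
      using root_nonzero[OF d(1)] by (simp add: inner_add_right inner_commute coroot_def)
    then have "v \<bullet> v = 0"
      using vb by (simp add: v_def inner_diff_right)
    then have "d = c *\<^sub>R b" by (simp add: v_def)
    then show False
      using reduced[OF b, of c] d by auto
  qed
  moreover have "?S \<inter> ?T \<noteq> {}" using FS z0 by blast
  ultimately have "aff_dim (?S \<inter> ?T) = aff_dim ?S - 1"
    using aff_dim_affine_Int_hyperplane[OF affine_hyperplane, of "coroot b" "of_int k" "coroot d" ?l] by simp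
  then show False
    using aff_dim_subset[OF FS] dimF dimA dimS by linarith
qed

context
  fixes A B F :: "'a set" and b :: 'a and k :: int
  assumes AB: "A \<in> alcoves \<Phi>" "B \<in> alcoves \<Phi>" and F: "common_wall F A B" "F \<subseteq> hyp b k"
    and b: "b \<in> \<Phi>" and sides: "\<forall>x\<in>A. x \<bullet> coroot b > of_int k" "\<forall>x\<in>B. x \<bullet> coroot b < of_int k"
begin

lemma wall_subset_closure: "F \<subseteq> closure A" "F \<subseteq> closure B" "F \<noteq> {}"
  using F by (auto simp: common_wall_def facet_of_def face_of_def)

lemma wall_floor:
  assumes "x \<in> A" "y \<in> B"
  shows "\<lfloor>x \<bullet> coroot b\<rfloor> = k" "\<lfloor>y \<bullet> coroot b\<rfloor> = k - 1"
proof -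
  obtain z where z: "z \<in> F" using wall_subset_closure by blast
  have zk: "z \<bullet> coroot b = of_int k" using z F by (auto simp: hyp_def)
  have "of_int \<lfloor>x \<bullet> coroot b\<rfloor> \<le> z \<bullet> coroot b"
    using alcove_closure_floor(1)[OF AB(1) assms(1) b] z wall_subset_closure by blast
  moreover have "of_int k < x \<bullet> coroot b"
    using assms sides by blast
  ultimately show "\<lfloor>x \<bullet> coroot b\<rfloor> = k"
    using zk by linarith
  have "z \<bullet> coroot b \<le> of_int \<lfloor>y \<bullet> coroot b\<rfloor> + 1"
    using alcove_closure_floor(2)[OF AB(2) assms(2) b] z wall_subset_closure by blast
  moreover have "y \<bullet> coroot b < of_int k"
    using assms sides by blast
  ultimately show "\<lfloor>y \<bullet> coroot b\<rfloor> = k - 1"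
    using zk by linarith
qed

lemma wall_floor_other:
  assumes xy: "x \<in> A" "y \<in> B" and d: "d \<in> \<Phi>" "d \<noteq> b" "d \<noteq> - b"
  shows "\<lfloor>x \<bullet> coroot d\<rfloor> = \<lfloor>y \<bullet> coroot d\<rfloor>"
    and "real_of_int \<lfloor>y \<bullet> coroot (reflection b d)\<rfloor> = of_int \<lfloor>x \<bullet> coroot d\<rfloor> - of_int k * (b \<bullet> coroot d)"
proof -
  obtain z where z: "z \<in> F" "z \<bullet> coroot d \<notin> \<int>"
    using facet_generic_point[OF AB(1) _ F(2) b d] F(1) by (auto simp: common_wall_def)
  have zA: "z \<in> closure A" and zB: "z \<in> closure B" using z wall_subset_closure by auto
  have fl: "\<lfloor>u \<bullet> coroot e\<rfloor> = \<lfloor>z \<bullet> coroot e\<rfloor>"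
    if "C \<in> alcoves \<Phi>" "u \<in> C" "z \<in> closure C" "e \<in> \<Phi>" "z \<bullet> coroot e \<notin> \<int>" for C u e
  proof -
    have "of_int \<lfloor>u \<bullet> coroot e\<rfloor> \<le> z \<bullet> coroot e" "z \<bullet> coroot e \<le> of_int \<lfloor>u \<bullet> coroot e\<rfloor> + 1"
      using alcove_closure_floor[OF that(1,2,4,3)] by auto
    moreover have "z \<bullet> coroot e \<noteq> of_int (\<lfloor>u \<bullet> coroot e\<rfloor> + 1)"
      using that(5) by (metis Ints_of_int)
    ultimately show ?thesis by (intro floor_unique[symmetric]) auto
  qed
  show "\<lfloor>x \<bullet> coroot d\<rfloor> = \<lfloor>y \<bullet> coroot d\<rfloor>"
    using fl[OF AB(1) xy(1) zA d(1) z(2)] fl[OF AB(2) xy(2) zB d(1) z(2)] by simp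
  obtain q where q: "b \<bullet> coroot d = of_int q"
    using inner_coroot_Ints[OF d(1) b] by (auto elim: Ints_cases)
  have "z \<bullet> coroot b = of_int k" using z(1) F(2) by (auto simp: hyp_def)
  then have e: "z \<bullet> coroot (reflection b d) = z \<bullet> coroot d - of_int (q * k)"
    by (simp add: coroot_reflection inner_diff_right q)
  then have "z \<bullet> coroot (reflection b d) \<notin> \<int>"
    using z(2) by (metis Ints_add Ints_of_int diff_add_cancel)
  then have "\<lfloor>y \<bullet> coroot (reflection b d)\<rfloor> = \<lfloor>z \<bullet> coroot (reflection b d)\<rfloor>"
    using fl[OF AB(2) xy(2) zB reflection_roots[OF b d(1)]] by blast
  also have "\<dots> = \<lfloor>x \<bullet> coroot d\<rfloor> - q * k"
    unfolding e floor_diff_of_int fl[OF AB(1) xy(1) zA d(1) z(2)] ..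
  finally show "real_of_int \<lfloor>y \<bullet> coroot (reflection b d)\<rfloor>
      = of_int \<lfloor>x \<bullet> coroot d\<rfloor> - of_int k * (b \<bullet> coroot d)"
    by (simp add: q)
qed

end

lemma floor_minus_notin_Ints:
  fixes x :: real
  assumes "x \<notin> \<int>"
  shows "\<lfloor>- x\<rfloor> = - \<lfloor>x\<rfloor> - 1"
proof -
  have "x \<noteq> of_int \<lfloor>x\<rfloor>" using assms by (metis Ints_of_int)
  then show ?thesis by (intro floor_unique) linarith+
qed

end

subsection \<open>Products of reflections along a chain\<close>

lemma sorted_list_of_set_less_Suc:
  fixes J :: "nat set"
  assumes "finite J"
  shows "sorted_list_of_set {j \<in> J. j < Suc i} =
    (if i \<in> J then sorted_list_of_set {j \<in> J. j < i} @ [i] else sorted_list_of_set {j \<in> J. j < i})"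
proof -
  have "{j \<in> J. j < Suc i} = (if i \<in> J then insert i {j \<in> J. j < i} else {j \<in> J. j < i})"
    by (auto simp: less_Suc_eq)
  then show ?thesis
    using assms by (intro sorted_distinct_set_unique) (auto simp: sorted_append)
qed

lemma refl_prod_Suc:
  assumes "finite J"
  shows "refl_prod \<beta> {j \<in> J. j < Suc i} =
    (if i \<in> J then refl_prod \<beta> {j \<in> J. j < i} \<circ> reflection (\<beta> i) else refl_prod \<beta> {j \<in> J. j < i})"
  by (simp add: refl_prod_def sorted_list_of_set_less_Suc[OF assms] comp_list_append)

lemma aff_refl_prod_Suc:
  assumes "finite J"
  shows "aff_refl_prod \<beta> {j \<in> J. j < Suc i} =
    (if i \<in> J then aff_refl_prod \<beta> {j \<in> J. j < i} \<circ> aff_reflection (\<beta> i) (- chain_level \<beta> i)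
     else aff_refl_prod \<beta> {j \<in> J. j < i})"
  by (simp add: aff_refl_prod_def sorted_list_of_set_less_Suc[OF assms] comp_list_append)

lemma aff_reflection_eq: "aff_reflection a k x = reflection a x + of_int k *\<^sub>R a"
  by (simp add: aff_reflection_def reflection_def algebra_simps)

locale root_chain = root_base \<Phi> \<alpha> Ix for \<Phi> :: "'a::euclidean_space set" and \<alpha> Ix +
  fixes lam :: 'a and m :: nat and \<beta> :: "nat \<Rightarrow> 'a"
  assumes dominant: "dominant_weight \<Phi> \<alpha> lam" and chain: "lambda_chain \<Phi> \<alpha> lam m \<beta>"
begin

lemma chain_pos: "i \<in> {1..m} \<Longrightarrow> \<beta> i \<in> pos"
  using chain by (simp add: lambda_chain_def)

lemma chain_root: "i \<in> {1..m} \<Longrightarrow> \<beta> i \<in> \<Phi>"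
  using chain_pos pos_root by blast

lemma root_neq_minus: "b \<in> \<Phi> \<Longrightarrow> b \<noteq> - b"
  using pos_minus[of b] by metis

text \<open>One point is chosen in each alcove of the path; only the strips containing it matter.\<close>

lemma chain_points:
  obtains x :: "nat \<Rightarrow> 'a" where
    "\<And>b. b \<in> pos \<Longrightarrow> \<lfloor>x 0 \<bullet> coroot b\<rfloor> = 0"
    "\<And>b. b \<in> \<Phi> \<Longrightarrow> real_of_int \<lfloor>x m \<bullet> coroot b\<rfloor> = real_of_int \<lfloor>x 0 \<bullet> coroot b\<rfloor> - lam \<bullet> coroot b"
    "\<And>i b. i \<le> m \<Longrightarrow> b \<in> \<Phi> \<Longrightarrow> x i \<bullet> coroot b \<notin> \<int>"
    "\<And>i d. i \<in> {1..m} \<Longrightarrow> d \<in> \<Phi> \<Longrightarrow>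
       \<lfloor>x i \<bullet> coroot d\<rfloor> = \<lfloor>x (i - 1) \<bullet> coroot d\<rfloor> - of_bool (d = \<beta> i) + of_bool (d = - \<beta> i)"
    "\<And>i d. i \<in> {1..m} \<Longrightarrow> d \<in> \<Phi> \<Longrightarrow> real_of_int \<lfloor>x i \<bullet> coroot (reflection (\<beta> i) d)\<rfloor> =
       real_of_int \<lfloor>x (i - 1) \<bullet> coroot d\<rfloor> + real_of_int (chain_level \<beta> i) * (\<beta> i \<bullet> coroot d)"
    "\<And>i. i \<in> {1..m} \<Longrightarrow> \<lfloor>x (i - 1) \<bullet> coroot (\<beta> i)\<rfloor> = - chain_level \<beta> i"
proof -
  let ?A = "fund_alcove \<Phi> \<alpha>"
  obtain P where P: "alcove_path \<Phi> ?A ((\<lambda>x. x - lam) ` ?A) m P"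
    and walls: "\<forall>i\<in>{1..m}. \<exists>F k. common_wall F (P (i - 1)) (P i) \<and> F \<subseteq> hyp (\<beta> i) k \<and>
               (\<forall>x\<in>P (i - 1). x \<bullet> coroot (\<beta> i) > real_of_int k) \<and>
               (\<forall>x\<in>P i. x \<bullet> coroot (\<beta> i) < real_of_int k)"
    using chain unfolding lambda_chain_def Let_def by blast
  have alc: "P i \<in> alcoves \<Phi>" if "i \<le> m" for i
    using P that by (simp add: alcove_path_def)
  then have "\<forall>i\<in>{..m}. \<exists>x. x \<in> P i"
    using alcove_nonempty by blast
  then obtain x where x: "\<And>i. i \<le> m \<Longrightarrow> x i \<in> P i" by (metis atMost_iff)
  have start: "\<lfloor>x 0 \<bullet> coroot b\<rfloor> = 0" if "b \<in> pos" for b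
  proof -
    have "x 0 \<in> ?A" using x[of 0] P by (simp add: alcove_path_def)
    then show ?thesis using that by (auto simp: fund_alcove_def floor_eq_iff less_imp_le)
  qed
  have notin: "x i \<bullet> coroot b \<notin> \<int>" if "i \<le> m" "b \<in> \<Phi>" for i b
    using alcove_notin_Ints[OF alc x] that by blast
  have fin: "real_of_int \<lfloor>x m \<bullet> coroot b\<rfloor> = real_of_int \<lfloor>x 0 \<bullet> coroot b\<rfloor> - lam \<bullet> coroot b"
    if b: "b \<in> \<Phi>" for b
  proof -
    have "P m = (\<lambda>x. x - lam) ` P 0" using P by (simp add: alcove_path_def)
    then have "x 0 - lam \<in> P m" using x[of 0] by simp
    then have "\<lfloor>x m \<bullet> coroot b\<rfloor> = \<lfloor>(x 0 - lam) \<bullet> coroot b\<rfloor>"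
      using alcove_floor_eq[OF alc x] b by blast
    moreover obtain q where "lam \<bullet> coroot b = of_int q"
      using dominant b Ints_cases[of "lam \<bullet> coroot b"] by (auto simp: dominant_weight_def)
    ultimately show ?thesis
      by (simp add: inner_diff_left)
  qed
  obtain k where
    k1: "\<And>i. i \<in> {1..m} \<Longrightarrow> \<lfloor>x (i - 1) \<bullet> coroot (\<beta> i)\<rfloor> = k i" and
    k2: "\<And>i. i \<in> {1..m} \<Longrightarrow> \<lfloor>x i \<bullet> coroot (\<beta> i)\<rfloor> = k i - 1" and
    k3: "\<And>i d. i \<in> {1..m} \<Longrightarrow> d \<in> \<Phi> \<Longrightarrow> d \<noteq> \<beta> i \<Longrightarrow> d \<noteq> - \<beta> i \<Longrightarrow>
       \<lfloor>x (i - 1) \<bullet> coroot d\<rfloor> = \<lfloor>x i \<bullet> coroot d\<rfloor>" and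
    k4: "\<And>i d. i \<in> {1..m} \<Longrightarrow> d \<in> \<Phi> \<Longrightarrow> d \<noteq> \<beta> i \<Longrightarrow> d \<noteq> - \<beta> i \<Longrightarrow>
       real_of_int \<lfloor>x i \<bullet> coroot (reflection (\<beta> i) d)\<rfloor>
         = of_int \<lfloor>x (i - 1) \<bullet> coroot d\<rfloor> - of_int (k i) * (\<beta> i \<bullet> coroot d)"
  proof -
    have "\<forall>i\<in>{1..m}. \<exists>k. \<lfloor>x (i - 1) \<bullet> coroot (\<beta> i)\<rfloor> = k \<and> \<lfloor>x i \<bullet> coroot (\<beta> i)\<rfloor> = k - 1 \<and>
      (\<forall>d\<in>\<Phi>. d \<noteq> \<beta> i \<longrightarrow> d \<noteq> - \<beta> i \<longrightarrow> \<lfloor>x (i - 1) \<bullet> coroot d\<rfloor> = \<lfloor>x i \<bullet> coroot d\<rfloor> \<and>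
        real_of_int \<lfloor>x i \<bullet> coroot (reflection (\<beta> i) d)\<rfloor>
         = of_int \<lfloor>x (i - 1) \<bullet> coroot d\<rfloor> - of_int k * (\<beta> i \<bullet> coroot d))"
    proof
      fix i assume i: "i \<in> {1..m}"
      then obtain F k where F: "common_wall F (P (i - 1)) (P i)" "F \<subseteq> hyp (\<beta> i) k"
          "\<forall>x\<in>P (i - 1). x \<bullet> coroot (\<beta> i) > real_of_int k"
          "\<forall>x\<in>P i. x \<bullet> coroot (\<beta> i) < real_of_int k"
        using walls by blast
      have A: "P (i - 1) \<in> alcoves \<Phi>" "P i \<in> alcoves \<Phi>" and X: "x (i - 1) \<in> P (i - 1)" "x i \<in> P i"
        using alc x i by auto
      note f = wall_floor[OF A F(1,2) chain_root[OF i] F(3,4) X]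
        wall_floor_other[OF A F(1,2) chain_root[OF i] F(3,4) X]
      show "\<exists>k. \<lfloor>x (i - 1) \<bullet> coroot (\<beta> i)\<rfloor> = k \<and> \<lfloor>x i \<bullet> coroot (\<beta> i)\<rfloor> = k - 1 \<and>
      (\<forall>d\<in>\<Phi>. d \<noteq> \<beta> i \<longrightarrow> d \<noteq> - \<beta> i \<longrightarrow> \<lfloor>x (i - 1) \<bullet> coroot d\<rfloor> = \<lfloor>x i \<bullet> coroot d\<rfloor> \<and>
        real_of_int \<lfloor>x i \<bullet> coroot (reflection (\<beta> i) d)\<rfloor>
         = of_int \<lfloor>x (i - 1) \<bullet> coroot d\<rfloor> - of_int k * (\<beta> i \<bullet> coroot d))"
        by (intro exI[of _ k] conjI ballI impI f)
    qed
    from bchoice[OF this] show ?thesis using that by blast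
  qed
  have neg: "\<lfloor>x i \<bullet> coroot (- d)\<rfloor> = - \<lfloor>x i \<bullet> coroot d\<rfloor> - 1" if "i \<le> m" "d \<in> \<Phi>" for i d
    using floor_minus_notin_Ints[OF notin[OF that]] by simp
  have step: "\<lfloor>x i \<bullet> coroot d\<rfloor> = \<lfloor>x (i - 1) \<bullet> coroot d\<rfloor> - of_bool (d = \<beta> i) + of_bool (d = - \<beta> i)"
    if i: "i \<in> {1..m}" and d: "d \<in> \<Phi>" for i d
  proof -
    have "\<beta> i \<noteq> - \<beta> i" using root_neq_minus[OF chain_root[OF i]] .
    moreover have "i \<le> m" "i - 1 \<le> m" using i by auto
    ultimately show ?thesis
      using k1[OF i] k2[OF i] k3[OF i d] neg[OF _ chain_root[OF i]] by auto
  qed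
  have count: "\<lfloor>x i \<bullet> coroot b\<rfloor> = - int (card {j \<in> {1..<Suc i}. \<beta> j = b})" if "i \<le> m" "b \<in> pos" for i b
    using that(1)
  proof (induction i)
    case 0
    then show ?case using start[OF that(2)] by simp
  next
    case (Suc i)
    have "b \<noteq> - \<beta> (Suc i)"
      using pos_minus[OF chain_root[of "Suc i"]] chain_pos[of "Suc i"] Suc.prems that(2) by auto
    then have s: "\<lfloor>x (Suc i) \<bullet> coroot b\<rfloor> = \<lfloor>x i \<bullet> coroot b\<rfloor> - of_bool (b = \<beta> (Suc i))"
      using step[of "Suc i" b] Suc.prems pos_root[OF that(2)] by simp
    have "{j \<in> {1..<Suc (Suc i)}. \<beta> j = b} =
        (if b = \<beta> (Suc i) then insert (Suc i) {j \<in> {1..<Suc i}. \<beta> j = b} else {j \<in> {1..<Suc i}. \<beta> j = b})"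
      by (auto simp: less_Suc_eq)
    then show ?case
      using s Suc by simp
  qed
  have lev: "\<lfloor>x (i - 1) \<bullet> coroot (\<beta> i)\<rfloor> = - chain_level \<beta> i" if i: "i \<in> {1..m}" for i
  proof -
    have "Suc (i - 1) = i" "i - 1 \<le> m" using i by auto
    then show ?thesis
      using count[of "i - 1" "\<beta> i"] chain_pos[OF i] by (simp add: chain_level_def)
  qed
  have refl: "real_of_int \<lfloor>x i \<bullet> coroot (reflection (\<beta> i) d)\<rfloor> =
       real_of_int \<lfloor>x (i - 1) \<bullet> coroot d\<rfloor> + real_of_int (chain_level \<beta> i) * (\<beta> i \<bullet> coroot d)"
    if i: "i \<in> {1..m}" and d: "d \<in> \<Phi>" for i d
  proof -
    note bR = chain_root[OF i]
    have b2: "\<beta> i \<bullet> coroot (\<beta> i) = 2" "reflection (\<beta> i) (\<beta> i) = - \<beta> i"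
      using root_nonzero[OF bR] by (auto simp: inner_coroot_self reflection_self)
    have im: "i \<le> m" "i - 1 \<le> m" using i by auto
    have kl: "k i = - chain_level \<beta> i" using k1[OF i] lev[OF i] by simp
    consider "d = \<beta> i" | "d = - \<beta> i" | "d \<noteq> \<beta> i" "d \<noteq> - \<beta> i" by blast
    then show ?thesis
    proof cases
      case 1
      have "\<lfloor>x i \<bullet> coroot (- \<beta> i)\<rfloor> = - k i"
        using neg[OF im(1) bR] k2[OF i] by simp
      then show ?thesis
        unfolding 1 b2 using k1[OF i] by (simp add: kl)
    next
      case 2
      have "\<lfloor>x (i - 1) \<bullet> coroot (- \<beta> i)\<rfloor> = - k i - 1"
        using neg[OF im(2) bR] k1[OF i] by simp
      moreover have "\<lfloor>x i \<bullet> coroot (reflection (\<beta> i) (- \<beta> i))\<rfloor> = k i - 1"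
        using k2[OF i] by (simp add: reflection_uminus b2)
      ultimately show ?thesis
        unfolding 2 by (simp only:) (simp add: b2 kl)
    next
      case 3
      then show ?thesis using k4[OF i d] by (simp add: kl)
    qed
  qed
  show thesis
    by (rule that[OF start fin notin step refl lev])
qed

end

lemma hyp_inj: "b \<noteq> 0 \<Longrightarrow> hyp b k = hyp b l \<Longrightarrow> k = l"
proof -
  assume b: "b \<noteq> 0" and e: "hyp b k = hyp b l"
  have "(of_int k / 2) *\<^sub>R b \<in> hyp b k"
    using b by (simp add: hyp_def inner_coroot_self)
  then show "k = l"
    using b unfolding e by (simp add: hyp_def inner_coroot_self)
qed

locale folding = root_chain \<Phi> \<alpha> Ix lam m \<beta>
  for \<Phi> :: "'a::euclidean_space set" and \<alpha> Ix lam m \<beta> +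
  fixes J :: "nat set" and a :: 'a
  assumes J: "J \<subseteq> {1..m}" and a: "a \<in> \<Phi>"
begin

definition w :: "nat \<Rightarrow> 'a \<Rightarrow> 'a" where
  "w i = refl_prod \<beta> {j \<in> J. j < i}"

definition aff :: "nat \<Rightarrow> 'a \<Rightarrow> 'a" where
  "aff i = aff_refl_prod \<beta> {j \<in> J. j < i}"

definition S :: "nat \<Rightarrow> real" where
  "S i = sg (inv (w i) a)"

abbreviation "I \<equiv> ind_set m \<beta> J a"

lemma finite_J: "finite J"
  using J finite_subset by blast

lemma w_Suc: "w (Suc i) = (if i \<in> J then w i \<circ> reflection (\<beta> i) else w i)"
  unfolding w_def by (rule refl_prod_Suc[OF finite_J])

lemma aff_Suc: "aff (Suc i) = (if i \<in> J then aff i \<circ> aff_reflection (\<beta> i) (- chain_level \<beta> i) else aff i)"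
  unfolding aff_def by (rule aff_refl_prod_Suc[OF finite_J])

lemma w_0: "w 0 = id" and aff_0: "aff 0 = id"
  by (simp_all add: w_def aff_def refl_prod_def aff_refl_prod_def)

lemma w_1: "w (Suc 0) = id" and aff_1: "aff (Suc 0) = id"
  using J by (auto simp: w_Suc aff_Suc w_0 aff_0)

lemma below_Suc_m: "{j \<in> J. j < Suc m} = J"
  using J by auto

lemma w_end: "w (Suc m) = refl_prod \<beta> J" and aff_end: "aff (Suc m) = aff_refl_prod \<beta> J"
  by (simp_all add: w_def aff_def below_Suc_m)

lemma J_root: "i \<in> J \<Longrightarrow> \<beta> i \<in> \<Phi>"
  using J chain_root by blast

lemma w_W: "w i \<in> W"
proof (induction i)
  case 0
  show ?case unfolding w_0 by (rule W_id)
next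
  case (Suc i)
  then show ?case by (simp add: w_Suc W_reflection_right J_root)
qed

lemma gam_eq: "gam \<beta> J i = w i (\<beta> i)"
  by (simp add: gam_def w_def)

lemma inv_w_Suc: "inv (w (Suc i)) a = (if i \<in> J then reflection (\<beta> i) (inv (w i) a) else inv (w i) a)"
  by (simp add: w_Suc inv_reflection_right w_W)

lemma inv_w_root: "inv (w i) a \<in> \<Phi>"
  using W_root[OF W_inv[OF w_W] a] .

lemma I_iff: "i \<in> I \<longleftrightarrow> i \<in> {1..m} \<and> (\<beta> i = inv (w i) a \<or> \<beta> i = - inv (w i) a)"
proof -
  have "w i x = y \<longleftrightarrow> x = inv (w i) y" for x y
    using W_inv_apply[OF w_W] by metis
  then show ?thesis
    by (auto simp: ind_set_def gam_eq W_uminus W_inv w_W)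
qed

lemma finite_I: "finite I"
  by (simp add: ind_set_def)

lemma S_cases: "S i = 1 \<or> S i = -1"
  unfolding S_def by (rule sg_cases)

lemma I_eq: "i \<in> I \<Longrightarrow> inv (w i) a = S i *\<^sub>R \<beta> i"
proof -
  assume i: "i \<in> I"
  then have im: "i \<in> {1..m}" and "inv (w i) a = \<beta> i \<or> inv (w i) a = - \<beta> i"
    unfolding I_iff by (auto intro: minus_minus[symmetric])
  then show ?thesis
    using sg_pos[OF chain_pos[OF im]] sg_minus[OF chain_root[OF im]] by (auto simp: S_def)
qed

lemma gam_I: "i \<in> I \<Longrightarrow> gam \<beta> J i = S i *\<^sub>R a"
  using I_eq[of i] S_cases[of i] w_W[of i] unfolding gam_eq
  by (metis W_inv_apply(2) W_uminus minus_minus scaleR_one scaleR_minus1_left)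

lemma S_1: "S (Suc 0) = sg a"
  by (simp add: S_def w_1)

lemma S_notin_J: "i \<notin> J \<Longrightarrow> S (Suc i) = S i"
  by (simp add: S_def inv_w_Suc)

lemma S_in_J: "i \<in> I \<Longrightarrow> i \<in> J \<Longrightarrow> S (Suc i) = - S i"
proof -
  assume i: "i \<in> I" "i \<in> J"
  have "reflection (\<beta> i) (inv (w i) a) = - inv (w i) a"
    using I_eq[OF i(1)] S_cases[of i] root_nonzero[OF J_root[OF i(2)]]
    by (auto simp: reflection_self reflection_uminus)
  then show ?thesis
    using i by (simp add: S_def inv_w_Suc sg_minus inv_w_root)
qed

lemma aff_eq: "aff i x = w i x + aff i 0"
proof (induction i arbitrary: x)
  case 0
  then show ?case by (simp add: w_0 aff_0)
next
  case (Suc i)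
  show ?case
  proof (cases "i \<in> J")
    case True
    have "aff (Suc i) y = w i (reflection (\<beta> i) y) - w i (of_int (chain_level \<beta> i) *\<^sub>R \<beta> i) + aff i 0" for y
      using Suc.IH[of "aff_reflection (\<beta> i) (- chain_level \<beta> i) y"] True
      by (simp add: aff_Suc aff_reflection_eq linear_diff[OF W_linear[OF w_W]])
    then show ?thesis
      using True by (simp add: w_Suc linear_0[OF linear_reflection] linear_0[OF W_linear[OF w_W]])
  next
    case False
    then show ?thesis using Suc.IH[of x] by (simp only: aff_Suc w_Suc if_False)
  qed
qed

lemma aff_Suc_0: "aff (Suc i) 0 = aff i 0 - (if i \<in> J then of_int (chain_level \<beta> i) *\<^sub>R gam \<beta> J i else 0)"
  using aff_eq[of i "- (of_int (chain_level \<beta> i) *\<^sub>R \<beta> i)"]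
  by (simp add: aff_Suc aff_reflection_eq linear_0[OF linear_reflection] gam_eq
      linear_neg[OF W_linear[OF w_W]] linear_cmul[OF W_linear[OF w_W]])

lemma aff_0_coroot_Ints: "d \<in> \<Phi> \<Longrightarrow> aff i 0 \<bullet> coroot d \<in> \<int>"
proof (induction i)
  case 0
  then show ?case by (simp add: aff_0)
next
  case (Suc i)
  have "gam \<beta> J i \<bullet> coroot d \<in> \<int>" if "i \<in> J"
    using inner_coroot_Ints[OF Suc.prems] that by (simp add: gam_eq W_root w_W J_root)
  then show ?case
    using Suc by (auto simp: aff_Suc_0 inner_diff_left intro!: Ints_diff Ints_mult)
qed

lemma signed_level_enat:
  assumes i: "i \<in> I"
  shows "signed_level \<Phi> \<alpha> lam \<beta> J a (enat i) = S i * real_of_int (chain_level \<beta> i) - aff i 0 \<bullet> coroot a"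
proof -
  let ?g = "gam \<beta> J i" and ?l = "chain_level \<beta> i"
  have im: "i \<in> {1..m}" using i by (simp add: ind_set_def)
  have gR: "?g \<in> \<Phi>" using W_root[OF w_W chain_root[OF im]] by (simp add: gam_eq)
  obtain q where q: "aff i 0 \<bullet> coroot ?g = of_int q"
    using aff_0_coroot_Ints[OF gR] by (auto elim: Ints_cases)
  obtain s :: int where s: "sg ?g = of_int s" "s = 1 \<or> s = -1"
  proof -
    show ?thesis
      using sg_cases[of ?g] that[of 1] that[of "-1"] by auto
  qed
  have abs: "root_abs \<Phi> \<alpha> ?g = of_int s *\<^sub>R ?g" by (simp add: root_abs_def s)
  have abs0: "root_abs \<Phi> \<alpha> ?g \<noteq> 0" using s(2) root_nonzero[OF gR] by (auto simp: abs)
  have img: "aff_refl_prod \<beta> {j \<in> J. j < i} ` hyp (\<beta> i) (- ?l) = {y. y \<bullet> coroot ?g = of_int (q - ?l)}"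
  proof -
    have "aff i ` hyp (\<beta> i) (- ?l) = {y. y \<bullet> coroot ?g = of_int (q - ?l)}"
    proof (intro equalityI subsetI)
      fix y assume "y \<in> aff i ` hyp (\<beta> i) (- ?l)"
      then obtain z where "y = aff i z" and zh: "z \<in> hyp (\<beta> i) (- ?l)"
        by blast
      then have z: "y = w i z + aff i 0" "z \<bullet> coroot (\<beta> i) = - of_int ?l"
        using aff_eq[of i z] by (simp_all add: hyp_def)
      have "w i z \<bullet> coroot ?g = z \<bullet> coroot (\<beta> i)"
        by (simp add: gam_eq W_coroot w_W W_inner)
      then show "y \<in> {y. y \<bullet> coroot ?g = of_int (q - ?l)}"
        using z q by (simp add: inner_add_left)
    next
      fix y assume y: "y \<in> {y. y \<bullet> coroot ?g = of_int (q - ?l)}"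
      let ?z = "inv (w i) (y - aff i 0)"
      have "?z \<bullet> coroot (\<beta> i) = (y - aff i 0) \<bullet> coroot ?g"
        using W_adjoint[OF w_W[of i], of "coroot (\<beta> i)" "y - aff i 0"]
        by (simp add: gam_eq W_coroot w_W inner_commute)
      then have "?z \<in> hyp (\<beta> i) (- ?l)"
        using y q by (simp add: hyp_def inner_diff_left)
      moreover have "y = aff i ?z"
        by (subst aff_eq) (simp add: w_W)
      ultimately show "y \<in> aff i ` hyp (\<beta> i) (- ?l)" by blast
    qed
    then show ?thesis by (simp add: aff_def)
  qed
  have sc: "coroot (of_int s *\<^sub>R ?g) = of_int s *\<^sub>R coroot ?g"
    using s(2) by auto
  have h: "hyp (root_abs \<Phi> \<alpha> ?g) (- (s * (?l - q))) = {y. y \<bullet> coroot ?g = of_int (q - ?l)}"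
    using s(2) by (auto simp: hyp_def abs sc)
  have "fold_level \<Phi> \<alpha> \<beta> J i = s * (?l - q)"
    unfolding fold_level_def
  proof (rule the_equality)
    show "hyp (root_abs \<Phi> \<alpha> ?g) (- (s * (?l - q))) = aff_refl_prod \<beta> {j \<in> J. j < i} ` hyp (\<beta> i) (- ?l)"
      using h img by simp
  next
    fix l assume "hyp (root_abs \<Phi> \<alpha> ?g) (- l) = aff_refl_prod \<beta> {j \<in> J. j < i} ` hyp (\<beta> i) (- ?l)"
    then have "hyp (root_abs \<Phi> \<alpha> ?g) (- l) = hyp (root_abs \<Phi> \<alpha> ?g) (- (s * (?l - q)))"
      using h img by simp
    then have "- l = - (s * (?l - q))" using hyp_inj[OF abs0] by blast
    then show "l = s * (?l - q)" by simp
  qed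
  then have sl: "signed_level \<Phi> \<alpha> lam \<beta> J a (enat i) = sg a * (sg ?g * (of_int ?l - aff i 0 \<bullet> coroot ?g))"
    by (simp add: signed_level_def s q)
  from S_cases[of i] show ?thesis
  proof
    assume "S i = 1"
    then show ?thesis using sl gam_I[OF i] sg_cases[of a] by auto
  next
    assume "S i = -1"
    then show ?thesis using sl gam_I[OF i] sg_cases[of a] by (auto simp: sg_minus a)
  qed
qed

lemma signed_level_infinity:
  "signed_level \<Phi> \<alpha> lam \<beta> J a \<infinity> = fold_weight lam \<beta> J \<bullet> coroot a"
  using sg_cases[of a] by (auto simp: signed_level_def)

text \<open>Up to sign, \<open>G i\<close> is the centre of the strip between consecutive hyperplanes orthogonal to \<open>a\<close>
  that contains the folded alcove before step \<open>i\<close>; it is the value of \<open>g\<^sub>a\<close> at the integer points.\<close>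

lemma strip_positions:
  obtains G :: "nat \<Rightarrow> real" where
    "G (Suc 0) = - sg a / 2"
    "\<forall>i\<in>{1..m}. i \<notin> I \<longrightarrow> G (Suc i) = G i"
    "\<forall>i\<in>I. G (Suc i) = G i + S i / 2 + S (Suc i) / 2"
    "\<And>i. i \<in> I \<Longrightarrow> signed_level \<Phi> \<alpha> lam \<beta> J a (enat i) = G i + S i / 2"
    "fold_weight lam \<beta> J \<bullet> coroot a = G (Suc m) + S (Suc m) / 2"
proof -
  obtain x :: "nat \<Rightarrow> 'a" where
    x0: "\<And>b. b \<in> pos \<Longrightarrow> \<lfloor>x 0 \<bullet> coroot b\<rfloor> = 0" and
    xm: "\<And>b. b \<in> \<Phi> \<Longrightarrow> real_of_int \<lfloor>x m \<bullet> coroot b\<rfloor> = real_of_int \<lfloor>x 0 \<bullet> coroot b\<rfloor> - lam \<bullet> coroot b" and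
    notin: "\<And>i b. i \<le> m \<Longrightarrow> b \<in> \<Phi> \<Longrightarrow> x i \<bullet> coroot b \<notin> \<int>" and
    step: "\<And>i d. i \<in> {1..m} \<Longrightarrow> d \<in> \<Phi> \<Longrightarrow>
       \<lfloor>x i \<bullet> coroot d\<rfloor> = \<lfloor>x (i - 1) \<bullet> coroot d\<rfloor> - of_bool (d = \<beta> i) + of_bool (d = - \<beta> i)" and
    refl: "\<And>i d. i \<in> {1..m} \<Longrightarrow> d \<in> \<Phi> \<Longrightarrow> real_of_int \<lfloor>x i \<bullet> coroot (reflection (\<beta> i) d)\<rfloor> =
       real_of_int \<lfloor>x (i - 1) \<bullet> coroot d\<rfloor> + real_of_int (chain_level \<beta> i) * (\<beta> i \<bullet> coroot d)" and
    lev: "\<And>i. i \<in> {1..m} \<Longrightarrow> \<lfloor>x (i - 1) \<bullet> coroot (\<beta> i)\<rfloor> = - chain_level \<beta> i"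
  proof (rule chain_points, goal_cases)
    case (1 x)
    show ?case by (rule 1(1)[OF 1(2-)])
  qed
  define d where "d i = inv (w i) a" for i
  have dR: "d i \<in> \<Phi>" for i unfolding d_def by (rule inv_w_root)
  define G where "G i = - (of_int \<lfloor>x (i - 1) \<bullet> coroot (d i)\<rfloor> + 1 / 2 + aff i 0 \<bullet> coroot a)" for i
  have base: "of_int \<lfloor>x 0 \<bullet> coroot b\<rfloor> + 1 / 2 = sg b / 2" if b: "b \<in> \<Phi>" for b
  proof (cases "b \<in> pos")
    case True
    then show ?thesis using x0 by (simp add: sg_pos)
  next
    case False
    then have "- b \<in> pos" using pos_minus[OF b] by simp
    then have "\<lfloor>x 0 \<bullet> coroot b\<rfloor> = -1"
      using x0[of "- b"] floor_minus_notin_Ints[OF notin[OF le0 b]] by simp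
    then show ?thesis using False sg_eq_m1[of b] by simp
  qed
  have G_J: "G (Suc i) = G i" if i: "i \<in> J" for i
  proof -
    have im: "i \<in> {1..m}" using i J by blast
    have "gam \<beta> J i \<bullet> coroot a = \<beta> i \<bullet> coroot (d i)"
      by (simp add: gam_eq d_def inner_coroot_inv w_W)
    moreover have "d (Suc i) = reflection (\<beta> i) (d i)"
      using i by (simp add: d_def inv_w_Suc)
    ultimately show ?thesis
      using i refl[OF im dR[of i]] by (simp add: G_def aff_Suc_0 inner_diff_left)
  qed
  have G_notJ: "G (Suc i) = G i + of_bool (d i = \<beta> i) - of_bool (d i = - \<beta> i)"
    if i: "i \<notin> J" "i \<in> {1..m}" for i
    using i step[OF i(2) dR[of i]] by (simp add: G_def aff_Suc_0 d_def inv_w_Suc)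
  have I_d: "i \<in> I \<longleftrightarrow> i \<in> {1..m} \<and> (d i = \<beta> i \<or> d i = - \<beta> i)" for i
    by (auto simp: I_iff d_def)
  have dI: "d i = S i *\<^sub>R \<beta> i" if "i \<in> I" for i
    using I_eq[OF that] by (simp add: d_def)
  show thesis
  proof (rule that[of G])
    show "G (Suc 0) = - sg a / 2"
      using base[OF a] by (simp add: G_def d_def w_1 aff_1)
  next
    have "G (Suc i) = G i" if "i \<in> {1..m}" "i \<notin> I" for i
      using G_J[of i] G_notJ[of i] that by (cases "i \<in> J") (auto simp: I_d)
    then show "\<forall>i\<in>{1..m}. i \<notin> I \<longrightarrow> G (Suc i) = G i" by blast
  next
    show "\<forall>i\<in>I. G (Suc i) = G i + S i / 2 + S (Suc i) / 2"
    proof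
      fix i assume i: "i \<in> I"
      then have im: "i \<in> {1..m}" by (simp add: ind_set_def)
      have "\<beta> i \<noteq> - \<beta> i" using root_neq_minus[OF chain_root[OF im]] .
      then show "G (Suc i) = G i + S i / 2 + S (Suc i) / 2"
        using G_J[of i] G_notJ[of i] i im S_in_J[of i] S_notin_J[of i] dI[OF i] S_cases[of i]
        by (cases "i \<in> J") auto
    qed
  next
    fix i assume i: "i \<in> I"
    then have im: "i \<in> {1..m}" "i - 1 \<le> m" by (auto simp: ind_set_def)
    have "G i = S i * of_int (chain_level \<beta> i) - S i / 2 - aff i 0 \<bullet> coroot a"
      using S_cases[of i] lev[OF im(1)] floor_minus_notin_Ints[OF notin[OF im(2) chain_root[OF im(1)]]]
      by (auto simp: G_def dI[OF i])
    then show "signed_level \<Phi> \<alpha> lam \<beta> J a (enat i) = G i + S i / 2"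
      using signed_level_enat[OF i] by simp
  next
    have "fold_weight lam \<beta> J = w (Suc m) lam - aff (Suc m) 0"
      using aff_eq[of "Suc m" "- lam"] by (simp add: fold_weight_def aff_end[symmetric] W_uminus w_W)
    then have "fold_weight lam \<beta> J \<bullet> coroot a = lam \<bullet> coroot (d (Suc m)) - aff (Suc m) 0 \<bullet> coroot a"
      by (simp add: inner_diff_left d_def inner_coroot_inv w_W)
    then show "fold_weight lam \<beta> J \<bullet> coroot a = G (Suc m) + S (Suc m) / 2"
      using xm[OF dR[of "Suc m"]] base[OF dR[of "Suc m"]] by (simp add: G_def S_def d_def)
  qed
qed

end

subsection \<open>Admissible subsets\<close>

lemma take_sorted_list_of_set:
  fixes J :: "nat set"
  assumes "finite J" "q < length (sorted_list_of_set J)"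
  shows "take q (sorted_list_of_set J) = sorted_list_of_set {j \<in> J. j < sorted_list_of_set J ! q}"
proof -
  let ?js = "sorted_list_of_set J"
  have lt: "p < r \<Longrightarrow> r < length ?js \<Longrightarrow> ?js ! p < ?js ! r" for p r
    using sorted_wrt_nth_less[OF strict_sorted_list_of_set] .
  have "set (take q ?js) = {j \<in> J. j < ?js ! q}"
  proof (intro equalityI subsetI)
    fix j assume "j \<in> set (take q ?js)"
    then obtain p where "p < q" "j = ?js ! p"
      using assms(2) by (auto simp: in_set_conv_nth)
    then show "j \<in> {j \<in> J. j < ?js ! q}"
      using lt[of p q] assms nth_mem[of p ?js] by auto
  next
    fix j assume j: "j \<in> {j \<in> J. j < ?js ! q}"
    then obtain p where p: "p < length ?js" "j = ?js ! p"
      using assms(1) by (metis (no_types, lifting) in_set_conv_nth mem_Collect_eq set_sorted_list_of_set)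
    then have "p < q"
      using lt[of q p] j by (metis (no_types, lifting) linorder_neqE_nat mem_Collect_eq order.asym)
    then show "j \<in> set (take q ?js)"
      using p assms(2) by (auto simp: in_set_conv_nth)
  qed
  then show ?thesis
    using assms(1)
    by (intro sorted_distinct_set_unique) (auto simp: sorted_wrt_take)
qed

lemma admissible_iff:
  "admissible \<Phi> \<alpha> m \<beta> J \<longleftrightarrow> J \<subseteq> {1..m} \<and>
    (\<forall>j\<in>J. qbg_edge \<Phi> \<alpha> (refl_prod \<beta> {i \<in> J. i < j}) (\<beta> j) (refl_prod \<beta> {i \<in> J. i < j} \<circ> reflection (\<beta> j)))"
proof (cases "J \<subseteq> {1..m}")
  case True
  then have fin: "finite J" using finite_subset by blast
  let ?js = "sorted_list_of_set J"
  let ?w = "\<lambda>q. comp_list (map (\<lambda>j. reflection (\<beta> j)) (take q ?js))"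
  have w: "?w q = refl_prod \<beta> {i \<in> J. i < ?js ! q}" if "q < length ?js" for q
    by (simp add: refl_prod_def take_sorted_list_of_set[OF fin that])
  have wS: "?w (Suc q) = ?w q \<circ> reflection (\<beta> (?js ! q))" if "q < length ?js" for q
    using that by (simp add: take_Suc_conv_app_nth comp_list_append)
  have "(\<forall>q<length ?js. qbg_edge \<Phi> \<alpha> (?w q) (\<beta> (?js ! q)) (?w (Suc q))) \<longleftrightarrow>
      (\<forall>q<length ?js. (\<lambda>j. qbg_edge \<Phi> \<alpha> (refl_prod \<beta> {i \<in> J. i < j}) (\<beta> j)
        (refl_prod \<beta> {i \<in> J. i < j} \<circ> reflection (\<beta> j))) (?js ! q))"
    by (intro all_cong1 imp_cong refl) (simp only: w wS)
  also have "\<dots> \<longleftrightarrow> (\<forall>j\<in>set ?js. qbg_edge \<Phi> \<alpha> (refl_prod \<beta> {i \<in> J. i < j}) (\<beta> j)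
        (refl_prod \<beta> {i \<in> J. i < j} \<circ> reflection (\<beta> j)))"
    by (simp only: all_set_conv_all_nth)
  finally show ?thesis
    using True fin by (simp add: admissible_def Let_def)
qed (simp add: admissible_def)

locale admissible_folding = folding \<Phi> \<alpha> Ix lam m \<beta> J a
  for \<Phi> :: "'a::euclidean_space set" and \<alpha> Ix lam m \<beta> J a +
  assumes admJ: "admissible \<Phi> \<alpha> m \<beta> J" and affine: "affine_simple a"
begin

lemma edge: "j \<in> J \<Longrightarrow> qbg_edge \<Phi> \<alpha> (w j) (\<beta> j) (w j \<circ> reflection (\<beta> j))"
  using admJ by (simp add: admissible_iff w_def)

lemma S_persist:
  assumes "j \<in> {1..m}" "j \<notin> I" "S j = 1"
  shows "S (Suc j) = 1"
proof (cases "j \<in> J")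
  case True
  show ?thesis
  proof (rule ccontr)
    assume "S (Suc j) \<noteq> 1"
    then have "inv (w j \<circ> reflection (\<beta> j)) a \<notin> pos"
      using True by (simp add: S_def sg_eq_1 w_Suc)
    moreover have "inv (w j) a \<in> pos"
      using assms by (simp add: S_def sg_eq_1)
    ultimately have "\<beta> j = inv (w j) a"
      using qbg_edge_sign_change[OF affine edge[OF True]] by blast
    then show False using assms by (auto simp: I_iff)
  qed
qed (use assms S_notin_J in simp)

lemma S_persist_le:
  assumes "i \<le> j" "1 \<le> i" "j \<le> Suc m" "\<And>l. i \<le> l \<Longrightarrow> l < j \<Longrightarrow> l \<notin> I" "S i = 1"
  shows "S j = 1"
  using assms(1,3,4)
proof (induction j rule: dec_induct)
  case base
  then show ?case using assms by simp
next
  case (step j)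
  then show ?case using S_persist[of j] assms(2) by simp
qed

lemma reflection_I: "i \<in> I \<Longrightarrow> w i \<circ> reflection (\<beta> i) = reflection a \<circ> w i"
  using W_reflection_conj[OF w_W, of i "\<beta> i"] gam_I[of i] S_cases[of i] by (auto simp: gam_eq)

text \<open>\<open>N = Suc m\<close> stands for the index \<open>\<infinity>\<close>.\<close>

context
  fixes k N :: nat and J' :: "nat set"
  assumes k: "k \<in> I" and kN: "k < N" and N: "N \<in> I \<or> N = Suc m"
    and gap: "\<And>j. k < j \<Longrightarrow> j < N \<Longrightarrow> j \<notin> I"
    and J': "J' \<subseteq> {1..m}"
    and toggle: "\<And>j. j \<le> m \<Longrightarrow> j \<in> J' \<longleftrightarrow> (if j = k \<or> j = N then j \<notin> J else j \<in> J)"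
begin

abbreviation "w' i \<equiv> refl_prod \<beta> {j \<in> J'. j < i}"

lemma w'_Suc: "w' (Suc i) = (if i \<in> J' then w' i \<circ> reflection (\<beta> i) else w' i)"
  by (rule refl_prod_Suc) (use J' finite_subset in blast)

lemma N_le: "N \<le> Suc m" and k_range: "k \<in> {1..m}"
  using N k by (auto simp: ind_set_def)

lemma w'_below: "i \<le> k \<Longrightarrow> w' i = w i"
proof (induction i)
  case 0
  then show ?case by (simp add: w_def)
next
  case (Suc i)
  then show ?case using toggle[of i] kN k_range by (simp add: w'_Suc w_Suc fun_eq_iff)
qed

lemma w'_between:
  assumes "k < i" "i \<le> N"
  shows "w' i = reflection a \<circ> w i"
proof -
  have "Suc k \<le> i" using assms by simp
  then show ?thesis
    using assms(2)
  proof (induction i rule: dec_induct)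
    case base
    have "k \<in> J' \<longleftrightarrow> k \<notin> J" using toggle[of k] k_range by simp
    then show ?case
      using w'_below[of k] reflection_I[OF k] by (cases "k \<in> J") (simp_all add: w'_Suc w_Suc)
  next
    case (step i)
    have "i \<in> J' \<longleftrightarrow> i \<in> J" using toggle[of i] step N_le by simp
    then show ?case
      using step by (simp add: w'_Suc w_Suc fun_eq_iff)
  qed
qed

lemma w'_above:
  assumes "N < i" "i \<le> Suc m"
  shows "w' i = w i"
proof -
  have NI: "N \<in> I" "N \<le> m" using N assms by auto
  have "Suc N \<le> i" using assms by simp
  then show ?thesis
    using assms(2)
  proof (induction i rule: dec_induct)
    case base
    have "N \<in> J' \<longleftrightarrow> N \<notin> J" using toggle[of N] NI by simp
    then show ?case
      using w'_between[of N] kN reflection_I[OF NI(1)]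
      by (cases "N \<in> J") (simp_all add: w'_Suc w_Suc comp_assoc)
  next
    case (step i)
    have "i \<in> J' \<longleftrightarrow> i \<in> J" using toggle[of i] step kN by simp
    then show ?case
      using step by (simp add: w'_Suc w_Suc fun_eq_iff)
  qed
qed

lemma admissible_toggle:
  assumes kS: "k \<notin> J \<Longrightarrow> S k = 1"
    and const: "\<And>j. k < j \<Longrightarrow> j < N \<Longrightarrow> S (Suc j) = S j"
    and NS: "N \<in> I \<Longrightarrow> N \<notin> J \<Longrightarrow> S N = -1"
  shows "admissible \<Phi> \<alpha> m \<beta> J'"
  unfolding admissible_iff
proof (intro conjI ballI J')
  fix j assume j: "j \<in> J'"
  then have jm: "j \<in> {1..m}" using J' by blast
  consider "j < k" | "j = k" | "k < j" "j < N" | "j = N" | "N < j" by linarith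
  then show "qbg_edge \<Phi> \<alpha> (w' j) (\<beta> j) (w' j \<circ> reflection (\<beta> j))"
  proof cases
    case 1
    then show ?thesis using edge[of j] toggle[of j] j jm kN w'_below[of j] by simp
  next
    case 2
    then have "k \<notin> J" using toggle[of k] j jm by simp
    then have b: "\<beta> k = inv (w k) a" using kS I_eq[OF k] by simp
    then have "inv (w k) a \<in> pos" using chain_pos[OF k_range] by simp
    from qbg_edge_left[OF affine w_W this] show ?thesis
      using 2 w'_below[of k] reflection_I[OF k] b by simp
  next
    case 3
    then have jJ: "j \<in> J" using toggle[of j] j jm by simp
    have "inv (w j) a \<in> pos \<longleftrightarrow> inv (w j \<circ> reflection (\<beta> j)) a \<in> pos"
      using const[OF 3] jJ by (simp add: S_def w_Suc flip: sg_eq_1)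
    moreover have "\<beta> j \<noteq> inv (w j) a" "\<beta> j \<noteq> - inv (w j) a"
      using gap[OF 3] jm by (auto simp: I_iff)
    ultimately have "qbg_edge \<Phi> \<alpha> (reflection a \<circ> w j) (\<beta> j) (reflection a \<circ> w j \<circ> reflection (\<beta> j))"
      by (rule qbg_edge_left_mult[OF affine edge[OF jJ]])
    then show ?thesis using w'_between[of j] 3 by simp
  next
    case 4
    then have NI: "N \<in> I" "N \<notin> J" using N toggle[of N] j jm by auto
    let ?v = "reflection a \<circ> w N"
    have v: "?v \<in> W" using W_reflection_left[OF w_W a] .
    have "inv ?v a = \<beta> N"
      using NS[OF NI] I_eq[OF NI(1)] w_W[of N] root_nonzero[OF a]
      by (simp add: inv_reflection_left reflection_self W_uminus W_inv)
    moreover have "\<beta> N \<in> pos" using chain_pos jm 4 by simp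
    ultimately have "qbg_edge \<Phi> \<alpha> ?v (\<beta> N) (reflection a \<circ> ?v)"
      using qbg_edge_left[OF affine v] by simp
    moreover have "?v \<circ> reflection (\<beta> N) = reflection a \<circ> ?v"
      using reflection_I[OF NI(1)] by (simp add: comp_assoc)
    ultimately show ?thesis using w'_between[of N] kN 4 by simp
  next
    case 5
    then have "j \<in> J" using toggle[of j] j jm kN by simp
    then show ?thesis using edge[of j] w'_above[of j] 5 jm by simp
  qed
qed

end

end

context folding
begin

subsection \<open>The piecewise-linear function\<close>

abbreviation "g \<equiv> g_fun \<Phi> \<alpha> m \<beta> J a"

lemma ind_set_minus: "ind_set m \<beta> J (- x) = ind_set m \<beta> J x"
  by (auto simp: ind_set_def)

lemma g_eq: "g x = sg a * g_pos \<Phi> \<alpha> m \<beta> J (sg a *\<^sub>R a) x"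
  by (auto simp: g_fun_def root_sgn_def)

lemma I_abs: "ind_set m \<beta> J (sg a *\<^sub>R a) = I"
  using sg_cases[of a] by (auto simp: ind_set_minus)

lemma nth_I: "k < card I \<Longrightarrow> sorted_list_of_set I ! k \<in> I"
  using nth_mem[of k "sorted_list_of_set I"] finite_I by simp

lemma S_end: "S (Suc m) = sgn (gam_inf \<Phi> \<alpha> \<beta> J \<bullet> coroot a)"
proof -
  have "gam_inf \<Phi> \<alpha> \<beta> J = w (Suc m) (rho \<Phi> \<alpha>)" by (simp add: gam_inf_def w_end)
  then have "gam_inf \<Phi> \<alpha> \<beta> J \<bullet> coroot a = rho \<Phi> \<alpha> \<bullet> coroot (inv (w (Suc m)) a)"
    by (simp add: inner_coroot_inv w_W)
  then show ?thesis
    using sgn_rho_coroot[OF inv_w_root[of "Suc m"]] by (simp add: S_def)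
qed

definition slope :: "nat \<Rightarrow> real" where
  "slope q = (if q < 2 * card I then
      (let i = sorted_list_of_set I ! (q div 2) in if even q then S i else S (Suc i)) else S (Suc m))"

lemma slope_eq: "slope q = sg a * g_slope \<Phi> \<alpha> m \<beta> J (sg a *\<^sub>R a) q"
proof (cases "q < 2 * card I")
  case True
  let ?i = "sorted_list_of_set I ! (q div 2)"
  have i: "?i \<in> I" using True by (intro nth_I) simp
  have "sg (gam \<beta> J ?i) = S ?i * sg a"
    using gam_I[OF i] S_cases[of ?i] by (auto simp: sg_minus a)
  moreover have "S (Suc ?i) = fold_sign J ?i * S ?i"
    using S_in_J[OF i] S_notin_J[of ?i] by (auto simp: fold_sign_def)
  ultimately show ?thesis
    using True sg_cases[of a] by (auto simp: slope_def g_slope_def I_abs Let_def)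
next
  case False
  then show ?thesis
    using sg_cases[of a] by (auto simp: slope_def g_slope_def I_abs Let_def S_end)
qed

lemma g_0: "g 0 = - sg a / 2"
  by (simp add: g_eq g_pos_0)

lemma g_step:
  assumes "q \<le> 2 * card I" "real q / 2 \<le> x" "x \<le> y" "y \<le> (real q + 1) / 2"
  shows "g y = g x + slope q * (y - x)"
proof -
  let ?g = "g_pos \<Phi> \<alpha> m \<beta> J (sg a *\<^sub>R a)"
  have e: "?g y = ?g x + g_slope \<Phi> \<alpha> m \<beta> J (sg a *\<^sub>R a) q * (y - x)"
    using g_pos_slope[of q m \<beta> J "sg a *\<^sub>R a" x y \<Phi> \<alpha>] assms by (simp add: I_abs)
  show ?thesis
    unfolding g_eq slope_eq e by (simp add: distrib_left mult.assoc)
qed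

lemma nth_sorted_I:
  assumes "i \<in> I"
  shows "sorted_list_of_set I ! card {j \<in> I. j < i} = i" "card {j \<in> I. j < i} < card I"
proof -
  let ?js = "sorted_list_of_set I"
  obtain p where p: "p < length ?js" "?js ! p = i"
    using assms finite_I by (metis in_set_conv_nth set_sorted_list_of_set)
  have "length (take p ?js) = card {j \<in> I. j < i}"
    using take_sorted_list_of_set[OF finite_I p(1)] p(2) by simp
  then have "card {j \<in> I. j < i} = p" using p(1) by simp
  then show "?js ! card {j \<in> I. j < i} = i" "card {j \<in> I. j < i} < card I"
    using p by auto
qed

context
  fixes G :: "nat \<Rightarrow> real"
  assumes G1: "G (Suc 0) = - sg a / 2"
    and Goff': "\<forall>i\<in>{1..m}. i \<notin> I \<longrightarrow> G (Suc i) = G i"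
    and Gon': "\<forall>i\<in>I. G (Suc i) = G i + S i / 2 + S (Suc i) / 2"
begin

lemmas Goff = Goff'[rule_format] and Gon = Gon'[rule_format]

abbreviation "L i \<equiv> G i + S i / 2"
abbreviation "Ih \<equiv> insert (Suc m) I"

lemma I_range: "i \<in> I \<Longrightarrow> i \<in> {1..m}"
  by (simp add: ind_set_def)

lemma g_half:
  assumes "i \<in> I"
  shows "g (real (card {j \<in> I. j < i}) + 1 / 2) = g (real (card {j \<in> I. j < i})) + S i / 2"
  using g_step[of "2 * card {j \<in> I. j < i}" "real (card {j \<in> I. j < i})" "real (card {j \<in> I. j < i}) + 1 / 2"]
    nth_sorted_I[OF assms]
  by (simp add: slope_def)

lemma G_eq_g: "i \<in> {1..Suc m} \<Longrightarrow> G i = g (real (card {j \<in> I. j < i}))"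
proof (induction i)
  case 0
  then show ?case by simp
next
  case (Suc i)
  show ?case
  proof (cases "i = 0")
    case True
    have e: "{j \<in> I. j < Suc 0} = {}" by (auto simp: ind_set_def)
    show ?thesis unfolding True e using G1 g_0 by simp
  next
    case False
    then have im: "i \<in> {1..m}" and IH: "G i = g (real (card {j \<in> I. j < i}))"
      using Suc by auto
    show ?thesis
    proof (cases "i \<in> I")
      case True
      let ?k = "card {j \<in> I. j < i}"
      have "{j \<in> I. j < Suc i} = insert i {j \<in> I. j < i}" using True by auto
      then have c: "card {j \<in> I. j < Suc i} = Suc ?k" using finite_I by simp
      have "slope (2 * ?k + 1) = S (Suc i)"
        using nth_sorted_I[OF True] by (simp add: slope_def)
      then have "g (real ?k + 1) = g (real ?k + 1 / 2) + S (Suc i) / 2"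
        using g_step[of "2 * ?k + 1" "real ?k + 1 / 2" "real ?k + 1"] nth_sorted_I[OF True]
        by (simp add: field_simps)
      then show ?thesis
        using g_half[OF True] IH Gon[OF True] c by (simp add: add.commute)
    next
      case False
      have "{j \<in> I. j < Suc i} = {j \<in> I. j < i}" using False by (auto simp: less_Suc_eq)
      then show ?thesis using IH Goff[OF im False] by simp
    qed
  qed
qed

lemma L_eq_g:
  assumes "i \<in> Ih"
  shows "L i = g (real (card {j \<in> I. j < i}) + 1 / 2)"
proof (cases "i \<in> I")
  case True
  then show ?thesis using g_half[OF True] G_eq_g[of i] I_range by force
next
  case False
  then have i: "i = Suc m" using assms by simp
  have c: "{j \<in> I. j < Suc m} = I" by (auto simp: ind_set_def)
  show ?thesis
    using g_step[of "2 * card I" "real (card I)" "real (card I) + 1 / 2"] G_eq_g[of "Suc m"]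
    unfolding i c by (simp add: slope_def)
qed

lemma Ih_card: "k \<le> card I \<Longrightarrow> \<exists>i\<in>Ih. card {j \<in> I. j < i} = k"
proof -
  assume k: "k \<le> card I"
  have c: "{j \<in> I. j < Suc m} = I" by (auto simp: ind_set_def)
  show ?thesis
  proof (cases "k = card I")
    case True
    then show ?thesis using c by (intro bexI[of _ "Suc m"]) auto
  next
    case False
    then have l: "k < length (sorted_list_of_set I)" using k finite_I by simp
    then have "sorted_list_of_set I ! k \<in> I" using nth_I by simp
    moreover have "card {j \<in> I. j < sorted_list_of_set I ! k} = length (take k (sorted_list_of_set I))"
      using take_sorted_list_of_set[OF finite_I l] by simp
    ultimately show ?thesis using l by (intro bexI[of _ "sorted_list_of_set I ! k"]) auto
  qed
qed

lemma Ih_card_le: "i \<in> Ih \<Longrightarrow> card {j \<in> I. j < i} \<le> card I"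
  using finite_I by (intro card_mono) auto

lemma g_max_props:
  defines "M \<equiv> g_max \<Phi> \<alpha> m \<beta> J a"
  shows "\<forall>i\<in>Ih. G i \<le> M" "\<forall>i\<in>Ih. L i \<le> M" "\<exists>i\<in>Ih. M = G i \<or> M = L i"
proof -
  let ?n = "card I" and ?X = "{0 .. real (card I) + 1 / 2}"
  let ?V = "(\<lambda>q. g (real q / 2)) ` {..2 * ?n + 1}"
  have V: "finite ?V" "?V \<noteq> {}" by auto
  have "?V \<subseteq> g ` ?X" by (auto intro!: imageI)
  then have mem: "Max ?V \<in> g ` ?X" using Max_in[OF V] by blast
  have le: "g x \<le> Max ?V" if x: "x \<in> ?X" for x
  proof -
    define q where "q = min (nat \<lfloor>2 * x\<rfloor>) (2 * ?n)"
    have q: "q \<le> 2 * ?n" "real q / 2 \<le> x" "x \<le> (real q + 1) / 2"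
      using x unfolding q_def by (auto simp: min_def) linarith+
    have 1: "g x = g (real q / 2) + slope q * (x - real q / 2)"
      by (rule g_step) (use q in auto)
    have 2: "g ((real q + 1) / 2) = g x + slope q * ((real q + 1) / 2 - x)"
      by (rule g_step) (use q in auto)
    have "g (real q / 2) \<le> Max ?V" by (rule Max_ge) (use q in auto)
    moreover have "g (real (Suc q) / 2) \<le> Max ?V"
      by (rule Max_ge[OF V(1)], rule image_eqI[OF refl]) (use q in auto)
    moreover have "g x \<le> g (real q / 2) \<or> g x \<le> g ((real q + 1) / 2)"
    proof (cases "0 \<le> slope q")
      case True
      then have "0 \<le> slope q * ((real q + 1) / 2 - x)" using q by simp
      then show ?thesis using 2 by simp
    next
      case False
      then have "slope q * (x - real q / 2) \<le> 0" using q by (simp add: mult_nonpos_nonneg)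
      then show ?thesis using 1 by simp
    qed
    ultimately show ?thesis by (auto simp: add.commute)
  qed
  have M: "M = Max ?V"
    unfolding M_def g_max_def using mem le by (intro cSup_eq_maximum) auto
  have "G i \<le> M" if i: "i \<in> Ih" for i
  proof -
    have "i \<in> {1..Suc m}" using i I_range by fastforce
    from G_eq_g[OF this] show ?thesis
      using le[of "real (card {j \<in> I. j < i})"] Ih_card_le[OF i] unfolding M by simp
  qed
  then show "\<forall>i\<in>Ih. G i \<le> M" by blast
  have "L i \<le> M" if i: "i \<in> Ih" for i
    using le[of "real (card {j \<in> I. j < i}) + 1 / 2"] Ih_card_le[OF i]
    unfolding M L_eq_g[OF i] by simp
  then show "\<forall>i\<in>Ih. L i \<le> M" by blast
  obtain q where q: "q \<le> 2 * ?n + 1" "M = g (real q / 2)"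
  proof -
    have "M \<in> ?V" unfolding M by (rule Max_in[OF V])
    then show ?thesis using that by auto
  qed
  then have "q div 2 \<le> ?n" by linarith
  then obtain i where i: "i \<in> Ih" "card {j \<in> I. j < i} = q div 2"
    using Ih_card by blast
  have i1: "i \<in> {1..Suc m}" using i I_range by fastforce
  show "\<exists>i\<in>Ih. M = G i \<or> M = L i"
  proof (cases "even q")
    case True
    then have "real (q div 2) = real q / 2" by (auto elim!: evenE)
    then have "M = G i" using G_eq_g[OF i1] i(2) q(2) by metis
    then show ?thesis using i by blast
  next
    case False
    then have "real (q div 2) + 1 / 2 = real q / 2" by (auto elim!: oddE)
    then have "M = L i" using L_eq_g[OF i(1)] i(2) q(2) by metis
    then show ?thesis using i by blast
  qed
qed

end

end

context admissible_folding
begin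

subsection \<open>The crystal operators\<close>

context
  fixes G :: "nat \<Rightarrow> real" and M :: real
  assumes G1: "G (Suc 0) = - sg a / 2"
    and Goff': "\<forall>i\<in>{1..m}. i \<notin> I \<longrightarrow> G (Suc i) = G i"
    and Gon': "\<forall>i\<in>I. G (Suc i) = G i + S i / 2 + S (Suc i) / 2"
    and GM': "\<forall>i\<in>Ih. G i \<le> M"
    and LM': "\<forall>i\<in>Ih. G i + S i / 2 \<le> M"
    and attained: "\<exists>i\<in>Ih. M = G i \<or> M = G i + S i / 2"
begin

lemmas Goff = Goff'[rule_format] and Gon = Gon'[rule_format]
  and GM = GM'[rule_format] and LM = LM'[rule_format]

lemma Ih_range: "i \<in> Ih \<Longrightarrow> i \<in> {1..Suc m}"
  by (auto simp: ind_set_def)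

lemma G_const:
  assumes "i \<le> j" "1 \<le> i" "j \<le> Suc m" "\<And>l. i \<le> l \<Longrightarrow> l < j \<Longrightarrow> l \<notin> I"
  shows "G j = G i"
  using assms(1,3,4)
proof (induction j rule: dec_induct)
  case (step j)
  then show ?case using Goff[of j] assms(2) by simp
qed simp

lemma next_index:
  assumes "i \<in> {1..Suc m}"
  obtains n where "n \<in> Ih" "i \<le> n" "G n = G i" "S i = 1 \<Longrightarrow> S n = 1"
proof -
  define n where "n = (LEAST n. n \<in> Ih \<and> i \<le> n)"
  have n: "n \<in> Ih" "i \<le> n"
    using LeastI[of "\<lambda>n. n \<in> Ih \<and> i \<le> n" "Suc m"] assms unfolding n_def by auto
  have gap: "l \<notin> I" if "i \<le> l" "l < n" for l
    using not_less_Least[of l "\<lambda>n. n \<in> Ih \<and> i \<le> n"] that unfolding n_def by auto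
  have "n \<le> Suc m" using Ih_range[OF n(1)] by simp
  then show thesis
    using that[of n] n G_const[OF n(2)] S_persist_le[OF n(2)] gap assms by force
qed

lemma previous_index:
  assumes "i \<in> {1..Suc m}"
  obtains (none) "\<And>l. l \<in> I \<Longrightarrow> \<not> l < i" "G i = - sg a / 2" "sg a = 1 \<Longrightarrow> S i = 1"
  | (some) k where "k \<in> I" "k < i" "\<And>l. l \<in> I \<Longrightarrow> l < i \<Longrightarrow> l \<le> k" "G i = G (Suc k)"
      "S (Suc k) = 1 \<Longrightarrow> S i = 1"
proof (cases "\<exists>l\<in>I. l < i")
  case False
  then have "G i = G 1" "S 1 = 1 \<Longrightarrow> S i = 1"
    using G_const[of 1 i] S_persist_le[of 1 i] assms by auto
  then show thesis
    using False G1 S_1 none by auto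
next
  case True
  let ?A = "{l \<in> I. l < i}"
  define k where "k = Max ?A"
  have fin: "finite ?A" using finite_I by simp
  have k: "k \<in> ?A" unfolding k_def using True by (intro Max_in fin) auto
  have le: "l \<le> k" if "l \<in> I" "l < i" for l
    unfolding k_def using that by (intro Max_ge fin) auto
  have gap: "l \<notin> I" if "Suc k \<le> l" "l < i" for l
    using le[of l] that by auto
  have "G i = G (Suc k)" "S (Suc k) = 1 \<Longrightarrow> S i = 1"
    using G_const[of "Suc k" i] S_persist_le[of "Suc k" i] gap k assms by auto
  then show thesis
    using some[of k] k le by auto
qed

lemma level_attained:
  assumes "(1 - sg a) / 2 \<le> M"
  shows "\<exists>i\<in>Ih. L G i = M"
proof -
  obtain i where i: "i \<in> Ih" "M = G i \<or> M = L G i" using attained by blast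
  show ?thesis
  proof (cases "M = L G i")
    case False
    then have Mi: "M = G i" using i by simp
    then have Si: "S i = -1" using LM[OF i(1)] S_cases[of i] by auto
    show ?thesis
    proof (rule previous_index[OF Ih_range[OF i(1)]])
      assume "G i = - sg a / 2" "sg a = 1 \<Longrightarrow> S i = 1"
      then show ?thesis using assms Mi Si sg_cases[of a] by auto
    next
      fix k assume k: "k \<in> I" "G i = G (Suc k)" "S (Suc k) = 1 \<Longrightarrow> S i = 1"
      then have "S (Suc k) = -1" using Si S_cases[of "Suc k"] by auto
      then show ?thesis using k Gon[OF k(1)] LM[of k] Mi by auto
    qed
  qed (use i in auto)
qed

lemma f_indices:
  assumes M: "(1 - sg a) / 2 < M"
  obtains n k where "n \<in> Ih" "L G n = M" "\<And>j. j \<in> Ih \<Longrightarrow> L G j = M \<Longrightarrow> n \<le> j"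
    "k \<in> I" "k < n" "\<And>j. j \<in> I \<Longrightarrow> j < n \<Longrightarrow> j \<le> k"
    "k \<notin> J" "S k = 1" "n \<in> I \<Longrightarrow> n \<in> J"
proof -
  define n where "n = (LEAST n. n \<in> Ih \<and> L G n = M)"
  have n: "n \<in> Ih" "L G n = M"
    using LeastI_ex[of "\<lambda>n. n \<in> Ih \<and> L G n = M"] level_attained M unfolding n_def by auto
  have least: "n \<le> j" if "j \<in> Ih" "L G j = M" for j
    unfolding n_def using that by (intro Least_le) simp
  have Sn: "S n = 1" using GM[OF n(1)] n(2) S_cases[of n] by auto
  have nJ: "n \<in> J" if "n \<in> I"
  proof (rule ccontr)
    assume nJ: "n \<notin> J"
    have "Suc n \<in> {1..Suc m}" using that by (auto simp: ind_set_def)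
    then obtain n' where n': "n' \<in> Ih" "G n' = G (Suc n)"
      by (rule next_index)
    have "G (Suc n) = M + 1 / 2" using Gon[OF that] n(2) Sn S_notin_J[OF nJ] by simp
    then show False using GM[OF n'(1)] n'(2) by simp
  qed
  show thesis
  proof (rule previous_index[OF Ih_range[OF n(1)]])
    assume "G n = - sg a / 2"
    then show thesis using n(2) Sn M by (simp add: field_simps)
  next
    fix k assume k: "k \<in> I" "k < n" "\<And>l. l \<in> I \<Longrightarrow> l < n \<Longrightarrow> l \<le> k" "G n = G (Suc k)"
    have lk: "L G k \<noteq> M" using least[of k] k by auto
    have e: "L G k = M - 1 / 2 - S (Suc k) / 2"
      using Gon[OF k(1)] k(4) n(2) Sn by simp
    have SSk: "S (Suc k) = 1" using e lk S_cases[of "Suc k"] by auto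
    have Sk: "S k = 1"
    proof (rule ccontr)
      assume "S k \<noteq> 1"
      then have Sk: "S k = -1" using S_cases[of k] by auto
      then have Gk: "G k = M - 1 / 2" using e SSk by simp
      have "k \<in> Ih" using k by simp
      show False
      proof (rule previous_index[OF Ih_range[OF \<open>k \<in> Ih\<close>]])
        assume "G k = - sg a / 2" "sg a = 1 \<Longrightarrow> S k = 1"
        then show False using Gk Sk M sg_cases[of a] by auto
      next
        fix k' assume k': "k' \<in> I" "k' < k" "G k = G (Suc k')" "S (Suc k') = 1 \<Longrightarrow> S k = 1"
        then have "S (Suc k') = -1" using Sk S_cases[of "Suc k'"] by auto
        then have "L G k' = M" using Gon[OF k'(1)] k'(3) Gk by simp
        then show False using least[of k'] k' k(2) by auto
      qed
    qed
    have "k \<notin> J" using S_in_J[OF k(1)] Sk SSk by auto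
    then show thesis using that[of n k] n least k Sk nJ by blast
  qed
qed

lemma e_indices:
  assumes M: "(1 - sg a) / 2 \<le> M" and M_end: "L G (Suc m) < M"
  obtains k N where "k \<in> I" "L G k = M" "\<And>j. j \<in> I \<Longrightarrow> L G j = M \<Longrightarrow> j \<le> k"
    "N \<in> Ih" "k < N" "\<And>j. j \<in> Ih \<Longrightarrow> k < j \<Longrightarrow> N \<le> j"
    "k \<in> J" "S N = -1" "N \<in> I \<Longrightarrow> N \<notin> J"
proof -
  let ?A = "{i \<in> I. L G i = M}"
  define k where "k = Max ?A"
  have fin: "finite ?A" using finite_I by simp
  have "?A \<noteq> {}" using level_attained[OF M] M_end by auto
  then have k: "k \<in> I" "L G k = M" using Max_in[OF fin] unfolding k_def by auto
  have kmax: "j \<le> k" if "j \<in> I" "L G j = M" for j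
    unfolding k_def using that by (intro Max_ge fin) auto
  have kr: "Suc k \<in> {1..Suc m}" using k by (auto simp: ind_set_def)
  have Sk: "S k = 1" using GM[of k] k S_cases[of k] by auto
  have SSk: "S (Suc k) = -1"
  proof (rule ccontr)
    assume "S (Suc k) \<noteq> -1"
    then have s: "S (Suc k) = 1" using S_cases[of "Suc k"] by auto
    obtain n' where n': "n' \<in> Ih" "G n' = G (Suc k)"
      using next_index[OF kr] .
    then show False using GM[OF n'(1)] Gon[OF k(1)] k(2) s by simp
  qed
  have kJ: "k \<in> J" using S_notin_J[of k] Sk SSk by auto
  define N where "N = (LEAST n. n \<in> Ih \<and> k < n)"
  have N: "N \<in> Ih" "k < N"
    using LeastI[of "\<lambda>n. n \<in> Ih \<and> k < n" "Suc m"] kr unfolding N_def by auto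
  have Nle: "N \<le> j" if "j \<in> Ih" "k < j" for j
    unfolding N_def using that by (intro Least_le) simp
  have GN: "G N = G (Suc k)"
    using G_const[of "Suc k" N] N Nle Ih_range[OF N(1)] by force
  have lt: "L G j \<noteq> M" if "j \<in> Ih" "k < j" for j
    using kmax[of j] that M_end by auto
  have GN': "G N = M - 1 / 2" using GN Gon[OF k(1)] k(2) SSk by simp
  have SN: "S N = -1" using GN' lt[OF N] S_cases[of N] by auto
  have "N \<notin> J" if NI: "N \<in> I"
  proof
    assume "N \<in> J"
    then have s: "S (Suc N) = 1" using S_in_J[OF NI] SN by simp
    have g: "G (Suc N) = M - 1 / 2" using Gon[OF NI] GN' SN s by simp
    have "Suc N \<in> {1..Suc m}" using NI by (auto simp: ind_set_def)
    then show False
    proof (rule next_index)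
      fix n' assume n': "n' \<in> Ih" "Suc N \<le> n'" "G n' = G (Suc N)" "S (Suc N) = 1 \<Longrightarrow> S n' = 1"
      then have "L G n' = M" using g s by simp
      then show False using lt[of n'] n' N by simp
    qed
  qed
  then show thesis using that[of k N] k kmax N Nle kJ SN by blast
qed

end

abbreviation "hat n \<equiv> (if n = Suc m then \<infinity> else enat n)"

lemma hat_less_iff: "i \<le> Suc m \<Longrightarrow> j \<le> Suc m \<Longrightarrow> hat i < hat j \<longleftrightarrow> i < j"
  and hat_le_iff: "i \<le> Suc m \<Longrightarrow> j \<le> Suc m \<Longrightarrow> hat i \<le> hat j \<longleftrightarrow> i \<le> j"
  by auto

lemma ind_set_hat_eq: "ind_set_hat m \<beta> J a = (\<lambda>n. hat n) ` insert (Suc m) I"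
proof -
  have "(\<lambda>n. hat n) ` I = enat ` I"
    by (rule image_cong) (auto simp: ind_set_def)
  then show ?thesis
    unfolding ind_set_hat_def image_insert by (simp only: if_True refl)
qed

lemma exchange_iff: "x \<in> exchange J i j \<longleftrightarrow> x \<in> J \<and> enat x \<noteq> i \<or> enat x = j"
  by (auto simp: exchange_def)

lemma admissible_exchange:
  assumes k: "k \<in> I" and kn: "k < n" and n: "n \<in> insert (Suc m) I"
    and gap: "\<And>j. k < j \<Longrightarrow> j < n \<Longrightarrow> j \<notin> I"
    and J': "\<And>x. x \<in> J' \<longleftrightarrow> x \<in> J \<and> enat x \<noteq> i \<or> enat x = j"
    and ij: "k \<notin> J \<and> S k = 1 \<and> (n \<in> I \<longrightarrow> n \<in> J) \<and> i = hat n \<and> j = enat k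
      \<or> k \<in> J \<and> S n = -1 \<and> (n \<in> I \<longrightarrow> n \<notin> J) \<and> i = enat k \<and> j = hat n"
  shows "admissible \<Phi> \<alpha> m \<beta> J'"
proof -
  have km: "k \<in> {1..m}" using k by (simp add: ind_set_def)
  have nm: "n \<in> I" if "n \<le> m" using n that by auto
  have nI: "n \<in> {1..m}" if "n \<in> I" using that by (simp add: ind_set_def)
  have nS: "n \<le> Suc m" using n nI by auto
  have sub: "J' \<subseteq> {1..m}"
  proof
    fix x assume "x \<in> J'"
    then have "x \<in> J \<or> x = k \<or> enat x = hat n" using ij by (auto simp: J')
    then show "x \<in> {1..m}" using J km nI n by (auto split: if_splits)
  qed
  show ?thesis
  proof (rule admissible_toggle[OF k kn _ gap sub])
    show "n \<in> I \<or> n = Suc m" using n by auto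
  next
    fix x assume x: "x \<le> m"
    have h: "enat x = hat n \<longleftrightarrow> x = n" using x by auto
    have 1: "x \<in> J' \<longleftrightarrow> x \<in> J \<and> x \<noteq> n \<or> x = k" if "i = hat n" "j = enat k"
      unfolding J' that h by simp
    have 2: "x \<in> J' \<longleftrightarrow> x \<in> J \<and> x \<noteq> k \<or> x = n" if "i = enat k" "j = hat n"
      unfolding J' that h by simp
    consider "k \<notin> J" "n \<in> I \<longrightarrow> n \<in> J" "x \<in> J' \<longleftrightarrow> x \<in> J \<and> x \<noteq> n \<or> x = k"
      | "k \<in> J" "n \<in> I \<longrightarrow> n \<notin> J" "x \<in> J' \<longleftrightarrow> x \<in> J \<and> x \<noteq> k \<or> x = n"
      using ij 1 2 by blast
    then show "x \<in> J' \<longleftrightarrow> (if x = k \<or> x = n then x \<notin> J else x \<in> J)"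
      using x nm kn by cases auto
  next
    show "S k = 1" if "k \<notin> J" using ij that by blast
  next
    show "S n = -1" if "n \<in> I" "n \<notin> J" using ij that by blast
  next
    fix l assume l: "k < l" "l < n"
    have persist: "S j = 1" if "i \<le> j" "k < i" "j \<le> n" "S i = 1" for i j
      using S_persist_le[of i j] that gap nS by force
    show "S (Suc l) = S l"
    proof (cases "k \<in> J")
      case False
      then have "S (Suc k) = 1" using ij S_notin_J[of k] by simp
      then show ?thesis using persist[of "Suc k" l] persist[of "Suc k" "Suc l"] l by simp
    next
      case True
      then have "S n = -1" using ij by blast
      then have "S l \<noteq> 1" "S (Suc l) \<noteq> 1"
        using persist[of l n] persist[of "Suc l" n] l by auto
      then show ?thesis using S_cases by metis
    qed
  qed
qed

lemma crystal_operators_admissible: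
  defines "M \<equiv> g_max \<Phi> \<alpha> m \<beta> J a" and "H \<equiv> ind_set_hat m \<beta> J a"
    and "sl \<equiv> signed_level \<Phi> \<alpha> lam \<beta> J a"
  shows "(1 - sg a) / 2 < M \<Longrightarrow> admissible \<Phi> \<alpha> m \<beta>
      (exchange J (LEAST i. i \<in> H \<and> sl i = M) (Max {k \<in> H. k < (LEAST i. i \<in> H \<and> sl i = M)}))"
    and "(1 - sg a) / 2 \<le> M \<Longrightarrow> fold_weight lam \<beta> J \<bullet> coroot a < M \<Longrightarrow> admissible \<Phi> \<alpha> m \<beta>
      (exchange J (Max {i \<in> H - {\<infinity>}. sl i = M}) (Min {i \<in> H. Max {i \<in> H - {\<infinity>}. sl i = M} < i}))"
proof -
  obtain G :: "nat \<Rightarrow> real" where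
    G: "G (Suc 0) = - sg a / 2"
    "\<forall>i\<in>{1..m}. i \<notin> I \<longrightarrow> G (Suc i) = G i"
    "\<forall>i\<in>I. G (Suc i) = G i + S i / 2 + S (Suc i) / 2" and
    lev: "\<And>i. i \<in> I \<Longrightarrow> signed_level \<Phi> \<alpha> lam \<beta> J a (enat i) = G i + S i / 2" and
    lev_end: "fold_weight lam \<beta> J \<bullet> coroot a = G (Suc m) + S (Suc m) / 2"
  proof (rule strip_positions, goal_cases)
    case (1 G)
    show ?case by (rule 1(1)[OF 1(2-)])
  qed
  note max = g_max_props[OF G, folded M_def]
  let ?Ih = "insert (Suc m) I"
  have Ih: "i \<le> Suc m" if "i \<in> ?Ih" for i using that by (auto simp: ind_set_def)
  have H: "H = (\<lambda>n. hat n) ` ?Ih" unfolding H_def by (rule ind_set_hat_eq)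
  have finH: "finite H" unfolding H using finite_I by simp
  have H_fin: "H - {\<infinity>} = enat ` I" unfolding H_def ind_set_hat_def by auto
  have sl: "sl (hat i) = G i + S i / 2" if "i \<in> ?Ih" for i
    using that lev[of i] lev_end signed_level_infinity by (auto simp: sl_def ind_set_def)
  show "admissible \<Phi> \<alpha> m \<beta>
      (exchange J (LEAST i. i \<in> H \<and> sl i = M) (Max {k \<in> H. k < (LEAST i. i \<in> H \<and> sl i = M)}))"
    if M: "(1 - sg a) / 2 < M"
  proof -
    obtain n k where n: "n \<in> ?Ih" "G n + S n / 2 = M"
        "\<And>j. j \<in> ?Ih \<Longrightarrow> G j + S j / 2 = M \<Longrightarrow> n \<le> j"
      and k: "k \<in> I" "k < n" "\<And>j. j \<in> I \<Longrightarrow> j < n \<Longrightarrow> j \<le> k"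
        "k \<notin> J" "S k = 1" "n \<in> I \<Longrightarrow> n \<in> J"
    proof (rule f_indices[OF G max M], goal_cases)
      case (1 n k)
      show ?case by (rule 1(1)[OF 1(2-)])
    qed
    have least: "(LEAST i. i \<in> H \<and> sl i = M) = hat n"
    proof (rule Least_equality)
      show "hat n \<in> H \<and> sl (hat n) = M" using n(1,2) sl[OF n(1)] unfolding H by blast
    next
      fix y assume y: "y \<in> H \<and> sl y = M"
      then obtain j where j: "j \<in> ?Ih" "y = hat j" unfolding H by blast
      then have "n \<le> j" using n(3)[OF j(1)] sl[OF j(1)] y by simp
      then show "hat n \<le> y" unfolding j(2) hat_le_iff[OF Ih[OF n(1)] Ih[OF j(1)]] .
    qed
    have kI: "k \<in> ?Ih" and kh: "hat k = enat k" using k(1) by (auto simp: ind_set_def)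
    have "Max {i \<in> H. i < hat n} = hat k"
    proof (rule Max_eqI)
      show "hat k \<in> {i \<in> H. i < hat n}"
        using hat_less_iff[of k n] Ih[OF kI] Ih[OF n(1)] k(2) kI unfolding H by blast
    next
      fix y assume y: "y \<in> {i \<in> H. i < hat n}"
      then obtain j where j: "j \<in> ?Ih" "y = hat j" unfolding H by blast
      then have "j < n" using y hat_less_iff[OF Ih[OF j(1)] Ih[OF n(1)]] by simp
      moreover from this have "j \<in> I" using j(1) Ih[OF n(1)] by auto
      ultimately have "j \<le> k" using k(3) by blast
      then show "y \<le> hat k" unfolding j(2) hat_le_iff[OF Ih[OF j(1)] Ih[OF kI]] .
    qed (use finH in simp)
    then show ?thesis
      unfolding least kh
      by (intro admissible_exchange[OF k(1,2) n(1) _ exchange_iff]) (use k in \<open>auto simp: not_le[symmetric]\<close>)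
  qed
  show "admissible \<Phi> \<alpha> m \<beta>
      (exchange J (Max {i \<in> H - {\<infinity>}. sl i = M}) (Min {i \<in> H. Max {i \<in> H - {\<infinity>}. sl i = M} < i}))"
    if M: "(1 - sg a) / 2 \<le> M" "fold_weight lam \<beta> J \<bullet> coroot a < M"
  proof -
    obtain k n where k: "k \<in> I" "G k + S k / 2 = M" "\<And>j. j \<in> I \<Longrightarrow> G j + S j / 2 = M \<Longrightarrow> j \<le> k"
      and n: "n \<in> ?Ih" "k < n" "\<And>j. j \<in> ?Ih \<Longrightarrow> k < j \<Longrightarrow> n \<le> j"
        "k \<in> J" "S n = -1" "n \<in> I \<Longrightarrow> n \<notin> J"
    proof (rule e_indices[OF G max M(1) M(2)[unfolded lev_end]], goal_cases)
      case (1 k n)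
      show ?case by (rule 1(1)[OF 1(2-)])
    qed
    have kI: "k \<in> ?Ih" and kh: "hat k = enat k" using k(1) by (auto simp: ind_set_def)
    have max: "Max {i \<in> H - {\<infinity>}. sl i = M} = enat k"
    proof (rule Max_eqI)
      show "enat k \<in> {i \<in> H - {\<infinity>}. sl i = M}"
        using k(1,2) lev[OF k(1)] by (simp add: H_fin sl_def)
    next
      fix y assume y: "y \<in> {i \<in> H - {\<infinity>}. sl i = M}"
      then obtain j where "j \<in> I" "y = enat j" unfolding H_fin by blast
      then show "y \<le> enat k" using y k(3)[of j] lev[of j] by (simp add: sl_def)
    qed (use finH in simp)
    have "Min {i \<in> H. hat k < i} = hat n"
    proof (rule Min_eqI)
      show "hat n \<in> {i \<in> H. hat k < i}"
        using hat_less_iff[of k n] Ih[OF kI] Ih[OF n(1)] n(1,2) unfolding H by blast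
    next
      fix y assume y: "y \<in> {i \<in> H. hat k < i}"
      then obtain j where j: "j \<in> ?Ih" "y = hat j" unfolding H by blast
      then have "k < j" using y hat_less_iff[OF Ih[OF kI] Ih[OF j(1)]] by simp
      then have "n \<le> j" using n(3) j(1) by blast
      then show "hat n \<le> y" unfolding j(2) hat_le_iff[OF Ih[OF n(1)] Ih[OF j(1)]] .
    qed (use finH in simp)
    then show ?thesis
      unfolding max kh
      by (intro admissible_exchange[OF k(1) n(2,1) _ exchange_iff])
        (use n in \<open>auto simp: not_le[symmetric]\<close>)
  qed
qed

end

theorem theorem3p8:
  fixes \<Phi> :: "'a::euclidean_space set" and \<alpha> :: "nat \<Rightarrow> 'a" and lam :: 'a
    and m :: nat and \<beta> :: "nat \<Rightarrow> 'a" and J :: "nat set" and p :: nat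
  assumes "irreducible_root_system \<Phi>"
    and "simple_roots \<Phi> \<alpha>"
    and "dominant_weight \<Phi> \<alpha> lam"
    and "lambda_chain \<Phi> \<alpha> lam m \<beta>"
    and "admissible \<Phi> \<alpha> m \<beta> J"
    and "p \<in> {0..DIM('a)}"
  shows "(\<forall>J'. f_op \<Phi> \<alpha> lam m \<beta> p J = Some J' \<longrightarrow> admissible \<Phi> \<alpha> m \<beta> J') \<and>
         (\<forall>J'. e_op \<Phi> \<alpha> lam m \<beta> p J = Some J' \<longrightarrow> admissible \<Phi> \<alpha> m \<beta> J')"
proof -
  let ?a = "affine_simple_root \<Phi> \<alpha> p"
  interpret root_base \<Phi> \<alpha> "{1..DIM('a)}"
    using assms by unfold_locales auto
  have aff: "affine_simple ?a"
    by (rule affine_simple_affine_simple_root[OF assms(6)])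
  interpret admissible_folding \<Phi> \<alpha> "{1..DIM('a)}" lam m \<beta> J ?a
    using assms aff affine_simple_root_in[OF aff]
    by unfold_locales (auto simp: admissible_iff)
  note adm = crystal_operators_admissible[unfolded sg_affine_simple_root[OF assms(6)]]
  show ?thesis
    unfolding f_op_def e_op_def Let_def using adm by (auto split: if_splits)
qed

end
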